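(* Let $\widetilde{\Pi}=(\widetilde{\mathsf{Prove}},\widetilde{\mathsf{Verify}})$ be the protocol defined in the context, with $t=t(\lambda)$ polynomially bounded. Then $\widetilde{\Pi}$ satisfies worst-case correctness: for any function $H:[t]\times\Sigma\to\{0,1\}^n$, $$\Pr\left[\widetilde{\mathsf{Verify}}^{H}(1^\lambda,\widetilde{\pi})=\bot:\widetilde{\pi}\leftarrow\widetilde{\mathsf{Prove}}^{H}(1^\lambda)\right]\le\mathrm{negl}(\lambda).$$
   Context: Codes. Fix constants $0<c<c'<1$ and a family of codes $C=C_\lambda\subseteq\Sigma^n$ with $\Sigma=\mathbb{F}_q^m$ ($q=p^r$ a prime power), $C$ an $\mathbb{F}_q$-linear subspace of $\Sigma^n\cong\mathbb{F}_q^{nm}$, $|\Sigma|=2^{\lambda^{\Theta(1)}}$, $n=\Theta(\lambda)$, $|C|\ge2^{n+\lambda}$, explicit (polynomial-time computable description), such that: (1) $C$ is $(\zeta,\ell,L)$-list recoverable with $\zeta=\Omega(1)$, $\ell=2^{\lambda^c}$, $L=2^{\tilde O(\lambda^{c'})}$, i.e. for all $S_i\subseteq\Sigma$ with $|S_i|\le\ell$ ($i\in[n]$), at most $L$ codewords $\mathbf{x}\in C$ satisfy $|\{i:\mathbf{x}_i\in S_i\}|\ge(1-\zeta)n$; (2) there is an efficient deterministic algorithm $\mathsf{Decode}_{C^\perp}$ for the dual code $C^\perp=\{\mathbf{z}\in\Sigma^n:\mathbf{x}\cdot\mathbf{z}=0\ \forall\mathbf{x}\in C\}$ with $\Pr_{\mathbf{e}\leftarrow\mathcal{D}^n}[\forall\mathbf{x}\in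 C^\perp,\ \mathsf{Decode}_{C^\perp}(\mathbf{x}+\mathbf{e})=\mathbf{x}]=1-2^{-\Omega(\lambda)}$, where $\mathcal{D}$ on $\Sigma$ is $\mathbf{0}$ with probability $1/2$ and otherwise uniform on $\Sigma\setminus\{\mathbf{0}\}$. Base protocol $\Pi=(\mathsf{Prove},\mathsf{Verify})$, with oracle $G:\Sigma\to\{0,1\}^n$, $G_i$ denoting the $i$-th output bit. $\mathsf{Prove}^{G}(1^\lambda)$: for each $i\in[n]$, generate $|\phi_i\rangle\propto\sum_{\mathbf{e}_i\in\Sigma:G_i(\mathbf{e}_i)=1}|\mathbf{e}_i\rangle$ by preparing a uniform superposition over $\Sigma$, coherently evaluating $G_i$ with a query, and measuring its value, succeeding on outcome $1$, with at most $\lambda$ trials (abort if all fail). Let $|\phi\rangle=|\phi_1\rangle\otimes\cdots\otimes|\phi_n\rangle$ and $|\psi\rangle\propto\sum_{\mathbf{x}\in C}|\mathbf{x}\rangle$. Apply $\mathsf{QFT}_\Sigma^{\otimes n}$ to each of $|\psi\rangle,|\phi\rangle$, where $\mathsf{QFT}_\Sigma|\mathbf{x}\rangle=|\Sigma|^{-1/2}\sum_{\mathbf{z}\in\Sigma}\omega_p^{\mathrm{Tr}(\mathbf{x}\cdot\mathbf{z})}|\mathbf{z}\rangle$, $\omega_p=e^{2\pi i/p}$, $\mathrm{Tr}:\mathbb{F}_q\to\mathbb{F}_p$ the field trace. Apply $|\mathbf{x}\rangle|\mathbf{e}\rangle\mapsto|\mathbf{x}\rangle|\mathbf{x}+\mathbf{e}\rangle$,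 then $|\mathbf{x}\rangle|\mathbf{z}\rangle\mapsto|\mathbf{x}-\mathsf{Decode}_{C^\perp}(\mathbf{z})\rangle|\mathbf{z}\rangle$, then $I\otimes(\mathsf{QFT}_\Sigma^{-1})^{\otimes n}$; measure the second register and output the outcome $\pi=\mathbf{x}\in\Sigma^n$. $\mathsf{Verify}^{G}(1^\lambda,\pi)$: parse $\pi=(\mathbf{x}_1,\dots,\mathbf{x}_n)$; output $\top$ iff $\pi\in C$ and $G_i(\mathbf{x}_i)=1$ for all $i\in[n]$. Modified protocol $\widetilde{\Pi}$. Let $H:[t]\times\Sigma\to\{0,1\}^n$, $H^{(j)}(x)=H(j\|x)$, and let $\mathcal{F}=\{f_K:\Sigma\to\{0,1\}^n\}_{K\in\mathcal{K}}$ be a family of efficiently computable $2(\lambda n+1)$-wise independent hash functions. Put $\widetilde{H}^{(j)}_K(x)=H^{(j)}(x)\oplus f_K(x)$. $\widetilde{\mathsf{Prove}}^{H}(1^\lambda)$: choose $K\leftarrow\mathcal{K}$ uniformly, run $\pi^{(j)}\leftarrow\mathsf{Prove}^{\widetilde{H}^{(j)}_K}(1^\lambda)$ for $j\in[t]$, output $\widetilde{\pi}=(K,\{\pi^{(j)}\}_{j\in[t]})$. $\widetilde{\mathsf{Verify}}^{H}(1^\lambda,\widetilde{\pi})$: output $\top$ iff $\mathsf{Verify}^{\widetilde{H}^{(j)}_K}(1^\lambda,\pi^{(j)})=\top$ for all $j\in[t]$. QFTs are treated as exact. *)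

theory Defs
  imports
    "HOL-Probability.Probability"
    "HOL-Algebra.Module"
    "HOL-Library.Landau_Symbols"
begin

section \<open>Codes over \<open>\<Sigma> = \<bbbF>\<^sub>q\<^sup>m\<close>\<close>

text \<open>
  Indices are counted from 0: \<open>[n]\<close> is \<open>{..<n}\<close>. A symbol is a function on the coordinates
  \<open>j < m\<close>, a word a function on the positions \<open>i < n\<close>; both are \<open>undefined\<close> elsewhere.
\<close>

type_synonym 'f symbol = "nat \<Rightarrow> 'f"
type_synonym 'f word = "nat \<Rightarrow> 'f symbol"

text \<open>The data attached to one value of the security parameter.\<close>

record 'f code_data =
  fld  :: "'f ring"                  \<comment> \<open>the field with \<open>q = p ^ r\<close> elements\<close>
  chr  :: nat                        \<comment> \<open>\<open>p\<close>\<close>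
  deg  :: nat                        \<comment> \<open>\<open>r\<close>\<close>
  slen :: nat                        \<comment> \<open>\<open>m\<close>\<close>
  blen :: nat                        \<comment> \<open>\<open>n\<close>\<close>
  code :: "'f word set"              \<comment> \<open>\<open>C\<close>\<close>
  dec  :: "'f word \<Rightarrow> 'f word"       \<comment> \<open>\<open>Decode\<close> for the dual code\<close>

definition alphabet :: "'f code_data \<Rightarrow> 'f symbol set" where
  "alphabet P = {..<slen P} \<rightarrow>\<^sub>E carrier (fld P)"

definition words :: "'f code_data \<Rightarrow> 'f word set" where
  "words P = {..<blen P} \<rightarrow>\<^sub>E alphabet P"

definition zero_symbol :: "'f code_data \<Rightarrow> 'f symbol" where
  "zero_symbol P = (\<lambda>j\<in>{..<slen P}. \<zero>\<^bsub>fld P\<^esub>)"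

text \<open>
  The vector space \<open>\<Sigma>\<^sup>n = \<bbbF>\<^sub>q\<^sup>n\<^sup>m\<close>. Records of type \<open>module\<close> extend those of rings, so
  there are two multiplicative fields that play no role here.
\<close>

definition word_space :: "'f code_data \<Rightarrow> ('f, 'f word) module" where
  "word_space P =
     \<lparr>carrier = words P,
      monoid.mult = undefined,
      one = undefined,
      zero = (\<lambda>i\<in>{..<blen P}. zero_symbol P),
      add = (\<lambda>x y. \<lambda>i\<in>{..<blen P}. \<lambda>j\<in>{..<slen P}. x i j \<oplus>\<^bsub>fld P\<^esub> y i j),
      smult = (\<lambda>a x. \<lambda>i\<in>{..<blen P}. \<lambda>j\<in>{..<slen P}. a \<otimes>\<^bsub>fld P\<^esub> x i j)\<rparr>"

definition dot :: "'f code_data \<Rightarrow> 'f symbol \<Rightarrow> 'f symbol \<Rightarrow> 'f" where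
  "dot P x z = (\<Oplus>\<^bsub>fld P\<^esub>j\<in>{..<slen P}. x j \<otimes>\<^bsub>fld P\<^esub> z j)"

definition dual_code :: "'f code_data \<Rightarrow> 'f word set" where
  "dual_code P = {z \<in> words P. \<forall>x\<in>code P.
     (\<Oplus>\<^bsub>fld P\<^esub>i\<in>{..<blen P}. dot P (x i) (z i)) = \<zero>\<^bsub>fld P\<^esub>}"

definition list_recoverable :: "'f code_data \<Rightarrow> real \<Rightarrow> real \<Rightarrow> real \<Rightarrow> bool" where
  "list_recoverable P \<zeta> ll L \<longleftrightarrow>
     (\<forall>S. (\<forall>i<blen P. S i \<subseteq> alphabet P \<and> real (card (S i)) \<le> ll) \<longrightarrow>
        real (card {x \<in> code P. real (card {i. i < blen P \<and> x i \<in> S i}) \<ge> (1 - \<zeta>) * real (blen P)}) \<le> L)"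

definition noise :: "'f code_data \<Rightarrow> 'f symbol pmf" where
  "noise P = do {
     b \<leftarrow> bernoulli_pmf (1/2);
     if b then return_pmf (zero_symbol P) else pmf_of_set (alphabet P - {zero_symbol P})}"

definition decoding_prob :: "'f code_data \<Rightarrow> real" where
  "decoding_prob P =
     measure_pmf.prob (Pi_pmf {..<blen P} undefined (\<lambda>_. noise P))
       {e. \<forall>x\<in>dual_code P. dec P (x \<oplus>\<^bsub>word_space P\<^esub> e) = x}"

text \<open>
  The structural conditions. The primality of \<open>p\<close> together with \<open>|\<bbbF>\<^sub>q| = p\<^sup>r\<close> makes \<open>p\<close> the
  characteristic.
\<close>

definition code_data_ok :: "'f code_data \<Rightarrow> bool" where
  "code_data_ok P \<longleftrightarrow>
     field (fld P) \<and> prime (chr P) \<and> 0 < deg P \<and> card (carrier (fld P)) = chr P ^ deg P \<and>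
     0 < slen P \<and> 0 < blen P \<and>
     submodule (code P) (fld P) (word_space P) \<and>
     dec P \<in> words P \<rightarrow> words P"


section \<open>Quantum states and measurements\<close>

text \<open>
  A pure state of a register with computational basis in \<open>'b\<close> is its amplitude function, which
  has finite support. Operators are given by the images of the basis states and extended linearly.
\<close>

type_synonym 'b state = "'b \<Rightarrow> complex"

definition ket :: "'b \<Rightarrow> 'b state" where
  "ket x = (\<lambda>y. if y = x then 1 else 0)"

definition uniform_state :: "'b set \<Rightarrow> 'b state" where
  "uniform_state A = (\<lambda>x. if x \<in> A then complex_of_real (1 / sqrt (real (card A))) else 0)"

definition lin_ext :: "('a \<Rightarrow> 'b state) \<Rightarrow> 'a state \<Rightarrow> 'b state" where
  "lin_ext U \<psi> = (\<lambda>y. \<Sum>x | \<psi> x \<noteq> 0. \<psi> x * U x y)"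

definition tensor :: "'a state \<Rightarrow> 'b state \<Rightarrow> ('a \<times> 'b) state" (infixr "\<otimes>\<^sub>q" 70) where
  "\<psi> \<otimes>\<^sub>q \<phi> = (\<lambda>(x, y). \<psi> x * \<phi> y)"

definition tensor_n :: "nat \<Rightarrow> (nat \<Rightarrow> 'b state) \<Rightarrow> (nat \<Rightarrow> 'b) state" where
  "tensor_n n \<phi> = (\<lambda>x. if x \<in> extensional {..<n} then \<Prod>i<n. \<phi> i (x i) else 0)"

text \<open>
  Projective measurement of the observable \<open>f\<close> of the basis label (e.g. \<open>snd\<close> measures the second
  register), returning the outcome and the renormalised post-measurement state. The basis label
  drawn in the first line is only used through \<open>f\<close>, so that outcome \<open>a\<close> has probability
  \<open>\<Sum>b | f b = a. |\<psi> b|\<^sup>2\<close>.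
\<close>

definition post_state :: "('b \<Rightarrow> 'o) \<Rightarrow> 'b state \<Rightarrow> 'o \<Rightarrow> 'b state" where
  "post_state f \<psi> a =
     (\<lambda>b. if f b = a
          then \<psi> b / complex_of_real (sqrt (\<Sum>b' | \<psi> b' \<noteq> 0 \<and> f b' = a. (cmod (\<psi> b'))\<^sup>2)) else 0)"

definition qmeasure :: "('b \<Rightarrow> 'o) \<Rightarrow> 'b state \<Rightarrow> ('o \<times> 'b state) pmf" where
  "qmeasure f \<psi> = do {
     b \<leftarrow> embed_pmf (\<lambda>b. (cmod (\<psi> b))\<^sup>2);
     return_pmf (f b, post_state f \<psi> (f b))}"


section \<open>The quantum Fourier transform over \<open>\<Sigma>\<close>\<close>

definition field_trace :: "'f code_data \<Rightarrow> 'f \<Rightarrow> 'f" where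
  "field_trace P a = (\<Oplus>\<^bsub>fld P\<^esub>i\<in>{..<deg P}. a [^]\<^bsub>fld P\<^esub> (chr P ^ i))"

text \<open>
  \<open>\<omega>\<^sub>p ^ Tr a\<close>, where \<open>Tr a\<close>, an element \<open>k \<cdot> 1\<close> of the prime subfield, is identified with
  the residue \<open>k\<close> modulo \<open>p\<close>.
\<close>

definition omega_trace :: "'f code_data \<Rightarrow> 'f \<Rightarrow> complex" where
  "omega_trace P a =
     cis (2 * pi / real (chr P)) ^ (LEAST k::nat. field_trace P a = [k] \<cdot>\<^bsub>fld P\<^esub> \<one>\<^bsub>fld P\<^esub>)"

definition qft :: "'f code_data \<Rightarrow> 'f symbol \<Rightarrow> 'f symbol state" where
  "qft P x = (\<lambda>z. if z \<in> alphabet P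
                   then omega_trace P (dot P x z) / complex_of_real (sqrt (real (card (alphabet P)))) else 0)"

definition qft_inv :: "'f code_data \<Rightarrow> 'f symbol \<Rightarrow> 'f symbol state" where
  "qft_inv P z = inv_into {\<psi>. \<forall>x. \<psi> x \<noteq> 0 \<longrightarrow> x \<in> alphabet P} (lin_ext (qft P)) (ket z)"

definition qft_n :: "'f code_data \<Rightarrow> 'f word \<Rightarrow> 'f word state" where
  "qft_n P x = tensor_n (blen P) (\<lambda>i. qft P (x i))"

definition qft_inv_n :: "'f code_data \<Rightarrow> 'f word \<Rightarrow> 'f word state" where
  "qft_inv_n P z = tensor_n (blen P) (\<lambda>i. qft_inv P (z i))"


section \<open>The base protocol\<close>

text \<open>Oracles map symbols to bit strings; \<open>G x i\<close> is the bit \<open>G\<^sub>i(x)\<close>.\<close>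

type_synonym bits = "nat \<Rightarrow> bool"
type_synonym 'f oracle_fun = "'f symbol \<Rightarrow> bits"

definition bit_strings :: "nat \<Rightarrow> bits set" where
  "bit_strings n = {..<n} \<rightarrow>\<^sub>E UNIV"

text \<open>
  One trial at preparing \<open>|\<phi>\<^sub>i\<rangle>\<close>, and up to \<open>k\<close> repetitions of it; \<open>None\<close> is failure. After
  outcome \<open>1\<close> the measured bit is in the state \<open>|1\<rangle>\<close> and is dropped.
\<close>

definition trial :: "'f code_data \<Rightarrow> 'f oracle_fun \<Rightarrow> nat \<Rightarrow> 'f symbol state option pmf" where
  "trial P G i = do {
     (b, \<psi>) \<leftarrow> qmeasure snd
       (lin_ext (\<lambda>(x, b). ket (x, b \<noteq> G x i)) (uniform_state (alphabet P) \<otimes>\<^sub>q ket False));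
     return_pmf (if b then Some (\<lambda>x. \<psi> (x, True)) else None)}"

primrec repeat_trial :: "nat \<Rightarrow> 'a option pmf \<Rightarrow> 'a option pmf" where
  "repeat_trial 0 T = return_pmf None"
| "repeat_trial (Suc k) T = do {
     res \<leftarrow> T;
     case res of Some s \<Rightarrow> return_pmf (Some s) | None \<Rightarrow> repeat_trial k T}"

definition final_state :: "'f code_data \<Rightarrow> (nat \<Rightarrow> 'f symbol state) \<Rightarrow> ('f word \<times> 'f word) state" where
  "final_state P \<phi> = (let
     s0 = lin_ext (qft_n P) (uniform_state (code P)) \<otimes>\<^sub>q lin_ext (qft_n P) (tensor_n (blen P) \<phi>);
     s1 = lin_ext (\<lambda>(x, e). ket (x, x \<oplus>\<^bsub>word_space P\<^esub> e)) s0;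
     s2 = lin_ext (\<lambda>(x, z). ket (x \<ominus>\<^bsub>word_space P\<^esub> dec P z, z)) s1
   in lin_ext (\<lambda>(x, z). ket x \<otimes>\<^sub>q qft_inv_n P z) s2)"

text \<open>The output \<open>None\<close> is an abort; it is rejected by the verifier.\<close>

definition prove :: "'f code_data \<Rightarrow> nat \<Rightarrow> 'f oracle_fun \<Rightarrow> 'f word option pmf" where
  "prove P l G = do {
     s \<leftarrow> Pi_pmf {..<blen P} None (\<lambda>i. repeat_trial l (trial P G i));
     if \<exists>i<blen P. s i = None then return_pmf None
     else do {
       (x, _) \<leftarrow> qmeasure snd (final_state P (\<lambda>i. the (s i)));
       return_pmf (Some x)}}"

definition verify :: "'f code_data \<Rightarrow> 'f oracle_fun \<Rightarrow> 'f word option \<Rightarrow> bool" where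
  "verify P G \<pi> \<longleftrightarrow> (\<exists>x. \<pi> = Some x \<and> x \<in> code P \<and> (\<forall>i<blen P. G (x i) i))"


section \<open>The modified protocol\<close>

text \<open>\<open>f\<close> with a uniformly random key from \<open>Ks\<close> is \<open>k\<close>-wise independent from \<open>X\<close> to \<open>Y\<close>.\<close>

definition k_wise_independent ::
  "nat \<Rightarrow> 'k set \<Rightarrow> ('k \<Rightarrow> 'x \<Rightarrow> 'y) \<Rightarrow> 'x set \<Rightarrow> 'y set \<Rightarrow> bool" where
  "k_wise_independent k Ks f X Y \<longleftrightarrow>
     finite Ks \<and> Ks \<noteq> {} \<and> (\<forall>K\<in>Ks. f K \<in> X \<rightarrow> Y) \<and>
     (\<forall>S y. S \<subseteq> X \<and> finite S \<and> card S \<le> k \<and> y \<in> S \<rightarrow> Y \<longrightarrow>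
        measure_pmf.prob (pmf_of_set Ks) {K. \<forall>x\<in>S. f K x = y x} = (1 / real (card Y)) ^ card S)"

definition shifted_oracle ::
  "'f code_data \<Rightarrow> (nat \<times> 'f symbol \<Rightarrow> bits) \<Rightarrow> ('k \<Rightarrow> 'f symbol \<Rightarrow> bits) \<Rightarrow> 'k \<Rightarrow> nat \<Rightarrow> 'f oracle_fun" where
  "shifted_oracle P H f K j = (\<lambda>x. \<lambda>i\<in>{..<blen P}. H (j, x) i \<noteq> f K x i)"

definition prove_mod ::
  "'f code_data \<Rightarrow> nat \<Rightarrow> 'k set \<Rightarrow> ('k \<Rightarrow> 'f symbol \<Rightarrow> bits) \<Rightarrow> nat \<Rightarrow> (nat \<times> 'f symbol \<Rightarrow> bits) \<Rightarrow>
     ('k \<times> (nat \<Rightarrow> 'f word option)) pmf" where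
  "prove_mod P l Ks f t H = do {
     K \<leftarrow> pmf_of_set Ks;
     \<pi> \<leftarrow> Pi_pmf {..<t} None (\<lambda>j. prove P l (shifted_oracle P H f K j));
     return_pmf (K, \<pi>)}"

definition verify_mod ::
  "'f code_data \<Rightarrow> ('k \<Rightarrow> 'f symbol \<Rightarrow> bits) \<Rightarrow> nat \<Rightarrow> (nat \<times> 'f symbol \<Rightarrow> bits) \<Rightarrow>
     'k \<times> (nat \<Rightarrow> 'f word option) \<Rightarrow> bool" where
  "verify_mod P f t H = (\<lambda>(K, \<pi>). \<forall>j<t. verify P (shifted_oracle P H f K j) (\<pi> j))"

definition negligible_fun :: "(nat \<Rightarrow> real) \<Rightarrow> bool" where
  "negligible_fun \<nu> \<longleftrightarrow> (\<forall>k::nat. \<forall>\<^sub>F l in sequentially. \<bar>\<nu> l\<bar> < 1 / real l ^ k)"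

end

theory Submission
  imports Defs "HOL-Algebra.Multiplicative_Group" "HOL-Real_Asymp.Real_Asymp"
begin

text \<open>
  A key from a \<open>2n\<close>-wise independent family already makes the second moments of the amplitudes of
  \<open>|\<phi>\<rangle>\<close>, normalised by the expected instead of the actual sizes of the sets \<open>G\<^sub>i = 1\<close>, agree with
  those of a random oracle. These second moments are translation invariant and factor over the
  positions, so the Fourier coefficients of \<open>|\<phi>\<rangle>\<close> are uncorrelated, and their expected squared
  moduli are, up to a factor \<open>(1 + 1/|\<Sigma>|)\<^sup>n\<close>, at most the noise distribution for which the
  decoder works. Hence the part of \<open>|\<phi>\<rangle>\<close> carried by undecodable errors has exponentially small
  expected mass, and by translation invariance this remains true after conditioning its inverse
  transform on the code. Outside that part decoding clears the first register, and the convolution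
  theorem turns the second one into the pointwise product of \<open>|\<psi>\<rangle>\<close> and \<open>|\<phi>\<rangle>\<close>, which is supported
  on accepted outputs. Chebyshev's inequality shows that, except with probability
  \<open>4n\<^sup>3/|\<Sigma>|\<close>, all the sets have size \<open>(1 \<plusminus> 1/(2n)) |\<Sigma>|/2\<close>; then replacing the
  normalisation costs only a factor 2, and a trial fails with probability at most 3/4.
\<close>

section \<open>The additive character of a finite field\<close>

text \<open>The oracle \<open>H\<close> is fixed and arbitrary, so the key is the only randomness in
  the oracle. For a single \<open>j\<close> the oracle \<open>H (j, x)\<close> xor
  \<open>f K x\<close> is as independent as \<open>f\<close> itself, because xor with a fixed string
  permutes the bit strings. The runs for different \<open>j\<close> share one key and are combined
  by a union bound. Two obstacles shape the rest. The state |phi> contains the norms of its factors,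
  which depend on every value of the oracle, so limited independence says nothing about its moments.
  Hence the surrogate \<open>w\<close> with a fixed norm: each of its entries is a product of
  \<open>n\<close> bits up to a constant, and a second moment touches at most \<open>2 * n\<close>
  symbols. Secondly, restriction to the code amplifies mass by |\<Sigma>|^n / |C|, so smallness of
  the total undecodable mass would not be enough. Since the Fourier coefficients are uncorrelated,
  the expected mass of the inverse transform of the undecodable part is the same at every word. Only
  the share |C| / |\<Sigma>|^n of it falls on the code, and the amplification cancels
  exactly.\<close>

no_notation HLD_nxt (infixr "\<cdot>" 65)

text \<open>Serves the additivity of the Frobenius map. Multiplying the expansion for
  \<open>n\<close> by \<open>a \<oplus> b\<close> and shifting one of the two sums makes Pascal's
  rule the recursion of the coefficients; index 0 is split off.\<close>

lemma (in cring) binomial_expansion: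
  assumes a: "a \<in> carrier R" and b: "b \<in> carrier R"
  shows "(a \<oplus> b) [^] n = (\<Oplus>k\<in>{..n}. [(n choose k)] \<cdot> (a [^] k \<otimes> b [^] (n - k)))"
proof (induction n)
  case 0
  show ?case using a b by simp
next
  case (Suc n)
  define c where "c n k = [(n choose k)] \<cdot> (a [^] k \<otimes> b [^] (n - k))" for n k :: nat
  have c_closed [simp]: "c n k \<in> carrier R" for n k
    unfolding c_def using a b by simp
  have c_Suc: "c (Suc n) (Suc k) = c n k \<otimes> a \<oplus> c n (Suc k) \<otimes> b" if "k \<le> n" for k
  proof -
    have x: "c n k \<otimes> a = [(n choose k)] \<cdot> (a [^] Suc k \<otimes> b [^] (n - k))"
      unfolding c_def using a b by (simp add: add_pow_ldistr add_pow_rdistr m_ac)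
    have y: "c n (Suc k) \<otimes> b = [(n choose Suc k)] \<cdot> (a [^] Suc k \<otimes> b [^] (n - k))"
    \<comment> \<open>For \<open>k = n\<close> the exponent \<open>n - Suc k\<close> is truncated,
      but its coefficient \<open>n choose Suc n\<close> is 0.\<close>
    proof (cases "k = n")
      case True
      then show ?thesis unfolding c_def using a b by (simp add: binomial_eq_0)
    next
      case False
      then have "n - k = Suc (n - Suc k)" using that by simp
      then show ?thesis unfolding c_def using a b by (simp add: add_pow_ldistr add_pow_rdistr m_ac)
    qed
    show ?thesis
      unfolding x y unfolding c_def using a b
      by (simp add: add.nat_pow_mult del: nat_pow_Suc)
  qed
  have c_0: "c (Suc n) 0 = c n 0 \<otimes> b"
    unfolding c_def using a b by simp
  have c_top: "c n (Suc n) = \<zero>"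
    unfolding c_def using a b by (simp add: binomial_eq_0)
  let ?S = "\<Oplus>k\<in>{..n}. c n k"
  have "(\<Oplus>k\<in>{..Suc n}. c (Suc n) k) = (\<Oplus>k\<in>{..n}. c (Suc n) (Suc k)) \<oplus> c (Suc n) 0"
    by (rule finsum_Suc2) simp
  also have "(\<Oplus>k\<in>{..n}. c (Suc n) (Suc k)) = (\<Oplus>k\<in>{..n}. c n k \<otimes> a \<oplus> c n (Suc k) \<otimes> b)"
    using a b by (intro finsum_cong') (auto simp: c_Suc)
  also have "\<dots> = (\<Oplus>k\<in>{..n}. c n k \<otimes> a) \<oplus> (\<Oplus>k\<in>{..n}. c n (Suc k) \<otimes> b)"
    using a b by (intro finsum_addf) auto
  also have "(\<Oplus>k\<in>{..n}. c n k \<otimes> a) \<oplus> (\<Oplus>k\<in>{..n}. c n (Suc k) \<otimes> b) \<oplus> c (Suc n) 0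
      = (\<Oplus>k\<in>{..n}. c n k \<otimes> a) \<oplus> ((\<Oplus>k\<in>{..n}. c n (Suc k) \<otimes> b) \<oplus> c n 0 \<otimes> b)"
    unfolding c_0 using a b by (intro a_assoc) (auto intro!: finsum_closed)
  also have "(\<Oplus>k\<in>{..n}. c n (Suc k) \<otimes> b) \<oplus> c n 0 \<otimes> b = (\<Oplus>k\<in>{..Suc n}. c n k \<otimes> b)"
    using b by (intro finsum_Suc2[symmetric]) auto
  also have "\<dots> = (\<Oplus>k\<in>{..n}. c n k \<otimes> b)"
    using b by (subst finsum_Suc) (auto simp: c_top intro!: finsum_closed)
  also have "(\<Oplus>k\<in>{..n}. c n k \<otimes> a) = ?S \<otimes> a"
    using a by (intro finsum_ldistr[symmetric]) auto
  also have "(\<Oplus>k\<in>{..n}. c n k \<otimes> b) = ?S \<otimes> b"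
    using b by (intro finsum_ldistr[symmetric]) auto
  also have "?S \<otimes> a \<oplus> ?S \<otimes> b = ?S \<otimes> (a \<oplus> b)"
    using a b by (intro r_distr[symmetric]) (auto intro!: finsum_closed)
  also have "?S = (a \<oplus> b) [^] n"
    using Suc.IH by (simp add: c_def)
  finally show ?case
    by (simp add: c_def)
qed

locale prime_power_field = field R for R (structure) +
  fixes p r :: nat
  assumes prime_p: "prime p" and r_pos: "0 < r" and card_carrier: "card (carrier R) = p ^ r"
begin

lemma p_gt_1: "1 < p"
  using prime_p by (rule prime_gt_1_nat)

lemma finite_field: "finite (carrier R)"
  by (rule card_ge_0_finite) (use card_carrier p_gt_1 in auto)

lemma add_pow_one_mult:
  "[(a * b :: nat)] \<cdot> \<one> = ([a] \<cdot> \<one>) \<otimes> ([b] \<cdot> \<one>)"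
  by (simp add: add_pow_ldistr add_pow_rdistr add.nat_pow_pow mult.commute)

lemma add_pow_one_power:
  "[(a ^ k :: nat)] \<cdot> \<one> = ([a] \<cdot> \<one>) [^] k"
  by (induction k) (simp_all add: add_pow_one_mult m_comm del: mult_Suc_right)

lemma nonzero_power:
  assumes "x \<in> carrier R" "x \<noteq> \<zero>"
  shows "x [^] (k::nat) \<noteq> \<zero>"
  using assms by (induction k) (auto simp: integral_iff)

text \<open>The additive group has order \<open>p ^ r\<close>, so the \<open>p ^ r\<close>-fold
  multiple of 1 is 0. Multiples of 1 multiply like integers, so this is the \<open>r\<close>-th
  power of \<open>[p] \<cdot> \<one>\<close>, and a field has no nilpotent elements besides
  0.\<close>

lemma char_p: "[p] \<cdot> \<one> = \<zero>"
proof -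
  have "[(p ^ r)] \<cdot> \<one> = \<zero>"
    using add.pow_order_eq_1[of \<one>] card_carrier by (simp add: order_def)
  then have "([p] \<cdot> \<one>) [^] r = \<zero>" by (simp add: add_pow_one_power)
  then show ?thesis
    using nonzero_power[of "[p] \<cdot> \<one>"] by auto
qed

lemma char_p_mult:
  assumes "x \<in> carrier R" "p dvd k"
  shows "[k] \<cdot> x = \<zero>"
proof -
  obtain j where k: "k = p * j" using assms by blast
  have "[k] \<cdot> x = ([k] \<cdot> \<one>) \<otimes> x"
    using assms by (simp add: add_pow_ldistr add_pow_rdistr)
  also have "[k] \<cdot> \<one> = \<zero>" unfolding k add_pow_one_mult by (simp add: char_p)
  finally show ?thesis using assms by simp
qed

text \<open>All binomial coefficients strictly between the two ends are divisible by the prime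
  \<open>p\<close> and vanish in characteristic \<open>p\<close>.\<close>

lemma frobenius_add:
  assumes a: "a \<in> carrier R" and b: "b \<in> carrier R"
  shows "(a \<oplus> b) [^] p = a [^] p \<oplus> b [^] p"
proof -
  obtain m where m: "p = Suc m" "0 < m" using p_gt_1 by (cases p) auto
  let ?c = "\<lambda>k. [(p choose k)] \<cdot> (a [^] k \<otimes> b [^] (p - k))"
  have z: "?c k = \<zero>" if "0 < k" "k < p" for k
    using that a b prime_p by (intro char_p_mult dvd_choose_prime) auto
  obtain m' where m': "m = Suc m'" using m(2) by (cases m) auto
  have "(a \<oplus> b) [^] p = (\<Oplus>k\<in>{..Suc m}. ?c k)"
    using binomial_expansion[OF a b, of p] by (simp add: m)
  also have "\<dots> = ?c (Suc m) \<oplus> (\<Oplus>k\<in>{..Suc m'}. ?c k)"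
    unfolding m' using a b by (intro finsum_Suc) auto
  also have "(\<Oplus>k\<in>{..Suc m'}. ?c k) = (\<Oplus>k\<in>{..m'}. ?c (Suc k)) \<oplus> ?c 0"
    using a b by (intro finsum_Suc2) auto
  also have "(\<Oplus>k\<in>{..m'}. ?c (Suc k)) = (\<Oplus>k\<in>{..m'}. \<zero>)"
    using m m' by (intro finsum_cong' z) auto
  finally show ?thesis using a b m by simp
qed

lemma frobenius_pow_add:
  assumes a: "a \<in> carrier R" and b: "b \<in> carrier R"
  shows "(a \<oplus> b) [^] (p ^ i) = a [^] (p ^ i) \<oplus> b [^] (p ^ i)"
proof (induction i)
  case 0
  then show ?case using a b by simp
next
  case (Suc i)
  have *: "x [^] (p ^ Suc i) = (x [^] (p ^ i)) [^] p" if "x \<in> carrier R" for x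
    using that by (simp add: nat_pow_pow mult.commute)
  show ?case using a b Suc.IH by (simp add: * frobenius_add del: power_Suc)
qed

definition tr :: "'a \<Rightarrow> 'a" where
  "tr a = (\<Oplus>i\<in>{..<r}. a [^] (p ^ i))"

lemma tr_closed [simp]: "a \<in> carrier R \<Longrightarrow> tr a \<in> carrier R"
  unfolding tr_def by (intro finsum_closed) auto

lemma tr_add:
  assumes "a \<in> carrier R" "b \<in> carrier R"
  shows "tr (a \<oplus> b) = tr a \<oplus> tr b"
proof -
  have "tr (a \<oplus> b) = (\<Oplus>i\<in>{..<r}. a [^] (p ^ i) \<oplus> b [^] (p ^ i))"
    unfolding tr_def using assms by (intro finsum_cong') (auto simp: frobenius_pow_add)
  also have "\<dots> = tr a \<oplus> tr b"
    unfolding tr_def using assms by (intro finsum_addf) auto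
  finally show ?thesis .
qed

lemma pow_card:
  assumes "a \<in> carrier R"
  shows "a [^] (p ^ r) = a"
proof (cases "a = \<zero>")
  case True
  then show ?thesis using p_gt_1 by (simp add: nat_pow_zero)
next
  case False
  then have a: "a \<in> carrier (mult_of R)" using assms by simp
  interpret M: group "mult_of R" by (rule field_mult_group)
  have "a [^]\<^bsub>mult_of R\<^esub> (p ^ r - 1) = \<one>"
    using M.pow_order_eq_1[OF a] finite_field card_carrier
    by (simp add: order_mult_of) (simp add: order_def)
  then have "a [^] (p ^ r - 1) = \<one>" by (simp add: nat_pow_mult_of)
  then have "a [^] (Suc (p ^ r - 1)) = a" using assms by simp
  then show ?thesis using p_gt_1 by (metis Suc_pred' zero_less_power less_trans zero_less_one)
qed

text \<open>The Frobenius map shifts the summands cyclically, since the last one becomes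
  \<open>a [^] (p ^ r) = a\<close>. Traces are therefore fixed points, which
  \<open>prime_subfield\<close> identifies with residues modulo \<open>p\<close>, the exponents in
  \<open>omega\<close>.\<close>

lemma tr_frobenius:
  assumes "a \<in> carrier R"
  shows "tr a [^] p = tr a"
proof -
  have *: "(\<Oplus>i\<in>{..<k}. a [^] (p ^ i)) [^] p = (\<Oplus>i\<in>{..<k}. a [^] (p ^ Suc i))" for k
  proof (induction k)
    case 0
    then show ?case using p_gt_1 by (simp add: nat_pow_zero)
  next
    case (Suc k)
    have "(\<Oplus>i\<in>{..<Suc k}. a [^] (p ^ i)) = a [^] (p ^ k) \<oplus> (\<Oplus>i\<in>{..<k}. a [^] (p ^ i))"
      unfolding lessThan_Suc using assms by (intro finsum_insert) auto
    moreover have "(\<Oplus>i\<in>{..<Suc k}. a [^] (p ^ Suc i)) = a [^] (p ^ Suc k) \<oplus> (\<Oplus>i\<in>{..<k}. a [^] (p ^ Suc i))"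
      unfolding lessThan_Suc using assms by (intro finsum_insert) auto
    ultimately show ?case
      using Suc.IH assms
      by (simp add: frobenius_add finsum_closed nat_pow_pow mult.commute)
  qed
  obtain m where m: "r = Suc m" using r_pos by (cases r) auto
  have "tr a [^] p = (\<Oplus>i\<in>{..m}. a [^] (p ^ Suc i))"
    unfolding tr_def * by (simp add: m lessThan_Suc_atMost)
  also have "\<dots> = a [^] (p ^ r) \<oplus> (\<Oplus>i\<in>{..<m}. a [^] (p ^ Suc i))"
    unfolding m lessThan_Suc_atMost[symmetric] lessThan_Suc
    using assms by (intro finsum_insert) auto
  also have "\<dots> = (\<Oplus>i\<in>{..<m}. a [^] (p ^ Suc i)) \<oplus> a [^] (p ^ 0)"
    using assms by (simp add: pow_card a_comm finsum_closed del: power_Suc)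
  also have "\<dots> = tr a"
  proof (cases m)
    case 0
    then have "r = Suc 0" using m by simp
    then show ?thesis unfolding tr_def using assms 0 by (simp add: lessThan_Suc)
  next
    case (Suc m')
    have "tr a = (\<Oplus>i\<in>{..Suc m'}. a [^] (p ^ i))"
      unfolding tr_def unfolding m Suc lessThan_Suc_atMost ..
    also have "\<dots> = (\<Oplus>i\<in>{..m'}. a [^] (p ^ Suc i)) \<oplus> a [^] (p ^ 0)"
      using assms by (intro finsum_Suc2) auto
    finally show ?thesis unfolding Suc lessThan_Suc_atMost ..
  qed
  finally show ?thesis .
qed

text \<open>The additive order of 1 divides the prime \<open>p\<close> and is not 1, hence equals
  \<open>p\<close>.\<close>

lemma add_pow_one_eq_iff:
  "[(j::nat)] \<cdot> \<one> = [(k::nat)] \<cdot> \<one> \<longleftrightarrow> j mod p = k mod p"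
proof -
  have ord: "add.ord \<one> = p"
  proof -
    have "add.ord \<one> dvd p"
      using add.pow_eq_id[of \<one> p] char_p by simp
    moreover have "add.ord \<one> \<noteq> 1"
      using add.ord_eq_1[of \<one>] by simp
    ultimately show ?thesis using prime_p by (auto simp: prime_nat_iff)
  qed
  show ?thesis
  proof (induction j k rule: linorder_wlog)
    case (le j k)
    have "[j] \<cdot> \<one> = [k] \<cdot> \<one> \<longleftrightarrow> [(k - j)] \<cdot> \<one> = \<zero>"
    proof
      assume "[j] \<cdot> \<one> = [k] \<cdot> \<one>"
      then show "[(k - j)] \<cdot> \<one> = \<zero>"
        using add.pow_eq_div2[of \<one> k j] by simp
    next
      assume "[(k - j)] \<cdot> \<one> = \<zero>"
      moreover have "[k] \<cdot> \<one> = [(k - j)] \<cdot> \<one> \<oplus> [j] \<cdot> \<one>"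
        using le by (simp add: add.nat_pow_mult)
      ultimately show "[j] \<cdot> \<one> = [k] \<cdot> \<one>" by simp
    qed
    also have "\<dots> \<longleftrightarrow> p dvd k - j"
      using add.pow_eq_id[of \<one> "k - j"] ord by simp
    also have "\<dots> \<longleftrightarrow> j mod p = k mod p"
      using le mod_eq_dvd_iff_nat[of j k p] by (metis)
    finally show ?case .
  next
    case (sym j k)
    then show ?case by metis
  qed
qed

text \<open>By counting: the fixed points of the Frobenius map are 0 and roots of x^(p-1) = 1, at
  most \<open>p\<close> elements in all, while the \<open>p\<close> distinct multiples of 1 are
  already fixed.\<close>

lemma prime_subfield:
  assumes "x \<in> carrier R" "x [^] p = x"
  shows "\<exists>k<p. x = [(k::nat)] \<cdot> \<one>"
proof -
  let ?A = "{x \<in> carrier R. x [^] p = x}"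
  let ?B = "(\<lambda>k::nat. [k] \<cdot> \<one>) ` {..<p}"
  have fixed: "([k] \<cdot> \<one>) [^] p = [k] \<cdot> \<one>" for k :: nat
  proof (induction k)
    case 0
    then show ?case using p_gt_1 by (simp add: nat_pow_zero)
  next
    case (Suc k)
    then show ?case by (simp add: frobenius_add)
  qed
  have "?A \<subseteq> insert \<zero> {x \<in> carrier R. x [^] (p - 1) = \<one>}"
  proof
    fix x assume x: "x \<in> ?A"
    show "x \<in> insert \<zero> {x \<in> carrier R. x [^] (p - 1) = \<one>}"
    proof (cases "x = \<zero>")
      case False
      have "x \<otimes> x [^] (p - 1) = x \<otimes> \<one>"
        using x p_gt_1 nat_pow_Suc2[of x "p - 1"] by simp
      then show ?thesis using x False m_lcancel[of x "x [^] (p - 1)" \<one>] by simp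
    qed simp
  qed
  then have "card ?A \<le> card (insert \<zero> {x \<in> carrier R. x [^] (p - 1) = \<one>})"
    using finite_field by (intro card_mono) auto
  also have "\<dots> \<le> Suc (card {x \<in> carrier R. x [^] (p - 1) = \<one>})"
    using finite_field by (simp add: card_insert_if)
  also have "\<dots> \<le> Suc (p - 1)"
    using num_roots_le_deg[OF finite_field, of "p - 1"] p_gt_1 by simp
  finally have "card ?A \<le> p" using p_gt_1 by simp
  moreover have "card ?B = p"
    by (subst card_image) (auto simp: inj_on_def add_pow_one_eq_iff)
  moreover have "?B \<subseteq> ?A" by (auto simp: fixed)
  moreover have "finite ?A" using finite_field by simp
  ultimately have "?B = ?A" by (metis card_seteq)
  then have "x \<in> ?B" using assms by simp
  then show ?thesis by blast
qed

text \<open>The trace evaluates a polynomial whose coefficient at \<open>p ^ (r - 1)\<close> is 1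
  and whose degree is at most that. It has fewer than \<open>p ^ r\<close> roots. If the trace
  vanished, \<open>omega\<close> would be constantly 1 and the Fourier transform could not be
  inverted.\<close>

lemma tr_nonzero: "\<exists>a\<in>carrier R. tr a \<noteq> \<zero>"
proof (rule ccontr)
  assume "\<not> ?thesis"
  then have zero: "tr a = \<zero>" if "a \<in> carrier R" for a using that by blast
  let ?P = "UP R"
  interpret U: UP_domain R ?P by unfold_locales
  interpret E: UP_pre_univ_prop R R id ?P
    by unfold_locales (auto simp: ring_hom_def)
  let ?f = "finsum ?P (\<lambda>i. monom ?P \<one> (p ^ i)) {..<r}"
  have f: "?f \<in> carrier ?P" by (intro U.P.finsum_closed) auto
  have coeff: "coeff ?P ?f k = (\<Oplus>i\<in>{..<r}. if p ^ i = k then \<one> else \<zero>)" for k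
    by (subst U.coeff_finsum) (auto intro!: finsum_cong')
  have "coeff ?P ?f (p ^ (r - 1)) = (\<Oplus>i\<in>{..<r}. if r - 1 = i then \<one> else \<zero>)"
    unfolding coeff using p_gt_1 by (intro finsum_cong') (auto simp: power_inject_exp)
  also have "\<dots> = \<one>"
    using r_pos by (intro finsum_singleton[where f = "\<lambda>_. \<one>", simplified]) auto
  finally have "?f \<noteq> \<zero>\<^bsub>?P\<^esub>" using U.coeff_zero by auto
  note bound = U.roots_bound[OF f this finite_field]
  have deg: "deg R ?f \<le> p ^ (r - 1)"
  proof (rule U.deg_aboveI[OF _ f])
    fix m assume m: "p ^ (r - 1) < m"
    have "p ^ i \<noteq> m" if "i < r" for i
    proof -
      have "p ^ i \<le> p ^ (r - 1)" using that p_gt_1 by (intro power_increasing) auto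
      then show ?thesis using m by simp
    qed
    then have "coeff ?P ?f m = (\<Oplus>i\<in>{..<r}. \<zero>)"
      unfolding coeff by (intro finsum_cong') auto
    then show "coeff ?P ?f m = \<zero>" by simp
  qed
  have "eval R R id a ?f = tr a" if a: "a \<in> carrier R" for a
  proof -
    have "eval R R id a \<in> ring_hom ?P R" using E.eval_ring_hom[OF a] .
    then interpret h: ring_hom_ring ?P R "eval R R id a"
      by (intro ring_hom_ringI2) (auto intro: U.P.ring_axioms ring_axioms)
    have "eval R R id a ?f = (\<Oplus>i\<in>{..<r}. eval R R id a (monom ?P \<one> (p ^ i)))"
      by (subst h.hom_finsum) (auto simp: comp_def)
    also have "\<dots> = tr a"
      unfolding tr_def using a by (intro finsum_cong') (auto simp: E.eval_monom[OF _ a])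
    finally show ?thesis .
  qed
  then have "{a \<in> carrier R. eval R R id a ?f = \<zero>} = carrier R"
    using zero by auto
  then have "p ^ r \<le> p ^ (r - 1)"
    using bound deg card_carrier by simp
  moreover have "p ^ (r - 1) < p ^ r"
    using p_gt_1 r_pos by (intro power_strict_increasing) auto
  ultimately show False by simp
qed

definition omega :: "'a \<Rightarrow> complex" where
  "omega a = cis (2 * pi / real p) ^ (LEAST k::nat. tr a = [k] \<cdot> \<one>)"

text \<open>The root of unity has \<open>p\<close>-th power 1 and all representatives of a trace
  agree modulo \<open>p\<close>, so the \<open>LEAST\<close> one may be exchanged for any other, for
  instance for a sum of two representatives in \<open>omega_add\<close>.\<close>

lemma omega_eq:
  assumes "tr a = [(k::nat)] \<cdot> \<one>"
  shows "omega a = cis (2 * pi / real p) ^ k"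
proof -
  let ?w = "cis (2 * pi / real p)"
  have p: "?w ^ p = 1" using p_gt_1 by (simp add: Complex.DeMoivre)
  have red: "?w ^ n = ?w ^ (n mod p)" for n
  proof -
    have "?w ^ n = ?w ^ (p * (n div p) + n mod p)" by simp
    also have "\<dots> = ?w ^ (n mod p)" unfolding power_add power_mult by (simp add: p)
    finally show ?thesis .
  qed
  have "tr a = [(LEAST k::nat. tr a = [k] \<cdot> \<one>)] \<cdot> \<one>"
    using assms by (rule LeastI)
  then have "(LEAST k::nat. tr a = [k] \<cdot> \<one>) mod p = k mod p"
    using assms add_pow_one_eq_iff by metis
  then show ?thesis unfolding omega_def using red by metis
qed

lemma tr_eq_obtain:
  assumes "a \<in> carrier R"
  obtains k :: nat where "k < p" "tr a = [k] \<cdot> \<one>"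
  using prime_subfield[OF tr_closed tr_frobenius] assms by blast

lemma omega_add:
  assumes "a \<in> carrier R" "b \<in> carrier R"
  shows "omega (a \<oplus> b) = omega a * omega b"
proof -
  obtain j k :: nat where j: "tr a = [j] \<cdot> \<one>" and k: "tr b = [k] \<cdot> \<one>"
    using assms tr_eq_obtain by metis
  then have "tr (a \<oplus> b) = [(j + k)] \<cdot> \<one>"
    using assms by (simp add: tr_add add.nat_pow_mult)
  then show ?thesis using j k by (simp add: omega_eq power_add)
qed

lemma omega_nontrivial: "\<exists>a\<in>carrier R. omega a \<noteq> 1"
proof -
  obtain a where a: "a \<in> carrier R" "tr a \<noteq> \<zero>" using tr_nonzero by blast
  then obtain k :: nat where k: "k < p" "tr a = [k] \<cdot> \<one>" using tr_eq_obtain by metis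
  have "0 < k" using a k by (cases k) auto
  have "omega a \<noteq> 1"
  proof
    assume "omega a = 1"
    then have "cis (2 * pi * real k / real p) = 1"
      using omega_eq[OF k(2)] by (simp add: Complex.DeMoivre mult_ac)
    then have "cos (2 * pi * real k / real p) = 1" by (simp add: complex_eq_iff)
    then obtain m :: int where "2 * pi * real k / real p = real_of_int m * 2 * pi"
      using cos_one_2pi_int by auto
    then have "real k = real_of_int m * real p"
      using p_gt_1 by (simp add: field_simps)
    then have "int k = m * int p" by (metis of_int_eq_iff of_int_mult of_int_of_nat_eq)
    then have "p dvd k" by (metis dvd_triv_right int_dvd_int_iff)
    then show False using \<open>0 < k\<close> k(1) by (auto dest: dvd_imp_le)
  qed
  then show ?thesis using a by blast
qed

lemma cmod_omega: "cmod (omega a) = 1"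
  unfolding omega_def by (simp add: norm_power)

text \<open>Translation by some \<open>c\<close> with
  \<open>omega (x \<otimes> c) \<noteq> 1\<close> permutes the summands and multiplies the sum by
  that value, so it is 0. The same argument recurs for the code in
  \<open>ft_code_eq_0\<close>.\<close>

lemma sum_omega:
  assumes "x \<in> carrier R"
  shows "(\<Sum>a\<in>carrier R. omega (x \<otimes> a)) = (if x = \<zero> then of_nat (card (carrier R)) else 0)"
proof (cases "x = \<zero>")
  case True
  have "omega \<zero> = 1" using omega_add[of \<zero> \<zero>] cmod_omega[of \<zero>] by auto
  then show ?thesis using True by simp
next
  case False
  obtain b where b: "b \<in> carrier R" "omega b \<noteq> 1" using omega_nontrivial by blast
  define c where "c = inv x \<otimes> b"
  have x: "x \<in> Units R" using False assms field_Units by simp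
  have c: "c \<in> carrier R" "x \<otimes> c = b"
    unfolding c_def using b assms x by (simp_all add: m_assoc[symmetric])
  let ?S = "\<Sum>a\<in>carrier R. omega (x \<otimes> a)"
  have "?S = (\<Sum>a\<in>carrier R. omega (x \<otimes> (c \<oplus> a)))"
    using c
    by (intro sum.reindex_bij_witness[of _ "\<lambda>a. c \<oplus> a" "\<lambda>a. \<ominus> c \<oplus> a"])
      (simp_all add: r_neg1 r_neg2)
  also have "\<dots> = omega b * ?S"
    unfolding sum_distrib_left using c assms by (intro sum.cong) (auto simp: r_distr omega_add)
  finally have "(1 - omega b) * ?S = 0" by (simp add: algebra_simps)
  then show ?thesis using b False by simp
qed

end


section \<open>Fourier analysis and coherent decoding\<close>

lemma sum_uniform_state:
  assumes "finite A" "C \<subseteq> A" "C \<noteq> {}"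
  shows "(\<Sum>x\<in>A. (cmod (uniform_state C x))\<^sup>2) = 1"
proof -
  have C: "finite C" using assms finite_subset by blast
  have "(\<Sum>x\<in>A. (cmod (uniform_state C x))\<^sup>2) = (\<Sum>x\<in>C. (cmod (uniform_state C x))\<^sup>2)"
    using assms by (intro sum.mono_neutral_right) (auto simp: uniform_state_def)
  also have "\<dots> = (\<Sum>x\<in>C. 1 / real (card C))"
    by (intro sum.cong) (auto simp: uniform_state_def norm_divide power_divide)
  also have "\<dots> = 1" using assms C by simp
  finally show ?thesis .
qed

text \<open>A symmetric nondegenerate bicharacter, which identifies a finite abelian group with its
  dual, so that transforms live on the same group; \<open>sum_chi\<close> expresses nondegeneracy.
  The decoding argument can then be carried out without positions and coordinates.\<close>

locale character_pairing = abelian_group G for G (structure) +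
  fixes chi :: "'a \<Rightarrow> 'a \<Rightarrow> complex"
  assumes finite_carrier: "finite (carrier G)"
    and chi_add: "\<lbrakk>x \<in> carrier G; y \<in> carrier G; z \<in> carrier G\<rbrakk> \<Longrightarrow> chi (x \<oplus> y) z = chi x z * chi y z"
    and chi_commute: "\<lbrakk>x \<in> carrier G; y \<in> carrier G\<rbrakk> \<Longrightarrow> chi x y = chi y x"
    and cmod_chi: "\<lbrakk>x \<in> carrier G; y \<in> carrier G\<rbrakk> \<Longrightarrow> cmod (chi x y) = 1"
    and sum_chi: "x \<in> carrier G \<Longrightarrow>
          (\<Sum>z\<in>carrier G. chi x z) = (if x = \<zero> then of_nat (card (carrier G)) else 0)"
begin

abbreviation "N \<equiv> card (carrier G)"

lemma N_pos: "0 < N"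
  using finite_carrier zero_closed card_gt_0_iff by blast

lemma chi_orthogonal:
  assumes x: "x \<in> carrier G" and y: "y \<in> carrier G"
  shows "(\<Sum>z\<in>carrier G. chi x z * cnj (chi y z)) = (if x = y then of_nat N else 0)"
proof -
  have "chi (x \<ominus> y) z = chi x z * cnj (chi y z)" if z: "z \<in> carrier G" for z
  proof -
    have "chi (x \<ominus> y) z * chi y z = chi x z"
      using x y z by (simp add: chi_add[symmetric] minus_eq a_assoc l_neg)
    moreover have "chi y z * cnj (chi y z) = 1"
      using cmod_chi[OF y z] by (simp add: complex_norm_square[symmetric])
    ultimately show ?thesis by (metis mult.assoc mult.right_neutral)
  qed
  then have "(\<Sum>z\<in>carrier G. chi x z * cnj (chi y z)) = (\<Sum>z\<in>carrier G. chi (x \<ominus> y) z)"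
    by (intro sum.cong) auto
  also have "\<dots> = (if x \<ominus> y = \<zero> then of_nat N else 0)"
    using x y by (intro sum_chi) auto
  also have "x \<ominus> y = \<zero> \<longleftrightarrow> x = y"
    using x y by (metis minus_eq r_neg a_assoc l_neg r_zero l_zero a_inv_closed)
  finally show ?thesis .
qed

definition ft :: "('a \<Rightarrow> complex) \<Rightarrow> 'a \<Rightarrow> complex" where
  "ft h u = (\<Sum>x\<in>carrier G. h x * chi x u) / complex_of_real (sqrt N)"

definition ift :: "('a \<Rightarrow> complex) \<Rightarrow> 'a \<Rightarrow> complex" where
  "ift h u = (\<Sum>x\<in>carrier G. h x * cnj (chi x u)) / complex_of_real (sqrt N)"

lemma sqrt_N_mult: "complex_of_real (sqrt N) * complex_of_real (sqrt N) = of_nat N"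
  by (simp flip: of_real_mult)

lemma ift_ft:
  assumes u: "u \<in> carrier G"
  shows "ift (ft h) u = h u"
proof -
  have "(\<Sum>x\<in>carrier G. ft h x * cnj (chi x u))
      = (\<Sum>x\<in>carrier G. \<Sum>y\<in>carrier G. h y * (chi y x * cnj (chi u x))) / complex_of_real (sqrt N)"
    unfolding ft_def sum_divide_distrib sum_distrib_right
    using chi_commute[OF u] by (intro sum.cong refl) simp
  then have "ift (ft h) u = (\<Sum>x\<in>carrier G. \<Sum>y\<in>carrier G. h y * (chi y x * cnj (chi u x))) / of_nat N"
    unfolding ift_def sqrt_N_mult[symmetric] by simp
  also have "(\<Sum>x\<in>carrier G. \<Sum>y\<in>carrier G. h y * (chi y x * cnj (chi u x)))
      = (\<Sum>y\<in>carrier G. h y * (\<Sum>x\<in>carrier G. chi y x * cnj (chi u x)))"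
    by (subst sum.swap) (simp add: sum_distrib_left)
  also have "\<dots> = (\<Sum>y\<in>carrier G. if y = u then h y * of_nat N else 0)"
    using u by (intro sum.cong) (auto simp: chi_orthogonal)
  also have "\<dots> = h u * of_nat N"
    using u finite_carrier by simp
  finally show ?thesis using N_pos by simp
qed

lemma parseval_ft: "(\<Sum>u\<in>carrier G. (cmod (ft h u))\<^sup>2) = (\<Sum>x\<in>carrier G. (cmod (h x))\<^sup>2)"
proof -
  have "complex_of_real (\<Sum>u\<in>carrier G. (cmod (ft h u))\<^sup>2) = (\<Sum>u\<in>carrier G. ft h u * cnj (ft h u))"
    by (simp only: of_real_sum complex_norm_square)
  also have "\<dots> = (\<Sum>u\<in>carrier G. \<Sum>x\<in>carrier G. \<Sum>y\<in>carrier G.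
      h x * cnj (h y) * (chi x u * cnj (chi y u))) / of_nat N"
    unfolding ft_def sqrt_N_mult[symmetric]
    by (simp add: sum_divide_distrib sum_product mult_ac)
  also have "(\<Sum>u\<in>carrier G. \<Sum>x\<in>carrier G. \<Sum>y\<in>carrier G.
        h x * cnj (h y) * (chi x u * cnj (chi y u)))
      = (\<Sum>x\<in>carrier G. \<Sum>u\<in>carrier G. \<Sum>y\<in>carrier G.
        h x * cnj (h y) * (chi x u * cnj (chi y u)))"
    by (rule sum.swap)
  also have "\<dots> = (\<Sum>x\<in>carrier G. \<Sum>y\<in>carrier G. h x * cnj (h y) *
      (\<Sum>u\<in>carrier G. chi x u * cnj (chi y u)))"
    unfolding sum_distrib_left by (intro sum.cong[OF refl] sum.swap)
  also have "\<dots> = (\<Sum>x\<in>carrier G. \<Sum>y\<in>carrier G. if x = y then h x * cnj (h x) * of_nat N else 0)"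
    by (intro sum.cong) (auto simp: chi_orthogonal)
  also have "\<dots> = (\<Sum>x\<in>carrier G. h x * cnj (h x)) * of_nat N"
    using finite_carrier by (simp add: sum_distrib_right)
  finally have "complex_of_real (\<Sum>u\<in>carrier G. (cmod (ft h u))\<^sup>2) = complex_of_real (\<Sum>x\<in>carrier G. (cmod (h x))\<^sup>2)"
    unfolding of_real_sum complex_norm_square using N_pos by simp
  then show ?thesis by (simp only: of_real_eq_iff)
qed

lemma parseval_ift: "(\<Sum>u\<in>carrier G. (cmod (ift h u))\<^sup>2) = (\<Sum>x\<in>carrier G. (cmod (h x))\<^sup>2)"
proof -
  have "ift h u = cnj (ft (\<lambda>x. cnj (h x)) u)" for u
    unfolding ift_def ft_def by simp
  then show ?thesis using parseval_ft[of "\<lambda>x. cnj (h x)"] by simp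
qed

lemma ift_cong: "(\<And>x. x \<in> carrier G \<Longrightarrow> h x = h' x) \<Longrightarrow> ift h u = ift h' u"
  unfolding ift_def by (simp cong: sum.cong)

lemma ift_add: "ift (\<lambda>x. h x + h' x) u = ift h u + ift h' u"
  unfolding ift_def by (simp add: sum.distrib add_divide_distrib distrib_right)

lemma sum_translate:
  assumes "a \<in> carrier G"
  shows "(\<Sum>x\<in>carrier G. h (x \<oplus> a)) = (\<Sum>x\<in>carrier G. h x)"
  using assms
  by (intro sum.reindex_bij_witness[of _ "\<lambda>x. x \<ominus> a" "\<lambda>x. x \<oplus> a"])
    (simp_all add: minus_eq a_assoc l_neg r_neg)

text \<open>The unitary normalisation leaves a factor \<open>sqrt N\<close>. Together with the
  amplitude \<open>1 / sqrt (card C)\<close> of |psi> it becomes the amplification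
  \<open>N / card C\<close> in \<open>decoding_failure\<close>.\<close>

lemma ift_convolution:
  assumes u: "u \<in> carrier G"
  shows "ift (\<lambda>z. \<Sum>x\<in>carrier G. v x * h (z \<ominus> x)) u = complex_of_real (sqrt N) * ift v u * ift h u"
proof -
  have "(\<Sum>z\<in>carrier G. (\<Sum>x\<in>carrier G. v x * h (z \<ominus> x)) * cnj (chi z u))
      = (\<Sum>x\<in>carrier G. \<Sum>z\<in>carrier G. v x * h (z \<ominus> x) * cnj (chi z u))"
    unfolding sum_distrib_right by (rule sum.swap)
  also have "\<dots> = (\<Sum>x\<in>carrier G. \<Sum>e\<in>carrier G. (v x * cnj (chi x u)) * (h e * cnj (chi e u)))"
  proof (rule sum.cong[OF refl])
    fix x assume x: "x \<in> carrier G"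
    have "(\<Sum>z\<in>carrier G. v x * h (z \<ominus> x) * cnj (chi z u))
        = (\<Sum>e\<in>carrier G. v x * h ((e \<oplus> x) \<ominus> x) * cnj (chi (e \<oplus> x) u))"
      using sum_translate[OF x, of "\<lambda>z. v x * h (z \<ominus> x) * cnj (chi z u)"] by simp
    also have "\<dots> = (\<Sum>e\<in>carrier G. (v x * cnj (chi x u)) * (h e * cnj (chi e u)))"
      using x u by (intro sum.cong) (auto simp: chi_add minus_eq a_assoc r_neg)
    finally show "(\<Sum>z\<in>carrier G. v x * h (z \<ominus> x) * cnj (chi z u))
        = (\<Sum>e\<in>carrier G. (v x * cnj (chi x u)) * (h e * cnj (chi e u)))" .
  qed
  also have "\<dots> = (\<Sum>x\<in>carrier G. v x * cnj (chi x u)) * (\<Sum>e\<in>carrier G. h e * cnj (chi e u))"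
    by (simp add: sum_product)
  finally show ?thesis unfolding ift_def using N_pos by simp
qed

text \<open>The amplitude at \<open>(y, z)\<close> after adding the first register to the second and
  then subtracting \<open>D z\<close> from the first: its only source is
  \<open>x = y \<oplus> D z\<close> with error \<open>z \<ominus> x\<close>.\<close>

definition decoded :: "('a \<Rightarrow> 'a) \<Rightarrow> ('a \<Rightarrow> complex) \<Rightarrow> ('a \<Rightarrow> complex) \<Rightarrow> 'a \<Rightarrow> 'a \<Rightarrow> complex" where
  "decoded D v h y z = v (y \<oplus> D z) * h (z \<ominus> (y \<oplus> D z))"

text \<open>For fixed \<open>z\<close>, adding \<open>D z\<close> is a bijection, so the operation
  preserves norms for every \<open>D\<close>, however badly it decodes. This serves twice: to
  normalise the measured state, and to bound the contribution of the undecodable errors.\<close>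

lemma sum_decoded:
  assumes D: "D \<in> carrier G \<rightarrow> carrier G"
  shows "(\<Sum>y\<in>carrier G. \<Sum>u\<in>carrier G. (cmod (ift (decoded D v h y) u))\<^sup>2)
    = (\<Sum>x\<in>carrier G. (cmod (v x))\<^sup>2) * (\<Sum>x\<in>carrier G. (cmod (h x))\<^sup>2)"
proof -
  have "(\<Sum>y\<in>carrier G. \<Sum>u\<in>carrier G. (cmod (ift (decoded D v h y) u))\<^sup>2)
      = (\<Sum>y\<in>carrier G. \<Sum>z\<in>carrier G. (cmod (v (y \<oplus> D z)))\<^sup>2 * (cmod (h (z \<ominus> (y \<oplus> D z))))\<^sup>2)"
    unfolding parseval_ift by (simp add: decoded_def norm_mult power_mult_distrib)
  also have "\<dots> = (\<Sum>z\<in>carrier G. \<Sum>y\<in>carrier G. (cmod (v (y \<oplus> D z)))\<^sup>2 * (cmod (h (z \<ominus> (y \<oplus> D z))))\<^sup>2)"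
    by (rule sum.swap)
  also have "\<dots> = (\<Sum>z\<in>carrier G. \<Sum>x\<in>carrier G. (cmod (v x))\<^sup>2 * (cmod (h (z \<ominus> x)))\<^sup>2)"
  proof (rule sum.cong[OF refl])
    fix z assume "z \<in> carrier G"
    then have "D z \<in> carrier G" using D by auto
    from sum_translate[OF this, of "\<lambda>x. (cmod (v x))\<^sup>2 * (cmod (h (z \<ominus> x)))\<^sup>2"]
    show "(\<Sum>y\<in>carrier G. (cmod (v (y \<oplus> D z)))\<^sup>2 * (cmod (h (z \<ominus> (y \<oplus> D z))))\<^sup>2)
      = (\<Sum>x\<in>carrier G. (cmod (v x))\<^sup>2 * (cmod (h (z \<ominus> x)))\<^sup>2)" .
  qed
  also have "\<dots> = (\<Sum>x\<in>carrier G. \<Sum>z\<in>carrier G. (cmod (v x))\<^sup>2 * (cmod (h (z \<ominus> x)))\<^sup>2)"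
    by (rule sum.swap)
  also have "\<dots> = (\<Sum>x\<in>carrier G. (cmod (v x))\<^sup>2 * (\<Sum>z\<in>carrier G. (cmod (h (z \<oplus> \<ominus> x)))\<^sup>2))"
    unfolding sum_distrib_left by (simp add: minus_eq)
  also have "\<dots> = (\<Sum>x\<in>carrier G. (cmod (v x))\<^sup>2 * (\<Sum>z\<in>carrier G. (cmod (h z))\<^sup>2))"
    by (intro sum.cong refl arg_cong2[where f = "(*)"] sum_translate[where h = "\<lambda>z. (cmod (h z))\<^sup>2"]) auto
  finally show ?thesis by (simp add: sum_distrib_right)
qed

text \<open>\<open>X\<close> stands for the dual code, outside of which \<open>v\<close> vanishes.
  If every error in the support of \<open>h\<close> is decoded, then \<open>z\<close> has at most
  one decomposition of nonzero amplitude, the one with \<open>x = D z\<close>. So the first register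
  is cleared, and the convolution at \<open>z\<close> consists of this single term.\<close>

lemma decoded_good:
  assumes D: "D \<in> carrier G \<rightarrow> carrier G"
    and v: "\<And>x. x \<in> carrier G - X \<Longrightarrow> v x = 0"
    and good: "\<And>x e. \<lbrakk>x \<in> X; x \<in> carrier G; e \<in> carrier G; h e \<noteq> 0\<rbrakk> \<Longrightarrow> D (x \<oplus> e) = x"
    and y: "y \<in> carrier G" and z: "z \<in> carrier G"
  shows "decoded D v h y z = (if y = \<zero> then \<Sum>x\<in>carrier G. v x * h (z \<ominus> x) else 0)"
proof -
  have Dz: "D z \<in> carrier G" using D z by auto
  have *: "D z = x" if x: "x \<in> carrier G" and nz: "v x * h (z \<ominus> x) \<noteq> 0" for x
  proof -
    have "x \<in> X" using x nz v[of x] by (cases "x \<in> X") simp_all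
    moreover have "z \<ominus> x \<in> carrier G" using x z by simp
    moreover have "h (z \<ominus> x) \<noteq> 0" using nz by simp
    ultimately have "D (x \<oplus> (z \<ominus> x)) = x" using x by (intro good)
    moreover have "x \<oplus> (z \<oplus> \<ominus> x) = z"
      using x z a_lcomm[of x z "\<ominus> x"] by (simp add: r_neg)
    ultimately show ?thesis by (simp add: minus_eq)
  qed
  show ?thesis
  proof (cases "y = \<zero>")
    case True
    have "(\<Sum>x\<in>carrier G. v x * h (z \<ominus> x)) = (\<Sum>x\<in>{D z}. v x * h (z \<ominus> x))"
      using finite_carrier Dz by (intro sum.mono_neutral_right) (simp, simp, use * in blast)
    then show ?thesis using True Dz by (simp add: decoded_def)
  next
    case False
    have "D z \<noteq> y \<oplus> D z" using False y Dz
      by simp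
    then have "decoded D v h y z = 0"
      using *[of "y \<oplus> D z"] y Dz unfolding decoded_def by blast
    then show ?thesis using False by simp
  qed
qed

text \<open>\<open>h\<close> is the part of the transform on the bad errors and \<open>h'\<close>
  the rest. The \<open>h'\<close> part yields \<open>sqrt N\<close> times the product of
  \<open>V\<close> and \<open>ift h'\<close>, which need not vanish where \<open>W\<close> does. At
  a codeword with \<open>W u = 0\<close>, however, \<open>ift h' u = - ift h u\<close>, so this
  failure too is measured by \<open>h\<close>, and it accounts for the first summand; the second one
  is the contribution of \<open>h\<close> itself.\<close>

lemma decoding_failure:
  fixes W :: "'a \<Rightarrow> complex" and C X B :: "'a set"
  defines "V \<equiv> uniform_state C"
    and "h \<equiv> \<lambda>e. if e \<in> B then ft W e else 0"
  assumes D: "D \<in> carrier G \<rightarrow> carrier G"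
    and C: "C \<subseteq> carrier G" "C \<noteq> {}"
    and dual: "\<And>x. x \<in> carrier G - X \<Longrightarrow> ft V x = 0"
    and good: "\<And>x e. \<lbrakk>x \<in> X; x \<in> carrier G; e \<in> carrier G - B\<rbrakk> \<Longrightarrow> D (x \<oplus> e) = x"
    and B: "B \<subseteq> carrier G"
  shows "(\<Sum>y\<in>carrier G. \<Sum>u\<in>{u\<in>carrier G. \<not> (u \<in> C \<and> W u \<noteq> 0)}. (cmod (ift (decoded D (ft V) (ft W) y) u))\<^sup>2)
    \<le> 2 * (N / card C * (\<Sum>u\<in>C. (cmod (ift h u))\<^sup>2)) + 2 * (\<Sum>e\<in>B. (cmod (ft W e))\<^sup>2)"
proof -
  define h' where "h' e = (if e \<in> B then 0 else ft W e)" for e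
  define F where "F = {u\<in>carrier G. \<not> (u \<in> C \<and> W u \<noteq> 0)}"
  have finF: "finite F" "F \<subseteq> carrier G" using finite_carrier by (auto simp: F_def)
  have finC: "finite C" using C finite_carrier finite_subset by blast
  have split: "ft W e = h' e + h e" for e by (simp add: h'_def h_def)
  let ?G = "\<lambda>y u. ift (decoded D (ft V) h' y) u"
  let ?H = "\<lambda>y u. ift (decoded D (ft V) h y) u"
  have sumV: "(\<Sum>x\<in>carrier G. (cmod (ft V x))\<^sup>2) = 1"
    unfolding parseval_ft V_def using finite_carrier C by (intro sum_uniform_state)
  have eq: "ift (decoded D (ft V) (ft W) y) u = ?G y u + ?H y u" for y u
    unfolding ift_add[symmetric] by (intro ift_cong) (simp add: decoded_def split distrib_left)
  \<comment> \<open>The inequality (a + b)^2 \<le> 2 a^2 + 2 b^2 is the origin of both factors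
    2.\<close>
  have le: "(cmod (ift (decoded D (ft V) (ft W) y) u))\<^sup>2 \<le> 2 * (cmod (?G y u))\<^sup>2 + 2 * (cmod (?H y u))\<^sup>2" for y u
  proof -
    have "(cmod (?G y u + ?H y u))\<^sup>2 \<le> (cmod (?G y u) + cmod (?H y u))\<^sup>2"
      by (intro power_mono norm_triangle_ineq) auto
    also have "\<dots> \<le> 2 * (cmod (?G y u))\<^sup>2 + 2 * (cmod (?H y u))\<^sup>2"
      using sum_squares_bound[of "cmod (?G y u)" "cmod (?H y u)"] by (simp add: power2_sum)
    finally show ?thesis by (simp add: eq)
  qed
  have "(\<Sum>y\<in>carrier G. \<Sum>u\<in>F. (cmod (ift (decoded D (ft V) (ft W) y) u))\<^sup>2)
      \<le> (\<Sum>y\<in>carrier G. \<Sum>u\<in>F. 2 * (cmod (?G y u))\<^sup>2 + 2 * (cmod (?H y u))\<^sup>2)"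
    by (intro sum_mono le)
  also have "\<dots> = 2 * (\<Sum>y\<in>carrier G. \<Sum>u\<in>F. (cmod (?G y u))\<^sup>2) + 2 * (\<Sum>y\<in>carrier G. \<Sum>u\<in>F. (cmod (?H y u))\<^sup>2)"
    by (simp add: sum.distrib sum_distrib_left)
  \<comment> \<open>Nothing is known about how bad errors are decoded, so their entire norm is
    counted as failure.\<close>
  also have "(\<Sum>y\<in>carrier G. \<Sum>u\<in>F. (cmod (?H y u))\<^sup>2) \<le> (\<Sum>y\<in>carrier G. \<Sum>u\<in>carrier G. (cmod (?H y u))\<^sup>2)"
    using finF finite_carrier by (intro sum_mono sum_mono2) auto
  also have "\<dots> = (\<Sum>e\<in>B. (cmod (ft W e))\<^sup>2)"
    unfolding sum_decoded[OF D] sumV using B finite_carrier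
    by (auto intro!: sum.mono_neutral_cong_right simp: h_def)
  also have "(\<Sum>y\<in>carrier G. \<Sum>u\<in>F. (cmod (?G y u))\<^sup>2) \<le> N / card C * (\<Sum>u\<in>C. (cmod (ift h u))\<^sup>2)"
  proof -
    have dec: "decoded D (ft V) h' y z = (if y = \<zero> then \<Sum>x\<in>carrier G. ft V x * h' (z \<ominus> x) else 0)"
      if "y \<in> carrier G" "z \<in> carrier G" for y z
      using that D dual by (intro decoded_good[where X = X]) (auto intro!: good simp: h'_def split: if_splits)
    have G0: "?G y u = (if y = \<zero> then complex_of_real (sqrt N) * V u * ift h' u else 0)"
      if "y \<in> carrier G" "u \<in> carrier G" for y u
    proof (cases "y = \<zero>")
      case True
      have "?G y u = ift (\<lambda>z. \<Sum>x\<in>carrier G. ft V x * h' (z \<ominus> x)) u"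
        using that True by (intro ift_cong) (simp add: dec)
      then show ?thesis using True that by (simp add: ift_convolution ift_ft)
    next
      case False
      have "?G y u = ift (\<lambda>_. 0) u" using that False by (intro ift_cong) (simp add: dec)
      then show ?thesis using False by (simp add: ift_def)
    qed
    have "(\<Sum>y\<in>carrier G. \<Sum>u\<in>F. (cmod (?G y u))\<^sup>2)
        = (\<Sum>y\<in>carrier G. if y = \<zero> then (\<Sum>u\<in>F. (cmod (complex_of_real (sqrt N) * V u * ift h' u))\<^sup>2) else 0)"
      using finF by (intro sum.cong refl) (auto simp: G0 subset_iff intro!: sum.cong sum.neutral)
    also have "\<dots> = (\<Sum>u\<in>F. (cmod (complex_of_real (sqrt N) * V u * ift h' u))\<^sup>2)"
      using finite_carrier by simp
    \<comment> \<open>\<open>V\<close> vanishes off \<open>C\<close>; the failing outputs that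
      remain are codewords with \<open>W u = 0\<close>.\<close>
    also have "\<dots> = (\<Sum>u\<in>F \<inter> C. (cmod (complex_of_real (sqrt N) * V u * ift h' u))\<^sup>2)"
      using finF by (intro sum.mono_neutral_right) (auto simp: V_def uniform_state_def)
    also have "\<dots> = (\<Sum>u\<in>F \<inter> C. N / card C * (cmod (ift h u))\<^sup>2)"
    proof (intro sum.cong refl)
      fix u assume u: "u \<in> F \<inter> C"
      then have uG: "u \<in> carrier G" and Wu: "W u = 0" by (auto simp: F_def)
      have "ift (ft W) u = ift h' u + ift h u"
        unfolding ift_add[symmetric] by (intro ift_cong split)
      then have "ift h' u = - ift h u" using ift_ft[OF uG] Wu by (metis add_eq_0_iff2)
      then show "(cmod (complex_of_real (sqrt N) * V u * ift h' u))\<^sup>2 = N / card C * (cmod (ift h u))\<^sup>2"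
        using u by (simp add: norm_mult power_mult_distrib V_def uniform_state_def norm_divide power_divide)
    qed
    also have "\<dots> \<le> (\<Sum>u\<in>C. N / card C * (cmod (ift h u))\<^sup>2)"
      using finC by (intro sum_mono2) auto
    finally show ?thesis by (simp add: sum_distrib_left)
  qed
  finally show ?thesis unfolding F_def by simp
qed

end


section \<open>The character pairing on words\<close>

locale code_setup =
  fixes P :: "'f code_data"
  assumes ok: "code_data_ok P"
begin

sublocale F: prime_power_field "fld P" "chr P" "code_data.deg P"
  using ok unfolding code_data_ok_def prime_power_field_def prime_power_field_axioms_def by auto

abbreviation "n \<equiv> blen P"
abbreviation "m \<equiv> slen P"

lemma m_pos: "0 < m" and n_pos: "0 < n"
  using ok unfolding code_data_ok_def by auto

lemma omega_trace_eq: "omega_trace P = F.omega"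
  unfolding omega_trace_def F.omega_def field_trace_def F.tr_def by (rule refl)

lemma cmod_omega_trace: "cmod (omega_trace P a) = 1"
  by (simp add: omega_trace_eq F.cmod_omega)

lemma omega_trace_zero [simp]: "omega_trace P \<zero>\<^bsub>fld P\<^esub> = 1"
  using F.omega_add[of "\<zero>\<^bsub>fld P\<^esub>" "\<zero>\<^bsub>fld P\<^esub>"] F.cmod_omega[of "\<zero>\<^bsub>fld P\<^esub>"] by (auto simp: omega_trace_eq)

lemma omega_trace_finsum:
  assumes "finite A" "g \<in> A \<rightarrow> carrier (fld P)"
  shows "omega_trace P (\<Oplus>\<^bsub>fld P\<^esub>j\<in>A. g j) = (\<Prod>j\<in>A. omega_trace P (g j))"
  using assms
  by (induction A rule: finite_induct) (simp_all add: Pi_def F.omega_add[folded omega_trace_eq] F.finsum_closed)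

lemma finite_alphabet: "finite (alphabet P)"
  unfolding alphabet_def by (intro finite_PiE) (auto simp: F.finite_field)

lemma alphabet_nth [simp]: "\<lbrakk>x \<in> alphabet P; j < m\<rbrakk> \<Longrightarrow> x j \<in> carrier (fld P)"
  unfolding alphabet_def by auto

lemma zero_symbol_in [simp]: "zero_symbol P \<in> alphabet P"
  unfolding alphabet_def zero_symbol_def by auto

lemma words_nth [simp]: "\<lbrakk>x \<in> words P; i < n\<rbrakk> \<Longrightarrow> x i \<in> alphabet P"
  unfolding words_def by auto

lemma finite_words: "finite (words P)"
  unfolding words_def by (intro finite_PiE) (auto simp: finite_alphabet)

lemma card_words: "card (words P) = card (alphabet P) ^ n"
  unfolding words_def by (simp add: card_PiE)

lemma card_alphabet_pos: "0 < card (alphabet P)"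
  using finite_alphabet zero_symbol_in card_gt_0_iff by blast

lemma card_alphabet_gt_1: "1 < card (alphabet P)"
proof -
  have "card (alphabet P) = (chr P ^ code_data.deg P) ^ m"
    unfolding alphabet_def by (simp add: card_PiE F.card_carrier)
  moreover have "1 < (chr P ^ code_data.deg P) ^ m"
    using F.p_gt_1 F.r_pos m_pos by (intro one_less_power)
  ultimately show ?thesis by simp
qed

lemma alphabet_eqI:
  "\<lbrakk>x \<in> alphabet P; y \<in> alphabet P; \<And>j. j < m \<Longrightarrow> x j = y j\<rbrakk> \<Longrightarrow> x = y"
  unfolding alphabet_def by (rule PiE_ext) auto

lemma words_eqI:
  assumes "x \<in> words P" "y \<in> words P" "\<And>i j. \<lbrakk>i < n; j < m\<rbrakk> \<Longrightarrow> x i j = y i j"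
  shows "x = y"
proof (rule PiE_ext)
  show "x \<in> {..<n} \<rightarrow>\<^sub>E alphabet P" "y \<in> {..<n} \<rightarrow>\<^sub>E alphabet P"
    using assms by (auto simp: words_def)
  fix i assume "i \<in> {..<n}"
  then show "x i = y i" using assms by (intro alphabet_eqI) auto
qed

lemma wordsI:
  assumes "\<And>i j. \<lbrakk>i < n; j < m\<rbrakk> \<Longrightarrow> g i j \<in> carrier (fld P)"
  shows "(\<lambda>i\<in>{..<n}. \<lambda>j\<in>{..<m}. g i j) \<in> words P"
  using assms unfolding words_def alphabet_def by auto

lemma dot_closed [simp]: "\<lbrakk>x \<in> alphabet P; z \<in> alphabet P\<rbrakk> \<Longrightarrow> dot P x z \<in> carrier (fld P)"
  unfolding dot_def by (intro F.finsum_closed) auto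

lemma omega_dot:
  assumes "x \<in> alphabet P" "z \<in> alphabet P"
  shows "omega_trace P (dot P x z) = (\<Prod>j<m. omega_trace P (x j \<otimes>\<^bsub>fld P\<^esub> z j))"
  unfolding dot_def using assms by (intro omega_trace_finsum) auto

lemma omega_dot_commute:
  assumes "x \<in> alphabet P" "z \<in> alphabet P"
  shows "omega_trace P (dot P x z) = omega_trace P (dot P z x)"
  using assms by (simp add: omega_dot F.m_comm)

lemma sum_omega_dot:
  assumes x: "x \<in> alphabet P"
  shows "(\<Sum>z\<in>alphabet P. omega_trace P (dot P x z)) = (if x = zero_symbol P then of_nat (card (alphabet P)) else 0)"
proof -
  have "(\<Sum>z\<in>alphabet P. omega_trace P (dot P x z))
      = (\<Sum>z\<in>alphabet P. \<Prod>j<m. omega_trace P (x j \<otimes>\<^bsub>fld P\<^esub> z j))"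
    using x by (intro sum.cong) (auto simp: omega_dot)
  also have "\<dots> = (\<Prod>j<m. \<Sum>a\<in>carrier (fld P). omega_trace P (x j \<otimes>\<^bsub>fld P\<^esub> a))"
    unfolding alphabet_def by (intro prod_sum_PiE[symmetric]) (auto simp: F.finite_field)
  also have "\<dots> = (\<Prod>j<m. if x j = \<zero>\<^bsub>fld P\<^esub> then of_nat (card (carrier (fld P))) else 0)"
    using x by (intro prod.cong) (auto simp: omega_trace_eq F.sum_omega)
  also have "\<dots> = (if x = zero_symbol P then of_nat (card (alphabet P)) else 0)"
  proof (cases "x = zero_symbol P")
    case True
    then have "x j = \<zero>\<^bsub>fld P\<^esub>" if "j < m" for j using that by (simp add: zero_symbol_def)
    then show ?thesis using True by (simp add: alphabet_def card_PiE)
  next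
    case False
    then obtain j where "j < m" "x j \<noteq> \<zero>\<^bsub>fld P\<^esub>"
      using alphabet_eqI[OF x zero_symbol_in] by (auto simp: zero_symbol_def)
    then show ?thesis using False by (auto intro!: prod_zero)
  qed
  finally show ?thesis .
qed

abbreviation "WS \<equiv> word_space P"

lemma carrier_WS [simp]: "carrier WS = words P"
  by (simp add: word_space_def)

lemma zero_WS: "\<zero>\<^bsub>WS\<^esub> = (\<lambda>i\<in>{..<n}. zero_symbol P)"
  by (simp add: word_space_def)

lemma add_WS: "x \<oplus>\<^bsub>WS\<^esub> y = (\<lambda>i\<in>{..<n}. \<lambda>j\<in>{..<m}. x i j \<oplus>\<^bsub>fld P\<^esub> y i j)"
  by (simp add: word_space_def)

lemma smult_WS: "a \<odot>\<^bsub>WS\<^esub> x = (\<lambda>i\<in>{..<n}. \<lambda>j\<in>{..<m}. a \<otimes>\<^bsub>fld P\<^esub> x i j)"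
  by (simp add: word_space_def)

lemma zero_WS_in: "\<zero>\<^bsub>WS\<^esub> \<in> words P"
  unfolding zero_WS words_def by auto

lemma zero_WS_nth: "\<lbrakk>i < n; j < m\<rbrakk> \<Longrightarrow> \<zero>\<^bsub>WS\<^esub> i j = \<zero>\<^bsub>fld P\<^esub>"
  by (simp add: zero_WS zero_symbol_def)

lemma add_WS_in: "\<lbrakk>x \<in> words P; y \<in> words P\<rbrakk> \<Longrightarrow> x \<oplus>\<^bsub>WS\<^esub> y \<in> words P"
  unfolding add_WS by (intro wordsI) auto

lemma add_WS_nth: "\<lbrakk>i < n; j < m\<rbrakk> \<Longrightarrow> (x \<oplus>\<^bsub>WS\<^esub> y) i j = x i j \<oplus>\<^bsub>fld P\<^esub> y i j"
  by (simp add: add_WS)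

lemma abelian_group_WS: "abelian_group WS"
proof (rule abelian_groupI, unfold carrier_WS)
  fix x y z assume x: "x \<in> words P" and y: "y \<in> words P" and z: "z \<in> words P"
  show "x \<oplus>\<^bsub>WS\<^esub> y \<in> words P" using x y by (rule add_WS_in)
  show "x \<oplus>\<^bsub>WS\<^esub> y \<oplus>\<^bsub>WS\<^esub> z = x \<oplus>\<^bsub>WS\<^esub> (y \<oplus>\<^bsub>WS\<^esub> z)"
    using x y z by (intro words_eqI add_WS_in) (auto simp: add_WS_nth F.a_assoc)
  show "x \<oplus>\<^bsub>WS\<^esub> y = y \<oplus>\<^bsub>WS\<^esub> x"
    using x y by (intro words_eqI add_WS_in) (auto simp: add_WS_nth F.a_comm)
next
  fix x assume x: "x \<in> words P"
  show "\<zero>\<^bsub>WS\<^esub> \<oplus>\<^bsub>WS\<^esub> x = x"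
    using x by (intro words_eqI add_WS_in zero_WS_in) (auto simp: add_WS_nth zero_WS_nth)
  let ?y = "\<lambda>i\<in>{..<n}. \<lambda>j\<in>{..<m}. \<ominus>\<^bsub>fld P\<^esub> (x i j)"
  have "?y \<in> words P" using x by (intro wordsI) auto
  moreover have "?y \<oplus>\<^bsub>WS\<^esub> x = \<zero>\<^bsub>WS\<^esub>"
    using x calculation by (intro words_eqI add_WS_in zero_WS_in) (auto simp: add_WS_nth zero_WS_nth F.l_neg)
  ultimately show "\<exists>y\<in>words P. y \<oplus>\<^bsub>WS\<^esub> x = \<zero>\<^bsub>WS\<^esub>" by blast
qed (rule zero_WS_in)

text \<open>The product form lets sums over words factor by position. \<open>word_char_inner\<close>
  recovers the character of the field-valued inner product, by which the dual code is
  defined.\<close>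

definition word_char :: "'f word \<Rightarrow> 'f word \<Rightarrow> complex" where
  "word_char x z = (\<Prod>i<n. omega_trace P (dot P (x i) (z i)))"

lemma word_char_eq:
  assumes "x \<in> words P" "z \<in> words P"
  shows "word_char x z = (\<Prod>i<n. \<Prod>j<m. omega_trace P (x i j \<otimes>\<^bsub>fld P\<^esub> z i j))"
  unfolding word_char_def using assms by (intro prod.cong) (auto simp: omega_dot)

lemma sum_word_char:
  assumes x: "x \<in> words P"
  shows "(\<Sum>z\<in>words P. word_char x z) = (if x = \<zero>\<^bsub>WS\<^esub> then of_nat (card (words P)) else 0)"
proof -
  have "(\<Sum>z\<in>words P. word_char x z) = (\<Prod>i<n. \<Sum>a\<in>alphabet P. omega_trace P (dot P (x i) a))"
    unfolding word_char_def words_def by (intro prod_sum_PiE[symmetric]) (auto simp: finite_alphabet)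
  also have "\<dots> = (\<Prod>i<n. if x i = zero_symbol P then of_nat (card (alphabet P)) else 0)"
    using x by (intro prod.cong) (auto simp: sum_omega_dot)
  also have "\<dots> = (if x = \<zero>\<^bsub>WS\<^esub> then of_nat (card (words P)) else 0)"
  proof (cases "x = \<zero>\<^bsub>WS\<^esub>")
    case True
    then have "x i = zero_symbol P" if "i < n" for i using that by (simp add: zero_WS)
    then show ?thesis using True by (simp add: card_words)
  next
    case False
    have "\<exists>i<n. x i \<noteq> zero_symbol P"
    proof (rule ccontr)
      assume "\<not> ?thesis"
      then have "x = \<zero>\<^bsub>WS\<^esub>" using x by (intro words_eqI zero_WS_in) (auto simp: zero_WS)
      then show False using False by simp
    qed
    then show ?thesis using False by (auto intro!: prod_zero)
  qed
  finally show ?thesis .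
qed

sublocale W: character_pairing WS word_char
proof (intro character_pairing.intro abelian_group_WS character_pairing_axioms.intro, unfold carrier_WS)
  fix x y z assume x: "x \<in> words P" and y: "y \<in> words P" and z: "z \<in> words P"
  show "word_char (x \<oplus>\<^bsub>WS\<^esub> y) z = word_char x z * word_char y z"
    using x y z
    by (simp add: word_char_eq add_WS_in add_WS_nth F.l_distr F.omega_add[folded omega_trace_eq] flip: prod.distrib)
next
  fix x y assume x: "x \<in> words P" and y: "y \<in> words P"
  show "word_char x y = word_char y x"
    unfolding word_char_def using x y by (intro prod.cong) (auto intro!: omega_dot_commute)
  show "cmod (word_char x y) = 1"
    unfolding word_char_def by (simp add: cmod_omega_trace flip: prod_norm)
qed (use finite_words sum_word_char in auto)

lemma code_subset: "code P \<subseteq> words P"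
  and zero_in_code: "\<zero>\<^bsub>WS\<^esub> \<in> code P"
  and add_in_code: "\<lbrakk>x \<in> code P; y \<in> code P\<rbrakk> \<Longrightarrow> x \<oplus>\<^bsub>WS\<^esub> y \<in> code P"
  and minus_in_code: "x \<in> code P \<Longrightarrow> \<ominus>\<^bsub>WS\<^esub> x \<in> code P"
  and smult_in_code: "\<lbrakk>a \<in> carrier (fld P); x \<in> code P\<rbrakk> \<Longrightarrow> a \<odot>\<^bsub>WS\<^esub> x \<in> code P"
proof -
  have s: "submodule (code P) (fld P) WS" using ok by (simp add: code_data_ok_def)
  then have g: "subgroup (code P) (add_monoid WS)" by (simp add: submodule_def)
  show "code P \<subseteq> words P" using subgroup.subset[OF g] by simp
  show "\<zero>\<^bsub>WS\<^esub> \<in> code P" using subgroup.one_closed[OF g] by simp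
  show "x \<oplus>\<^bsub>WS\<^esub> y \<in> code P" if "x \<in> code P" "y \<in> code P" using subgroup.m_closed[OF g that] by simp
  show "\<ominus>\<^bsub>WS\<^esub> x \<in> code P" if "x \<in> code P" using subgroup.m_inv_closed[OF g that] by (simp add: a_inv_def)
  show "a \<odot>\<^bsub>WS\<^esub> x \<in> code P" if "a \<in> carrier (fld P)" "x \<in> code P"
    using submodule.smult_closed[OF s that] .
qed

lemma dec_closed: "dec P \<in> words P \<rightarrow> words P"
  using ok by (simp add: code_data_ok_def)

lemma word_char_inner:
  assumes x: "x \<in> words P" and z: "z \<in> words P"
  shows "word_char x z = omega_trace P (\<Oplus>\<^bsub>fld P\<^esub>i\<in>{..<n}. dot P (x i) (z i))"
  unfolding word_char_def using assms by (subst omega_trace_finsum) auto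

lemma inner_smult:
  assumes a: "a \<in> carrier (fld P)" and x: "x \<in> words P" and z: "z \<in> words P"
  shows "(\<Oplus>\<^bsub>fld P\<^esub>i\<in>{..<n}. dot P ((a \<odot>\<^bsub>WS\<^esub> x) i) (z i))
    = a \<otimes>\<^bsub>fld P\<^esub> (\<Oplus>\<^bsub>fld P\<^esub>i\<in>{..<n}. dot P (x i) (z i))"
proof -
  have d: "dot P ((a \<odot>\<^bsub>WS\<^esub> x) i) (z i) = a \<otimes>\<^bsub>fld P\<^esub> dot P (x i) (z i)" if i: "i < n" for i
  proof -
    have "dot P ((a \<odot>\<^bsub>WS\<^esub> x) i) (z i) = (\<Oplus>\<^bsub>fld P\<^esub>j\<in>{..<m}. a \<otimes>\<^bsub>fld P\<^esub> (x i j \<otimes>\<^bsub>fld P\<^esub> z i j))"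
      unfolding dot_def using assms i by (intro F.finsum_cong') (auto simp: smult_WS F.m_assoc)
    also have "\<dots> = a \<otimes>\<^bsub>fld P\<^esub> dot P (x i) (z i)"
      unfolding dot_def using assms i by (intro F.finsum_rdistr[symmetric]) auto
    finally show ?thesis .
  qed
  have "(\<Oplus>\<^bsub>fld P\<^esub>i\<in>{..<n}. dot P ((a \<odot>\<^bsub>WS\<^esub> x) i) (z i))
      = (\<Oplus>\<^bsub>fld P\<^esub>i\<in>{..<n}. a \<otimes>\<^bsub>fld P\<^esub> dot P (x i) (z i))"
    using assms by (intro F.finsum_cong') (auto simp: d)
  also have "\<dots> = a \<otimes>\<^bsub>fld P\<^esub> (\<Oplus>\<^bsub>fld P\<^esub>i\<in>{..<n}. dot P (x i) (z i))"
    using assms by (intro F.finsum_rdistr[symmetric]) auto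
  finally show ?thesis .
qed

text \<open>Some codeword \<open>c\<close> has nonzero inner product with \<open>x\<close>, but the
  character sees only the trace of it, which may be 0. Since the code is closed under scalars of the
  field, \<open>c\<close> can be scaled until the inner product is some \<open>b\<close> with
  nontrivial character value; translation by the scaled codeword then forces the sum over the code
  to be 0.\<close>

lemma ft_code_eq_0:
  assumes x: "x \<in> words P - dual_code P"
  shows "W.ft (uniform_state (code P)) x = 0"
proof -
  have xw: "x \<in> words P" using x by simp
  let ?inner = "\<lambda>c. \<Oplus>\<^bsub>fld P\<^esub>i\<in>{..<n}. dot P (c i) (x i)"
  obtain c where c: "c \<in> code P" "?inner c \<noteq> \<zero>\<^bsub>fld P\<^esub>"
    using x unfolding dual_code_def by blast
  have cw: "c \<in> words P" using c code_subset by auto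
  have ic: "?inner c \<in> carrier (fld P)" using cw xw by (intro F.finsum_closed) auto
  obtain b where b: "b \<in> carrier (fld P)" "omega_trace P b \<noteq> 1"
    using F.omega_nontrivial by (auto simp: omega_trace_eq)
  define a where "a = b \<otimes>\<^bsub>fld P\<^esub> inv\<^bsub>fld P\<^esub> ?inner c"
  have u: "?inner c \<in> Units (fld P)" using ic c F.field_Units by simp
  have a: "a \<in> carrier (fld P)" "a \<otimes>\<^bsub>fld P\<^esub> ?inner c = b"
    unfolding a_def using b ic u by (simp_all add: F.m_assoc)
  define c1 where "c1 = a \<odot>\<^bsub>WS\<^esub> c"
  have c1: "c1 \<in> code P" unfolding c1_def using a c by (intro smult_in_code)
  have c1w: "c1 \<in> words P" using c1 code_subset by auto
  have ne: "word_char c1 x \<noteq> 1"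
    using b a cw xw c1w inner_smult[OF a(1) cw xw] by (simp add: word_char_inner c1_def)
  let ?S = "\<Sum>c\<in>code P. word_char c x"
  have "?S = (\<Sum>c\<in>code P. word_char (c1 \<oplus>\<^bsub>WS\<^esub> c) x)"
    using c1 c1w code_subset
    by (intro sum.reindex_bij_witness[of _ "\<lambda>c. c1 \<oplus>\<^bsub>WS\<^esub> c" "\<lambda>c. \<ominus>\<^bsub>WS\<^esub> c1 \<oplus>\<^bsub>WS\<^esub> c"])
      (auto simp: W.r_neg1 W.r_neg2 add_in_code minus_in_code subset_iff)
  also have "\<dots> = word_char c1 x * ?S"
    unfolding sum_distrib_left using c1w xw code_subset by (intro sum.cong) (auto simp: W.chi_add)
  finally have "(1 - word_char c1 x) * ?S = 0" by (simp add: algebra_simps)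
  then have S: "?S = 0" using ne by simp
  have "(\<Sum>c\<in>words P. uniform_state (code P) c * word_char c x)
      = (\<Sum>c\<in>code P. uniform_state (code P) c * word_char c x)"
    using code_subset finite_words by (intro sum.mono_neutral_right) (auto simp: uniform_state_def)
  also have "\<dots> = (\<Sum>c\<in>code P. complex_of_real (1 / sqrt (real (card (code P)))) * word_char c x)"
    by (intro sum.cong) (auto simp: uniform_state_def)
  also have "\<dots> = 0" unfolding sum_distrib_left[symmetric] S by simp
  finally show ?thesis unfolding W.ft_def by simp
qed

end


section \<open>States and measurements\<close>

lemma lin_ext_eq_sum:
  assumes "finite A" "\<And>x. x \<notin> A \<Longrightarrow> \<psi> x = 0"
  shows "lin_ext U \<psi> y = (\<Sum>x\<in>A. \<psi> x * U x y)"
  unfolding lin_ext_def using assms by (intro sum.mono_neutral_left) auto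

text \<open>For an operator that maps basis states bijectively, the new amplitude is the old one at
  the preimage; \<open>s\<close> inverts \<open>p\<close> between \<open>A\<close> and
  \<open>B\<close>. This covers the oracle evaluation, the addition of registers and the decoding
  step.\<close>

lemma lin_ext_ket:
  assumes "finite A" "\<And>x. x \<notin> A \<Longrightarrow> \<psi> x = 0"
    and "\<And>x. x \<in> A \<Longrightarrow> p x \<in> B" "\<And>y. y \<in> B \<Longrightarrow> s y \<in> A"
    and "\<And>x. x \<in> A \<Longrightarrow> s (p x) = x" "\<And>y. y \<in> B \<Longrightarrow> p (s y) = y"
  shows "lin_ext (\<lambda>x. ket (p x)) \<psi> y = (if y \<in> B then \<psi> (s y) else 0)"
proof -
  have "lin_ext (\<lambda>x. ket (p x)) \<psi> y = (\<Sum>x\<in>A. \<psi> x * ket (p x) y)"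
    using assms(1,2) by (rule lin_ext_eq_sum)
  also have "\<dots> = (\<Sum>x\<in>A. if x = s y \<and> y \<in> B then \<psi> x else 0)"
    using assms(3-6) by (intro sum.cong) (auto simp: ket_def)
  also have "\<dots> = (if y \<in> B then \<psi> (s y) else 0)"
    using assms(1,4) by (cases "y \<in> B") auto
  finally show ?thesis .
qed

text \<open>\<open>embed_pmf\<close> has the prescribed masses only when these sum to 1, so each
  state has to be shown normalised before its measurement can be analysed.\<close>

lemma pmf_embed_finite:
  assumes A: "finite A" and supp: "\<And>x. x \<notin> A \<Longrightarrow> \<psi> x = 0"
    and norm: "(\<Sum>x\<in>A. (cmod (\<psi> x))\<^sup>2) = 1"
  shows "pmf (embed_pmf (\<lambda>b. (cmod (\<psi> b))\<^sup>2)) b = (cmod (\<psi> b))\<^sup>2"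
proof (rule pmf_embed_pmf)
  have "(\<integral>\<^sup>+x. ennreal ((cmod (\<psi> x))\<^sup>2) \<partial>count_space UNIV) = (\<Sum>x\<in>A. ennreal ((cmod (\<psi> x))\<^sup>2))"
    using A supp by (intro nn_integral_count_space') auto
  also have "\<dots> = ennreal (\<Sum>x\<in>A. (cmod (\<psi> x))\<^sup>2)" by (intro sum_ennreal) auto
  finally show "(\<integral>\<^sup>+x. ennreal ((cmod (\<psi> x))\<^sup>2) \<partial>count_space UNIV) = 1" using norm by simp
qed simp

lemma prob_qmeasure:
  assumes A: "finite A" and supp: "\<And>x. x \<notin> A \<Longrightarrow> \<psi> x = 0"
    and norm: "(\<Sum>x\<in>A. (cmod (\<psi> x))\<^sup>2) = 1"
  shows "measure_pmf.prob (qmeasure g \<psi>) {r. R (fst r)} = (\<Sum>b | b \<in> A \<and> R (g b). (cmod (\<psi> b))\<^sup>2)"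
proof -
  let ?E = "embed_pmf (\<lambda>b. (cmod (\<psi> b))\<^sup>2)"
  note pmf = pmf_embed_finite[OF A supp norm]
  have "qmeasure g \<psi> = map_pmf (\<lambda>b. (g b, post_state g \<psi> (g b))) ?E"
    unfolding qmeasure_def map_pmf_def ..
  then have "measure_pmf.prob (qmeasure g \<psi>) {r. R (fst r)} = measure_pmf.prob ?E {b. R (g b)}"
    by (simp add: vimage_def)
  also have "\<dots> = measure_pmf.prob ?E {b. b \<in> A \<and> R (g b)}"
  proof (rule measure_eq_AE)
    show "AE b in measure_pmf ?E. (b \<in> {b. R (g b)}) = (b \<in> {b. b \<in> A \<and> R (g b)})"
    proof (rule AE_pmfI)
      fix b assume "b \<in> set_pmf ?E"
      then have "b \<in> A" using supp[of b] pmf[of b] by (auto simp: set_pmf_iff)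
      then show "(b \<in> {b. R (g b)}) = (b \<in> {b. b \<in> A \<and> R (g b)})" by simp
    qed
  qed auto
  also have "\<dots> = (\<Sum>b | b \<in> A \<and> R (g b). pmf ?E b)"
    using A by (intro measure_measure_pmf_finite) auto
  finally show ?thesis by (simp add: pmf)
qed

lemma prob_bind_pmf:
  "measure_pmf.prob (bind_pmf M g) X = (\<integral>x. measure_pmf.prob (g x) X \<partial>measure_pmf M)"
  unfolding measure_pmf_bind
  by (rule measure_pmf.measure_bind[where N = "count_space UNIV"])
    (auto simp: measure_pmf_in_subprob_algebra)

lemma prob_bind_pmf_le:
  fixes c :: real
  assumes "0 \<le> c" "\<And>x. \<lbrakk>x \<in> set_pmf M; x \<notin> Z\<rbrakk> \<Longrightarrow> measure_pmf.prob (g x) X \<le> c"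
  shows "measure_pmf.prob (bind_pmf M g) X \<le> measure_pmf.prob M Z + c"
proof -
  have "measure_pmf.prob (bind_pmf M g) X = (\<integral>x. measure_pmf.prob (g x) X \<partial>measure_pmf M)"
    by (rule prob_bind_pmf)
  also have "\<dots> \<le> (\<integral>x. indicator Z x + c \<partial>measure_pmf M)"
  proof (rule integral_mono_AE)
    show "integrable (measure_pmf M) (\<lambda>x. measure_pmf.prob (g x) X)"
      by (rule measure_pmf.integrable_const_bound[where B = 1]) auto
    show "integrable (measure_pmf M) (\<lambda>x. indicator Z x + c)"
      by (rule measure_pmf.integrable_const_bound[where B = "1 + c"])
        (use assms(1) in \<open>auto simp: indicator_def\<close>)
    show "AE x in measure_pmf M. measure_pmf.prob (g x) X \<le> indicator Z x + c"
    proof (rule AE_pmfI)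
      fix x assume "x \<in> set_pmf M"
      then show "measure_pmf.prob (g x) X \<le> indicator Z x + c"
        using assms(1) assms(2)[of x] measure_pmf.prob_le_1[of "g x" X] unfolding indicator_def
        by (cases "x \<in> Z") (simp_all add: add_increasing2)
    qed
  qed
  also have "\<dots> = measure_pmf.prob M Z + c"
    by (subst Bochner_Integration.integral_add) (auto intro: measure_pmf.integrable_const_bound[where B = 1])
  finally show ?thesis .
qed

lemma set_repeat_trial:
  assumes "set_pmf T \<subseteq> insert None X"
  shows "set_pmf (repeat_trial k T) \<subseteq> insert None X"
  using assms by (induction k) (auto split: option.splits)

lemma pmf_repeat_trial_None: "pmf (repeat_trial k T) None = pmf T None ^ k"
proof (induction k)
  case (Suc k)
  have "pmf (repeat_trial (Suc k) T) None
      = (\<integral>r. pmf (repeat_trial k T) None * indicator {None} r \<partial>measure_pmf T)"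
    unfolding repeat_trial.simps pmf_bind
  proof (rule Bochner_Integration.integral_cong[OF refl])
    fix r
    show "pmf (case r of None \<Rightarrow> repeat_trial k T | Some s \<Rightarrow> return_pmf (Some s)) None
        = pmf (repeat_trial k T) None * indicator {None} r"
      by (cases r) auto
  qed
  also have "\<dots> = pmf (repeat_trial k T) None * pmf T None"
    by (simp add: measure_pmf_single)
  finally show ?case by (simp add: Suc.IH)
qed simp

context code_setup
begin

text \<open>The counterpart of \<open>chi_orthogonal\<close> for single symbols, as the pairing is
  instantiated for words. It serves the inverse transform and the second moments.\<close>

lemma omega_dot_orthogonal:
  assumes x: "x \<in> alphabet P" and y: "y \<in> alphabet P"
  shows "(\<Sum>z\<in>alphabet P. omega_trace P (dot P x z) * cnj (omega_trace P (dot P y z)))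
    = (if x = y then of_nat (card (alphabet P)) else 0)"
proof -
  define w where "w = (\<lambda>j\<in>{..<m}. x j \<ominus>\<^bsub>fld P\<^esub> y j)"
  have w: "w \<in> alphabet P" using x y unfolding w_def alphabet_def by auto
  have diff: "omega_trace P (a \<ominus>\<^bsub>fld P\<^esub> b) = omega_trace P a * cnj (omega_trace P b)"
    if a: "a \<in> carrier (fld P)" and b: "b \<in> carrier (fld P)" for a b
  proof -
    have "omega_trace P (a \<ominus>\<^bsub>fld P\<^esub> b) * omega_trace P b = omega_trace P a"
      using a b by (simp add: F.omega_add[folded omega_trace_eq, symmetric] F.minus_eq F.a_assoc F.l_neg)
    moreover have "omega_trace P b * cnj (omega_trace P b) = 1"
      using cmod_omega_trace[of b] by (simp add: complex_norm_square[symmetric])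
    ultimately show ?thesis by (metis mult.assoc mult.right_neutral)
  qed
  have "omega_trace P (dot P x z) * cnj (omega_trace P (dot P y z)) = omega_trace P (dot P w z)"
    if z: "z \<in> alphabet P" for z
  proof -
    have "omega_trace P (w j \<otimes>\<^bsub>fld P\<^esub> z j)
        = omega_trace P (x j \<otimes>\<^bsub>fld P\<^esub> z j) * cnj (omega_trace P (y j \<otimes>\<^bsub>fld P\<^esub> z j))" if j: "j < m" for j
    proof -
      have "w j \<otimes>\<^bsub>fld P\<^esub> z j = (x j \<otimes>\<^bsub>fld P\<^esub> z j) \<ominus>\<^bsub>fld P\<^esub> (y j \<otimes>\<^bsub>fld P\<^esub> z j)"
        using x y z j by (simp add: w_def F.minus_eq F.l_distr F.l_minus)
      then show ?thesis using x y z j by (simp add: diff)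
    qed
    then show ?thesis using x y z w by (simp add: omega_dot prod.distrib)
  qed
  then have "(\<Sum>z\<in>alphabet P. omega_trace P (dot P x z) * cnj (omega_trace P (dot P y z)))
      = (\<Sum>z\<in>alphabet P. omega_trace P (dot P w z))"
    by (intro sum.cong) auto
  also have "\<dots> = (if w = zero_symbol P then of_nat (card (alphabet P)) else 0)"
    by (rule sum_omega_dot[OF w])
  also have "w = zero_symbol P \<longleftrightarrow> x = y"
  proof
    assume wz: "w = zero_symbol P"
    show "x = y"
    proof (rule alphabet_eqI[OF x y])
      fix j assume j: "j < m"
      then have "x j \<ominus>\<^bsub>fld P\<^esub> y j = w j" by (simp add: w_def)
      also have "\<dots> = \<zero>\<^bsub>fld P\<^esub>" using j by (simp add: wz zero_symbol_def)
      finally show "x j = y j" using x y j by simp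
    qed
  next
    assume "x = y"
    then show "w = zero_symbol P"
      using y unfolding w_def zero_symbol_def by (intro restrict_ext) simp
  qed
  finally show ?thesis .
qed

abbreviation "Q \<equiv> card (alphabet P)"

text \<open>\<open>qft_inv\<close> is an \<open>inv_into\<close> and is pinned down only by
  injectivity on the states supported on the alphabet. The left inverse exhibited here is the
  conjugate transform.\<close>

lemma lin_ext_qft_inject:
  "inj_on (lin_ext (qft P)) {\<psi>. \<forall>x. \<psi> x \<noteq> 0 \<longrightarrow> x \<in> alphabet P}"
proof (rule inj_on_inverseI)
  fix \<psi> :: "'f symbol state" assume "\<psi> \<in> {\<psi>. \<forall>x. \<psi> x \<noteq> 0 \<longrightarrow> x \<in> alphabet P}"
  then have \<psi>: "\<psi> x = 0" if "x \<notin> alphabet P" for x using that by auto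
  show "(\<lambda>\<phi> u. if u \<in> alphabet P
      then (\<Sum>z\<in>alphabet P. \<phi> z * cnj (omega_trace P (dot P u z))) / complex_of_real (sqrt Q) else 0)
      (lin_ext (qft P) \<psi>) = \<psi>"
  proof (rule ext)
    fix u
    show "(if u \<in> alphabet P
      then (\<Sum>z\<in>alphabet P. lin_ext (qft P) \<psi> z * cnj (omega_trace P (dot P u z))) / complex_of_real (sqrt Q) else 0)
      = \<psi> u"
    proof (cases "u \<in> alphabet P")
      case u: True
      have "(\<Sum>z\<in>alphabet P. lin_ext (qft P) \<psi> z * cnj (omega_trace P (dot P u z)))
          = (\<Sum>z\<in>alphabet P. \<Sum>x\<in>alphabet P. \<psi> x / complex_of_real (sqrt Q)
              * (omega_trace P (dot P x z) * cnj (omega_trace P (dot P u z))))"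
        by (intro sum.cong) (auto simp: lin_ext_eq_sum[OF finite_alphabet \<psi>] qft_def sum_distrib_left mult_ac)
      also have "\<dots> = (\<Sum>x\<in>alphabet P. \<psi> x / complex_of_real (sqrt Q)
          * (\<Sum>z\<in>alphabet P. omega_trace P (dot P x z) * cnj (omega_trace P (dot P u z))))"
        unfolding sum_distrib_left by (rule sum.swap)
      also have "\<dots> = (\<Sum>x\<in>alphabet P. if x = u then \<psi> x / complex_of_real (sqrt Q) * of_nat Q else 0)"
        using u by (intro sum.cong) (auto simp: omega_dot_orthogonal)
      also have "\<dots> = \<psi> u * (of_nat Q / complex_of_real (sqrt Q))"
        using u finite_alphabet by simp
      also have "of_nat Q / complex_of_real (sqrt Q) = complex_of_real (sqrt Q)"
        by (metis of_real_divide of_real_of_nat_eq real_div_sqrt of_nat_0_le_iff)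
      finally show ?thesis using u card_alphabet_pos by simp
    qed (simp add: \<psi>)
  qed
qed

lemma qft_inv_eq:
  assumes z: "z \<in> alphabet P"
  shows "qft_inv P z = (\<lambda>u. if u \<in> alphabet P
    then cnj (omega_trace P (dot P z u)) / complex_of_real (sqrt Q) else 0)"
proof -
  let ?\<psi> = "\<lambda>u. if u \<in> alphabet P then cnj (omega_trace P (dot P z u)) / complex_of_real (sqrt Q) else 0"
  have "lin_ext (qft P) ?\<psi> = ket z"
  proof (rule ext)
    fix y
    show "lin_ext (qft P) ?\<psi> y = ket z y"
    proof (cases "y \<in> alphabet P")
      case y: True
      have "lin_ext (qft P) ?\<psi> y
          = (\<Sum>x\<in>alphabet P. omega_trace P (dot P y x) * cnj (omega_trace P (dot P z x)) / of_nat Q)"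
        unfolding lin_ext_eq_sum[OF finite_alphabet, of ?\<psi>, simplified] using y
        by (intro sum.cong) (auto simp: qft_def omega_dot_commute[of y] simp flip: of_real_mult)
      also have "\<dots> = ket z y"
        unfolding sum_divide_distrib[symmetric] using y z card_alphabet_pos
        by (simp add: omega_dot_orthogonal ket_def)
      finally show ?thesis .
    next
      case False
      then show ?thesis using z
        by (auto simp: lin_ext_eq_sum[OF finite_alphabet, of ?\<psi>] qft_def ket_def)
    qed
  qed
  then show ?thesis unfolding qft_inv_def
    by (intro inv_into_f_eq[OF lin_ext_qft_inject]) auto
qed

abbreviation "NW \<equiv> card (words P)"

lemma sqrt_card_words: "sqrt NW = (\<Prod>i<n. sqrt Q)"
  by (simp add: card_words real_sqrt_power)

lemma in_words_iff: "x \<in> words P \<longleftrightarrow> x \<in> extensional {..<n} \<and> (\<forall>i<n. x i \<in> alphabet P)"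
  unfolding words_def PiE_def by auto

lemma qft_n_eq:
  "qft_n P x z = (if z \<in> words P then word_char x z / complex_of_real (sqrt NW) else 0)"
proof (cases "z \<in> words P")
  case True
  then show ?thesis
    by (simp add: qft_n_def tensor_n_def in_words_iff qft_def word_char_def sqrt_card_words prod_dividef)
next
  case False
  then show ?thesis
    unfolding qft_n_def tensor_n_def in_words_iff by (auto simp: qft_def intro!: prod_zero)
qed

text \<open>For a symbol outside the alphabet, \<open>ket\<close> has no preimage and
  \<open>qft_inv\<close> is an arbitrary choice; hence the assumption on \<open>z\<close>.\<close>

lemma qft_inv_n_eq:
  assumes "z \<in> words P"
  shows "qft_inv_n P z u = (if u \<in> words P then cnj (word_char z u) / complex_of_real (sqrt NW) else 0)"
proof (cases "u \<in> words P")
  case True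
  then show ?thesis using assms
    by (simp add: qft_inv_n_def tensor_n_def in_words_iff qft_inv_eq word_char_def sqrt_card_words prod_dividef)
next
  case False
  then show ?thesis using assms
    unfolding qft_inv_n_def tensor_n_def in_words_iff by (auto simp: qft_inv_eq intro!: prod_zero)
qed

lemma lin_ext_qft_n:
  assumes "\<And>x. x \<notin> words P \<Longrightarrow> \<psi> x = 0"
  shows "lin_ext (qft_n P) \<psi> z = (if z \<in> words P then W.ft \<psi> z else 0)"
  using lin_ext_eq_sum[OF finite_words assms, where U = "qft_n P"]
  by (simp add: qft_n_eq W.ft_def sum_divide_distrib)

text \<open>Replaces the circuit by \<open>ft\<close>, \<open>decoded\<close> and \<open>ift\<close>
  on the group of words. The two arithmetic maps are bijective on pairs of words, and amplitudes are
  pulled back along their inverses, which subtract \<open>x\<close> from \<open>z\<close> and add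
  \<open>dec P z\<close> to \<open>x\<close>.\<close>

lemma final_state_eq:
  assumes \<phi>: "\<And>x. x \<notin> words P \<Longrightarrow> tensor_n n \<phi> x = 0"
  shows "final_state P \<phi> (y, u) = (if y \<in> words P \<and> u \<in> words P
    then W.ift (W.decoded (dec P) (W.ft (uniform_state (code P))) (W.ft (tensor_n n \<phi>)) y) u else 0)"
proof -
  let ?V = "W.ft (uniform_state (code P))" and ?W = "W.ft (tensor_n n \<phi>)"
  let ?A = "words P \<times> words P"
  have fin: "finite ?A" using finite_words by simp
  define s0 where "s0 = lin_ext (qft_n P) (uniform_state (code P)) \<otimes>\<^sub>q lin_ext (qft_n P) (tensor_n n \<phi>)"
  define s1 where "s1 = lin_ext (\<lambda>(x, e). ket (x, x \<oplus>\<^bsub>WS\<^esub> e)) s0"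
  define s2 where "s2 = lin_ext (\<lambda>(x, z). ket (x \<ominus>\<^bsub>WS\<^esub> dec P z, z)) s1"
  have s0: "s0 (x, e) = (if x \<in> words P \<and> e \<in> words P then ?V x * ?W e else 0)" for x e
    unfolding s0_def tensor_def using code_subset \<phi>
    by (subst (1 2) lin_ext_qft_n) (auto simp: uniform_state_def)
  have s1: "s1 (x, z) = (if x \<in> words P \<and> z \<in> words P then ?V x * ?W (z \<ominus>\<^bsub>WS\<^esub> x) else 0)" for x z
  proof -
    have "s1 (x, z) = lin_ext (\<lambda>p. ket (case p of (x, e) \<Rightarrow> (x, x \<oplus>\<^bsub>WS\<^esub> e))) s0 (x, z)"
      unfolding s1_def by (simp add: case_prod_unfold)
    also have "\<dots> = (if (x, z) \<in> ?A then s0 (case (x, z) of (x, z) \<Rightarrow> (x, z \<ominus>\<^bsub>WS\<^esub> x)) else 0)"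
    proof (rule lin_ext_ket[OF fin])
      fix p assume "p \<in> ?A"
      then obtain x z where p: "p = (x, z)" "x \<in> words P" "z \<in> words P" by auto
      show "(case p of (x, e) \<Rightarrow> (x, x \<oplus>\<^bsub>WS\<^esub> e)) \<in> ?A" "(case p of (x, z) \<Rightarrow> (x, z \<ominus>\<^bsub>WS\<^esub> x)) \<in> ?A"
        using p W.minus_closed[of z x] by (auto intro: add_WS_in)
      have z: "x \<oplus>\<^bsub>WS\<^esub> (z \<oplus>\<^bsub>WS\<^esub> \<ominus>\<^bsub>WS\<^esub> x) = z" "(x \<oplus>\<^bsub>WS\<^esub> z) \<oplus>\<^bsub>WS\<^esub> \<ominus>\<^bsub>WS\<^esub> x = z"
        using p W.a_lcomm[of x z "\<ominus>\<^bsub>WS\<^esub> x"] W.a_comm[of x z] W.a_assoc[of z x "\<ominus>\<^bsub>WS\<^esub> x"] W.a_inv_closed[of x]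
        by (simp_all add: W.r_neg)
      then show "(case (case p of (x, e) \<Rightarrow> (x, x \<oplus>\<^bsub>WS\<^esub> e)) of (x, z) \<Rightarrow> (x, z \<ominus>\<^bsub>WS\<^esub> x)) = p"
        "(case (case p of (x, z) \<Rightarrow> (x, z \<ominus>\<^bsub>WS\<^esub> x)) of (x, e) \<Rightarrow> (x, x \<oplus>\<^bsub>WS\<^esub> e)) = p"
        using p by (simp_all add: W.minus_eq)
    qed (auto simp: s0 split: if_splits)
    finally show ?thesis using W.minus_closed[of z x] by (auto simp: s0)
  qed
  have s2: "s2 (x, z) = (if x \<in> words P \<and> z \<in> words P then W.decoded (dec P) ?V ?W x z else 0)" for x z
  proof -
    have "s2 (x, z) = lin_ext (\<lambda>p. ket (case p of (x, z) \<Rightarrow> (x \<ominus>\<^bsub>WS\<^esub> dec P z, z))) s1 (x, z)"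
      unfolding s2_def by (simp add: case_prod_unfold)
    also have "\<dots> = (if (x, z) \<in> ?A then s1 (case (x, z) of (x, z) \<Rightarrow> (x \<oplus>\<^bsub>WS\<^esub> dec P z, z)) else 0)"
    proof (rule lin_ext_ket[OF fin])
      fix p assume "p \<in> ?A"
      then obtain x z where p: "p = (x, z)" "x \<in> words P" "z \<in> words P" by auto
      have d: "dec P z \<in> words P" using p dec_closed by auto
      show "(case p of (x, z) \<Rightarrow> (x \<ominus>\<^bsub>WS\<^esub> dec P z, z)) \<in> ?A" "(case p of (x, z) \<Rightarrow> (x \<oplus>\<^bsub>WS\<^esub> dec P z, z)) \<in> ?A"
        using p d W.minus_closed[of x "dec P z"] by (auto intro: add_WS_in)
      show "(case (case p of (x, z) \<Rightarrow> (x \<ominus>\<^bsub>WS\<^esub> dec P z, z)) of (x, z) \<Rightarrow> (x \<oplus>\<^bsub>WS\<^esub> dec P z, z)) = p"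
        "(case (case p of (x, z) \<Rightarrow> (x \<oplus>\<^bsub>WS\<^esub> dec P z, z)) of (x, z) \<Rightarrow> (x \<ominus>\<^bsub>WS\<^esub> dec P z, z)) = p"
        using p d W.a_assoc[of x] W.a_inv_closed[of "dec P z"]
        by (simp_all add: W.minus_eq W.l_neg W.r_neg)
    qed (auto simp: s1 split: if_splits)
    finally show ?thesis using dec_closed by (auto simp: s1 W.decoded_def intro: add_WS_in)
  qed
  have "final_state P \<phi> (y, u) = lin_ext (\<lambda>(x, z). ket x \<otimes>\<^sub>q qft_inv_n P z) s2 (y, u)"
    unfolding final_state_def Let_def s2_def s1_def s0_def ..
  also have "\<dots> = (\<Sum>(x, z)\<in>?A. s2 (x, z) * (ket x y * qft_inv_n P z u))"
    by (subst lin_ext_eq_sum[OF fin]) (auto simp: s2 tensor_def intro!: sum.cong split: if_splits)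
  also have "\<dots> = (\<Sum>x\<in>words P. \<Sum>z\<in>words P. s2 (x, z) * (ket x y * qft_inv_n P z u))"
    by (simp add: sum.cartesian_product)
  also have "\<dots> = (\<Sum>x\<in>words P. if x = y then \<Sum>z\<in>words P. s2 (x, z) * qft_inv_n P z u else 0)"
    by (intro sum.cong) (auto simp: ket_def)
  also have "\<dots> = (if y \<in> words P then \<Sum>z\<in>words P. s2 (y, z) * qft_inv_n P z u else 0)"
    using finite_words by simp
  also have "\<dots> = (if y \<in> words P \<and> u \<in> words P
      then W.ift (W.decoded (dec P) ?V ?W y) u else 0)"
    by (auto simp: s2 qft_inv_n_eq W.ift_def sum_divide_distrib intro!: sum.cong)
  finally show ?thesis .
qed

end


section \<open>The base protocol for a fixed oracle\<close>

lemma prob_Pi_pmf_ex_le: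
  assumes "finite A"
  shows "measure_pmf.prob (Pi_pmf A d p) {f. \<exists>x\<in>A. R x (f x)} \<le> (\<Sum>x\<in>A. measure_pmf.prob (p x) {y. R x y})"
proof -
  have "measure_pmf.prob (Pi_pmf A d p) {f. \<exists>x\<in>A. R x (f x)}
      = measure_pmf.prob (Pi_pmf A d p) (\<Union>x\<in>A. {f. R x (f x)})"
    by (intro arg_cong2[where f = measure]) auto
  also have "\<dots> \<le> (\<Sum>x\<in>A. measure_pmf.prob (Pi_pmf A d p) {f. R x (f x)})"
    using assms by (intro measure_pmf.finite_measure_subadditive_finite) auto
  also have "\<dots> = (\<Sum>x\<in>A. measure_pmf.prob (p x) {y. R x y})"
  proof (intro sum.cong refl)
    fix x assume x: "x \<in> A"
    have "p x = map_pmf (\<lambda>f. f x) (Pi_pmf A d p)" using assms x by (simp add: Pi_pmf_component)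
    then show "measure_pmf.prob (Pi_pmf A d p) {f. R x (f x)} = measure_pmf.prob (p x) {y. R x y}"
      by (simp add: vimage_def)
  qed
  finally show ?thesis .
qed

context code_setup
begin

lemma alphabet_nonempty: "alphabet P \<noteq> {}"
  using zero_symbol_in by blast

definition accepting :: "'f oracle_fun \<Rightarrow> nat \<Rightarrow> 'f symbol set" where
  "accepting G i = {x \<in> alphabet P. G x i}"

lemma accepting_subset: "accepting G i \<subseteq> alphabet P"
  by (auto simp: accepting_def)

lemma finite_accepting: "finite (accepting G i)"
  using accepting_subset finite_alphabet finite_subset by blast

text \<open>The measured bit is distributed as that of a uniform symbol. On success the collapsed
  state is the same whichever symbol was drawn, so the only random information in a trial is whether
  it succeeds.\<close>

lemma trial_eq:
  "trial P G i = map_pmf (\<lambda>x. if G x i then Some (uniform_state (accepting G i)) else None) (pmf_of_set (alphabet P))"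
proof -
  let ?T = "accepting G i"
  let ?A = "alphabet P \<times> (UNIV :: bool set)"
  define \<psi> where "\<psi> = lin_ext (\<lambda>(x, b). ket (x, b \<noteq> G x i)) (uniform_state (alphabet P) \<otimes>\<^sub>q ket False)"
  have fin: "finite ?A" using finite_alphabet by simp
  have \<psi>: "\<psi> (x, b) = (if x \<in> alphabet P \<and> b = G x i then complex_of_real (1 / sqrt Q) else 0)" for x b
  proof -
    have "\<psi> (x, b) = lin_ext (\<lambda>p. ket (case p of (x, b) \<Rightarrow> (x, b \<noteq> G x i))) (uniform_state (alphabet P) \<otimes>\<^sub>q ket False) (x, b)"
      unfolding \<psi>_def by (simp add: case_prod_unfold)
    also have "\<dots> = (if (x, b) \<in> ?A then (uniform_state (alphabet P) \<otimes>\<^sub>q ket False) (case (x, b) of (x, b) \<Rightarrow> (x, b \<noteq> G x i)) else 0)"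
      by (rule lin_ext_ket[OF fin]) (auto simp: tensor_def uniform_state_def split: if_splits)
    finally show ?thesis by (auto simp: tensor_def uniform_state_def ket_def)
  qed
  have norm: "(\<Sum>p\<in>?A. (cmod (\<psi> p))\<^sup>2) = 1"
  proof -
    have "(\<Sum>p\<in>?A. (cmod (\<psi> p))\<^sup>2) = (\<Sum>x\<in>alphabet P. \<Sum>b\<in>UNIV. (cmod (\<psi> (x, b)))\<^sup>2)"
      by (simp add: sum.cartesian_product)
    also have "\<dots> = (\<Sum>x\<in>alphabet P. 1 / real Q)"
      by (intro sum.cong) (auto simp: UNIV_bool \<psi> norm_divide power_divide)
    finally show ?thesis using card_alphabet_pos by simp
  qed
  have "\<psi> p = 0" if "p \<notin> ?A" for p using that by (cases p) (auto simp: \<psi>)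
  note pmf = pmf_embed_finite[OF fin this norm]
  have embed: "embed_pmf (\<lambda>b. (cmod (\<psi> b))\<^sup>2) = map_pmf (\<lambda>x. (x, G x i)) (pmf_of_set (alphabet P))"
  proof (rule pmf_eqI)
    fix p :: "'f symbol \<times> bool"
    obtain x b where p: "p = (x, b)" by (cases p)
    have "(\<lambda>x. (x, G x i)) -` {(x, b)} = (if b = G x i then {x} else {})" by auto
    then have "pmf (map_pmf (\<lambda>x. (x, G x i)) (pmf_of_set (alphabet P))) (x, b)
        = (if b = G x i then pmf (pmf_of_set (alphabet P)) x else 0)"
      by (simp add: pmf_map measure_pmf_single)
    also have "\<dots> = (cmod (\<psi> (x, b)))\<^sup>2"
      using finite_alphabet alphabet_nonempty
      by (subst pmf_of_set) (auto simp: \<psi> norm_divide power_divide indicator_def)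
    finally have "pmf (map_pmf (\<lambda>x. (x, G x i)) (pmf_of_set (alphabet P))) (x, b) = (cmod (\<psi> (x, b)))\<^sup>2" .
    with pmf[of "(x, b)"] show "pmf (embed_pmf (\<lambda>b. (cmod (\<psi> b))\<^sup>2)) p = pmf (map_pmf (\<lambda>x. (x, G x i)) (pmf_of_set (alphabet P))) p"
      unfolding p by (rule trans[OF _ sym])
  qed
  \<comment> \<open>The amplitude \<open>1 / sqrt Q\<close> is divided by the root of the outcome
    probability, the fraction of accepting symbols.\<close>
  have post: "(\<lambda>x. post_state snd \<psi> True (x, True)) = uniform_state ?T"
  proof
    fix x
    have "{b'. \<psi> b' \<noteq> 0 \<and> snd b' = True} = (\<lambda>x. (x, True)) ` ?T"
      using card_alphabet_pos by (auto simp: \<psi> accepting_def image_iff split: if_splits)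
    then have "(\<Sum>b' | \<psi> b' \<noteq> 0 \<and> snd b' = True. (cmod (\<psi> b'))\<^sup>2) = (\<Sum>x\<in>?T. (cmod (\<psi> (x, True)))\<^sup>2)"
      by (simp add: sum.reindex inj_on_def)
    also have "\<dots> = (\<Sum>x\<in>?T. 1 / real Q)"
      by (intro sum.cong) (auto simp: \<psi> accepting_def norm_divide power_divide)
    finally have *: "(\<Sum>b' | \<psi> b' \<noteq> 0 \<and> snd b' = True. (cmod (\<psi> b'))\<^sup>2) = real (card ?T) / real Q" by simp
    show "post_state snd \<psi> True (x, True) = uniform_state ?T x"
      unfolding post_state_def * using card_alphabet_pos
      by (auto simp: \<psi> uniform_state_def accepting_def real_sqrt_divide simp flip: of_real_divide)
  qed
  have "trial P G i = bind_pmf (embed_pmf (\<lambda>b. (cmod (\<psi> b))\<^sup>2))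
      (\<lambda>b. return_pmf (if snd b then Some (\<lambda>x. post_state snd \<psi> (snd b) (x, True)) else None))"
    unfolding trial_def qmeasure_def \<psi>_def[symmetric] by (simp add: bind_assoc_pmf bind_return_pmf)
  also have "\<dots> = map_pmf (\<lambda>x. if G x i then Some (uniform_state ?T) else None) (pmf_of_set (alphabet P))"
    unfolding embed map_pmf_def bind_assoc_pmf bind_return_pmf
    by (intro bind_pmf_cong) (auto simp: post)
  finally show ?thesis .
qed

lemma pmf_trial_None: "pmf (trial P G i) None = 1 - card (accepting G i) / Q"
proof -
  have "(\<lambda>x. if G x i then Some (uniform_state (accepting G i)) else None) -` {None} = {x. \<not> G x i}" by auto
  then have "pmf (trial P G i) None = measure_pmf.prob (pmf_of_set (alphabet P)) {x. \<not> G x i}"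
    unfolding trial_eq by (simp add: pmf_map)
  also have "\<dots> = card (alphabet P \<inter> {x. \<not> G x i}) / Q"
    using finite_alphabet alphabet_nonempty by (intro measure_pmf_of_set)
  also have "alphabet P \<inter> {x. \<not> G x i} = alphabet P - accepting G i" by (auto simp: accepting_def)
  also have "real (card \<dots>) = real Q - real (card (accepting G i))"
    using finite_accepting accepting_subset card_mono[OF finite_alphabet accepting_subset]
    by (simp add: card_Diff_subset of_nat_diff)
  finally show ?thesis using card_alphabet_pos by (simp add: diff_divide_distrib)
qed

lemma set_trial: "set_pmf (trial P G i) \<subseteq> insert None {Some (uniform_state (accepting G i))}"
  unfolding trial_eq by auto

text \<open>An error is bad as soon as one dual codeword is decoded wrongly. This is the complement,
  among words, of the event in \<open>decoding_prob\<close>, and outside it all dual codewords in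
  the superposition decode at once.\<close>

definition bad_errors :: "'f word set" where
  "bad_errors = {e \<in> words P. \<exists>x\<in>dual_code P. dec P (x \<oplus>\<^bsub>WS\<^esub> e) \<noteq> x}"

definition bad_part :: "('f word \<Rightarrow> complex) \<Rightarrow> 'f word \<Rightarrow> complex" where
  "bad_part W e = (if e \<in> bad_errors then W.ft W e else 0)"

text \<open>The right-hand side of \<open>decoding_failure\<close>. It is stated for any
  \<open>W\<close> because it bounds the failure of the actual state but is averaged for a rescaled
  one. Being quadratic in \<open>W\<close>, it scales well and its average involves second moments
  only.\<close>

definition failure_mass :: "('f word \<Rightarrow> complex) \<Rightarrow> real" where
  "failure_mass W = 2 * (NW / card (code P) * (\<Sum>u\<in>code P. (cmod (W.ift (bad_part W) u))\<^sup>2))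
     + 2 * (\<Sum>e\<in>bad_errors. (cmod (W.ft W e))\<^sup>2)"

lemma bad_errors_subset: "bad_errors \<subseteq> words P"
  by (auto simp: bad_errors_def)

lemma tensor_accepting_eq_0:
  "x \<notin> words P \<Longrightarrow> tensor_n n (\<lambda>i. uniform_state (accepting G i)) x = 0"
  using accepting_subset unfolding tensor_n_def in_words_iff
  by (auto simp: uniform_state_def intro!: prod_zero)

text \<open>Aborts and rejected outputs are bounded separately. Without an abort every prepared
  factor is the uniform state on its accepting set, so the measured state is determined by
  \<open>G\<close>. That product state is nonzero exactly at the words passing all oracle checks,
  which makes rejection the event of \<open>decoding_failure\<close>. Nonempty accepting sets make
  it a unit vector.\<close>

lemma prob_prove_failure:
  assumes ne: "\<And>i. i < n \<Longrightarrow> accepting G i \<noteq> {}"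
  shows "measure_pmf.prob (prove P l G) {\<pi>. \<not> verify P G \<pi>}
    \<le> (\<Sum>i<n. (1 - card (accepting G i) / Q) ^ l) + failure_mass (tensor_n n (\<lambda>i. uniform_state (accepting G i)))"
proof -
  let ?S = "Pi_pmf {..<n} None (\<lambda>i. repeat_trial l (trial P G i))"
  let ?W = "tensor_n n (\<lambda>i. uniform_state (accepting G i))"
  let ?V = "uniform_state (code P)"
  have W_nz: "?W x \<noteq> 0 \<longleftrightarrow> (\<forall>i<n. G (x i) i)" if "x \<in> words P" for x
    using that ne finite_accepting card_gt_0_iff
    by (auto simp: tensor_n_def in_words_iff uniform_state_def accepting_def)
  have W_norm: "(\<Sum>x\<in>words P. (cmod (?W x))\<^sup>2) = 1"
  proof -
    have "(\<Sum>x\<in>words P. (cmod (?W x))\<^sup>2) = (\<Sum>x\<in>words P. \<Prod>i<n. (cmod (uniform_state (accepting G i) (x i)))\<^sup>2)"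
      by (intro sum.cong) (auto simp: tensor_n_def in_words_iff norm_power prod_power_distrib simp flip: prod_norm)
    also have "\<dots> = (\<Prod>i<n. \<Sum>a\<in>alphabet P. (cmod (uniform_state (accepting G i) a))\<^sup>2)"
      unfolding words_def by (intro prod_sum_PiE[symmetric]) (auto simp: finite_alphabet)
    also have "\<dots> = (\<Prod>i<n. 1)"
      using finite_alphabet accepting_subset ne by (intro prod.cong sum_uniform_state) auto
    finally show ?thesis by simp
  qed
  define g where "g s = (if \<exists>i<n. s i = None then return_pmf None
     else do { (x, _) \<leftarrow> qmeasure snd (final_state P (\<lambda>i. the (s i))); return_pmf (Some x) })"
    for s :: "nat \<Rightarrow> 'f symbol state option"
  have "failure_mass ?W \<ge> 0"
    unfolding failure_mass_def by (intro add_nonneg_nonneg mult_nonneg_nonneg sum_nonneg) auto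
  then have "measure_pmf.prob (bind_pmf ?S g) {\<pi>. \<not> verify P G \<pi>}
    \<le> measure_pmf.prob ?S {s. \<exists>i\<in>{..<n}. s i = None} + failure_mass ?W"
  proof (rule prob_bind_pmf_le)
    fix s assume s: "s \<in> set_pmf ?S" "s \<notin> {s. \<exists>i\<in>{..<n}. s i = None}"
    have si: "s i = Some (uniform_state (accepting G i))" if i: "i < n" for i
    proof -
      have "s i \<in> set_pmf (repeat_trial l (trial P G i))"
        using s(1) i set_Pi_pmf[of "{..<n}" None "\<lambda>i. repeat_trial l (trial P G i)"]
        by (auto simp: PiE_dflt_def)
      then show ?thesis using set_repeat_trial[OF set_trial] s(2) i by fastforce
    qed
    define \<eta> where "\<eta> = final_state P (\<lambda>i. the (s i))"
    have tn: "tensor_n n (\<lambda>i. the (s i)) = ?W"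
      unfolding tensor_n_def by (intro ext) (auto simp: si intro!: prod.cong)
    have \<eta>: "\<eta> (y, u) = (if y \<in> words P \<and> u \<in> words P
        then W.ift (W.decoded (dec P) (W.ft ?V) (W.ft ?W) y) u else 0)" for y u
      unfolding \<eta>_def using tensor_accepting_eq_0 by (subst final_state_eq) (simp_all add: tn)
    have \<eta>_supp: "\<eta> p = 0" if "p \<notin> words P \<times> words P" for p
      using that by (cases p) (auto simp: \<eta>)
    have code: "(\<Sum>x\<in>words P. (cmod (?V x))\<^sup>2) = 1"
      using finite_words code_subset zero_in_code by (intro sum_uniform_state) auto
    have \<eta>_norm: "(\<Sum>p\<in>words P \<times> words P. (cmod (\<eta> p))\<^sup>2) = 1"
    proof -
      have "(\<Sum>p\<in>words P \<times> words P. (cmod (\<eta> p))\<^sup>2) = (\<Sum>y\<in>words P. \<Sum>u\<in>words P. (cmod (\<eta> (y, u)))\<^sup>2)"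
        by (simp add: sum.cartesian_product)
      also have "\<dots> = (\<Sum>y\<in>words P. \<Sum>u\<in>words P.
          (cmod (W.ift (W.decoded (dec P) (W.ft ?V) (W.ft ?W) y) u))\<^sup>2)"
        by (intro sum.cong) (auto simp: \<eta>)
      also have "\<dots> = 1"
        using W.sum_decoded[of "dec P" "W.ft ?V" "W.ft ?W"] dec_closed W.parseval_ft[of ?V] W.parseval_ft[of ?W]
        by (simp add: code W_norm)
      finally show ?thesis .
    qed
    have no: "(\<exists>i<n. s i = None) = False" using si by auto
    have "g s = map_pmf (\<lambda>r. Some (fst r)) (qmeasure snd \<eta>)"
      unfolding g_def no if_False \<eta>_def map_pmf_def case_prod_unfold by (rule refl)
    then have "measure_pmf.prob (g s) {\<pi>. \<not> verify P G \<pi>}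
        = measure_pmf.prob (qmeasure snd \<eta>) {r. \<not> verify P G (Some (fst r))}"
      by (simp add: vimage_def)
    also have "\<dots> = (\<Sum>b | b \<in> words P \<times> words P \<and> \<not> verify P G (Some (snd b)). (cmod (\<eta> b))\<^sup>2)"
      using finite_words \<eta>_supp \<eta>_norm by (intro prob_qmeasure) auto
    also have "{b. b \<in> words P \<times> words P \<and> \<not> verify P G (Some (snd b))}
        = words P \<times> {u \<in> words P. \<not> (u \<in> code P \<and> ?W u \<noteq> 0)}"
    proof -
      have "verify P G (Some u) \<longleftrightarrow> u \<in> code P \<and> ?W u \<noteq> 0" if "u \<in> words P" for u
        unfolding verify_def W_nz[OF that] by simp
      then show ?thesis by auto
    qed
    also have "(\<Sum>b\<in>\<dots>. (cmod (\<eta> b))\<^sup>2)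
        = (\<Sum>y\<in>words P. \<Sum>u\<in>{u \<in> words P. \<not> (u \<in> code P \<and> ?W u \<noteq> 0)}. (cmod (\<eta> (y, u)))\<^sup>2)"
      by (simp add: sum.cartesian_product)
    also have "\<dots> = (\<Sum>y\<in>words P. \<Sum>u\<in>{u \<in> words P. \<not> (u \<in> code P \<and> ?W u \<noteq> 0)}.
          (cmod (W.ift (W.decoded (dec P) (W.ft ?V) (W.ft ?W) y) u))\<^sup>2)"
      by (intro sum.cong) (auto simp: \<eta>)
    also have "\<dots> \<le> failure_mass ?W"
      using W.decoding_failure[of "dec P" "code P" "dual_code P" bad_errors ?W]
        dec_closed code_subset zero_in_code ft_code_eq_0 bad_errors_subset
      unfolding failure_mass_def bad_part_def by (auto simp: bad_errors_def)
    finally show "measure_pmf.prob (g s) {\<pi>. \<not> verify P G \<pi>} \<le> failure_mass ?W" .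
  qed
  moreover have "prove P l G = bind_pmf ?S g"
    unfolding prove_def g_def ..
  moreover have "measure_pmf.prob ?S {s. \<exists>i\<in>{..<n}. s i = None}
      \<le> (\<Sum>i<n. measure_pmf.prob (repeat_trial l (trial P G i)) {y. y = None})"
    by (rule prob_Pi_pmf_ex_le) simp
  moreover have "measure_pmf.prob (repeat_trial l (trial P G i)) {y. y = None} = (1 - card (accepting G i) / Q) ^ l" for i
    by (simp add: measure_pmf_single pmf_repeat_trial_None pmf_trial_None)
  ultimately show ?thesis by simp
qed

end


section \<open>Second moments over an oracle family\<close>

lemma sum_sum_prod_PiE:
  fixes F :: "'i \<Rightarrow> 'x \<Rightarrow> 'x \<Rightarrow> 'c :: comm_semiring_1"
  assumes "finite I" "finite A"
  shows "(\<Sum>e\<in>PiE I (\<lambda>_. A). \<Sum>e'\<in>PiE I (\<lambda>_. A). \<Prod>i\<in>I. F i (e i) (e' i)) = (\<Prod>i\<in>I. \<Sum>x\<in>A. \<Sum>x'\<in>A. F i x x')"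
proof -
  have "(\<Sum>e\<in>PiE I (\<lambda>_. A). \<Sum>e'\<in>PiE I (\<lambda>_. A). \<Prod>i\<in>I. F i (e i) (e' i))
      = (\<Sum>e\<in>PiE I (\<lambda>_. A). \<Prod>i\<in>I. \<Sum>x'\<in>A. F i (e i) x')"
    using assms by (intro sum.cong refl prod_sum_PiE[symmetric])
  also have "\<dots> = (\<Prod>i\<in>I. \<Sum>x\<in>A. \<Sum>x'\<in>A. F i x x')"
    using assms by (intro prod_sum_PiE[symmetric])
  finally show ?thesis .
qed

lemma prod_of_bool: "finite A \<Longrightarrow> (\<Prod>x\<in>A. of_bool (R x)) = (of_bool (\<forall>x\<in>A. R x) :: 'c :: comm_semiring_1)"
  by (induction A rule: finite_induct) auto

text \<open>One oracle value carries \<open>n\<close> bits, so the independence budget counts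
  distinct symbols of \<open>Z\<close> whereas the probability counts bits. Events forcing bits to
  be True are the ones that arise from products of accepting indicators. \<open>R K\<close> will be
  the shifted oracle for fixed \<open>H\<close> and \<open>j\<close>.\<close>

locale oracle_family = code_setup P for P :: "'f code_data" +
  fixes Ks :: "'k set" and R :: "'k \<Rightarrow> 'f oracle_fun"
  assumes finite_Ks: "finite Ks" and Ks_nonempty: "Ks \<noteq> {}"
    and constraints: "\<lbrakk>Z \<subseteq> alphabet P \<times> {..<n}; card (fst ` Z) \<le> 2 * n\<rbrakk> \<Longrightarrow>
      real (card {K \<in> Ks. \<forall>z\<in>Z. R K (fst z) (snd z)}) / real (card Ks) = (1 / 2) ^ card Z"
begin

text \<open>The expectation over the key, typed so that it applies both to real masses and to
  complex second moments.\<close>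

definition avg :: "('k \<Rightarrow> 'c) \<Rightarrow> 'c :: real_normed_field" where
  "avg X = (\<Sum>K\<in>Ks. X K) / of_nat (card Ks)"

lemma card_Ks_pos: "0 < card Ks"
  using finite_Ks Ks_nonempty by (simp add: card_gt_0_iff)

lemma avg_cong: "(\<And>K. K \<in> Ks \<Longrightarrow> X K = Y K) \<Longrightarrow> avg X = avg Y"
  unfolding avg_def by (simp cong: sum.cong)

lemma avg_const: "avg (\<lambda>_. c) = c"
  unfolding avg_def using card_Ks_pos by simp

lemma avg_add: "avg (\<lambda>K. X K + Y K) = avg X + avg Y"
  unfolding avg_def by (simp add: sum.distrib add_divide_distrib)

lemma avg_cmult: "avg (\<lambda>K. c * X K) = c * avg X"
  unfolding avg_def by (simp add: sum_distrib_left)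

lemma avg_sum: "avg (\<lambda>K. \<Sum>a\<in>A. X a K) = (\<Sum>a\<in>A. avg (X a))"
  unfolding avg_def sum_divide_distrib[symmetric] by (subst sum.swap) simp

lemma avg_of_real: "avg (\<lambda>K. complex_of_real (X K)) = complex_of_real (avg X)"
  unfolding avg_def by simp

lemma avg_mono: "(\<And>K. K \<in> Ks \<Longrightarrow> X K \<le> Y K) \<Longrightarrow> avg X \<le> (avg Y :: real)"
  unfolding avg_def by (intro divide_right_mono sum_mono) auto

lemma avg_constraints:
  assumes "Z \<subseteq> alphabet P \<times> {..<n}" "card (fst ` Z) \<le> 2 * n"
  shows "avg (\<lambda>K. of_bool (\<forall>z\<in>Z. R K (fst z) (snd z))) = ((1 / 2) ^ card Z :: real)"
  using constraints[OF assms] finite_Ks unfolding avg_def by (simp add: Int_def)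

text \<open>Distinct symbols give two independent fair bits, a repeated symbol only one: 1/4 against
  1/2. Two symbols fit into the budget because \<open>n\<close> is positive.\<close>

lemma avg_pair:
  assumes "x \<in> alphabet P" "x' \<in> alphabet P" "i < n"
  shows "avg (\<lambda>K. of_bool (R K x i) * of_bool (R K x' i)) = ((1 + of_bool (x = x')) / 4 :: real)"
proof -
  let ?Z = "{(x, i), (x', i)}"
  have "card (fst ` ?Z) \<le> 2" by (simp add: card_insert_if)
  then have "card (fst ` ?Z) \<le> 2 * n" using n_pos by linarith
  then have "avg (\<lambda>K. of_bool (\<forall>z\<in>?Z. R K (fst z) (snd z))) = ((1 / 2) ^ card ?Z :: real)"
    using assms by (intro avg_constraints) auto
  moreover have "((1 / 2) ^ card ?Z :: real) = (1 + of_bool (x = x')) / 4"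
    by (auto simp: card_insert_if power2_eq_square)
  ultimately show ?thesis by (simp add: of_bool_conj)
qed

text \<open>Bits at different positions are different bits even when the symbols coincide, so the
  constraints split by position into one or two bits each. The symbols involved are values of
  \<open>e\<close> and \<open>e'\<close>, at most \<open>2 * n\<close> of them.\<close>

lemma avg_words:
  assumes e: "e \<in> words P" and e': "e' \<in> words P"
  shows "avg (\<lambda>K. (\<Prod>i<n. of_bool (R K (e i) i)) * (\<Prod>i<n. of_bool (R K (e' i) i)))
    = (\<Prod>i<n. (1 + of_bool (e i = e' i)) / 4 :: real)"
proof -
  define Z where "Z = (\<Union>i<n. {(e i, i), (e' i, i)})"
  have "fst ` Z \<subseteq> e ` {..<n} \<union> e' ` {..<n}" by (auto simp: Z_def)
  then have "card (fst ` Z) \<le> card (e ` {..<n} \<union> e' ` {..<n})" by (intro card_mono) auto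
  also have "\<dots> \<le> card (e ` {..<n}) + card (e' ` {..<n})" by (rule card_Un_le)
  also have "\<dots> \<le> n + n" using card_image_le[of "{..<n}" e] card_image_le[of "{..<n}" e'] by simp
  finally have cZ: "card (fst ` Z) \<le> 2 * n" by simp
  have "avg (\<lambda>K. (\<Prod>i<n. of_bool (R K (e i) i)) * (\<Prod>i<n. of_bool (R K (e' i) i)))
      = (avg (\<lambda>K. of_bool (\<forall>z\<in>Z. R K (fst z) (snd z))) :: real)"
    by (intro avg_cong) (auto simp: prod_of_bool Z_def simp flip: of_bool_conj)
  also have "\<dots> = (1 / 2) ^ card Z"
    using e e' cZ by (intro avg_constraints) (auto simp: Z_def)
  also have "card Z = (\<Sum>i<n. card {(e i, i), (e' i, i)})"
    unfolding Z_def by (intro card_UN_disjoint) auto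
  also have "(1 / 2 :: real) ^ \<dots> = (\<Prod>i<n. (1 / 2) ^ card {(e i, i), (e' i, i)})"
    by (rule power_sum)
  also have "\<dots> = (\<Prod>i<n. (1 + of_bool (e i = e' i)) / 4)"
    by (intro prod.cong) (auto simp: card_insert_if power2_eq_square)
  finally show ?thesis .
qed

text \<open>
  \<open>w K\<close> is the state \<open>|\<phi>\<rangle>\<close> with the norm of each factor replaced by its
  typical value. Without the random normalisation, second moments of \<open>w K\<close> involve only \<open>2 * n\<close>
  values of the oracle.
\<close>

definition w :: "'k \<Rightarrow> 'f word \<Rightarrow> complex" where
  "w K e = (if e \<in> words P then \<Prod>i<n. complex_of_real (sqrt (2 / Q)) * of_bool (R K (e i) i) else 0)"

text \<open>An even mixture of the point mass at zero and the uniform distribution on the whole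
  alphabet. \<open>noise\<close> differs only in that its uniform half omits zero.\<close>

definition err :: "'f symbol \<Rightarrow> real" where
  "err a = 1 / (2 * Q) + (if a = zero_symbol P then 1 / 2 else 0)"

lemma avg_w:
  assumes e: "e \<in> words P" and e': "e' \<in> words P"
  shows "avg (\<lambda>K. w K e * cnj (w K e')) = (\<Prod>i<n. (1 + of_bool (e i = e' i)) / (2 * of_nat Q))"
proof -
  have s: "complex_of_real (sqrt (2 / Q)) * complex_of_real (sqrt (2 / Q)) = complex_of_real (2 / Q)"
    unfolding of_real_mult[symmetric] by simp
  have bool: "cnj (of_bool b) = of_bool b" "complex_of_real (of_bool b) = of_bool b" for b
    by (cases b; simp)+
  have "w K e * cnj (w K e') = complex_of_real (2 / Q) ^ n *
      complex_of_real ((\<Prod>i<n. of_bool (R K (e i) i)) * (\<Prod>i<n. of_bool (R K (e' i) i)))" for K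
    using e e' unfolding w_def s[symmetric] power_mult_distrib by (simp add: prod.distrib bool)
  then have "avg (\<lambda>K. w K e * cnj (w K e'))
      = complex_of_real (2 / Q) ^ n * complex_of_real (\<Prod>i<n. (1 + of_bool (e i = e' i)) / 4)"
    by (simp only: avg_cmult avg_of_real avg_words[OF e e'])
  also have "\<dots> = (\<Prod>i<n. complex_of_real (2 / Q) * complex_of_real ((1 + of_bool (e i = e' i)) / 4))"
    unfolding prod.distrib by simp
  also have "\<dots> = (\<Prod>i<n. (1 + of_bool (e i = e' i)) / (2 * of_nat Q))"
    by (intro prod.cong) auto
  finally show ?thesis .
qed

text \<open>The kernel is a constant plus the identity. The constant survives the transform only at
  \<open>a = b = 0\<close>, the identity on the whole diagonal; these are the two terms of
  \<open>err\<close>.\<close>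

lemma symbol_kernel:
  assumes a: "a \<in> alphabet P" and b: "b \<in> alphabet P"
  shows "(\<Sum>x\<in>alphabet P. \<Sum>x'\<in>alphabet P. (1 + of_bool (x = x')) / (2 * of_nat Q)
      * (omega_trace P (dot P x a) * cnj (omega_trace P (dot P x' b))))
    = (if a = b then of_nat Q * complex_of_real (err a) else 0)"
proof -
  let ?\<omega> = "\<lambda>x a. omega_trace P (dot P x a)"
  have sum0: "(\<Sum>x\<in>alphabet P. ?\<omega> x c) = (if c = zero_symbol P then of_nat Q else 0)" if c: "c \<in> alphabet P" for c
    using sum_omega_dot[OF c] c by (simp add: omega_dot_commute[OF _ c] cong: sum.cong)
  have orth: "(\<Sum>x\<in>alphabet P. ?\<omega> x a * cnj (?\<omega> x b)) = (if a = b then of_nat Q else 0)"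
    using omega_dot_orthogonal[OF a b] a b
    by (simp add: omega_dot_commute[OF _ a] omega_dot_commute[OF _ b] cong: sum.cong)
  have "(\<Sum>x\<in>alphabet P. \<Sum>x'\<in>alphabet P. (1 + of_bool (x = x')) / (2 * of_nat Q) * (?\<omega> x a * cnj (?\<omega> x' b)))
      = ((\<Sum>x\<in>alphabet P. \<Sum>x'\<in>alphabet P. ?\<omega> x a * cnj (?\<omega> x' b))
        + (\<Sum>x\<in>alphabet P. \<Sum>x'\<in>alphabet P. if x = x' then ?\<omega> x a * cnj (?\<omega> x b) else 0)) / (2 * of_nat Q)"
    unfolding sum.distrib[symmetric] sum_divide_distrib
    by (intro sum.cong) (auto simp: field_simps)
  also have "(\<Sum>x\<in>alphabet P. \<Sum>x'\<in>alphabet P. ?\<omega> x a * cnj (?\<omega> x' b))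
      = (\<Sum>x\<in>alphabet P. ?\<omega> x a) * cnj (\<Sum>x'\<in>alphabet P. ?\<omega> x' b)"
    by (simp add: sum_product)
  also have "(\<Sum>x\<in>alphabet P. \<Sum>x'\<in>alphabet P. if x = x' then ?\<omega> x a * cnj (?\<omega> x b) else 0)
      = (\<Sum>x\<in>alphabet P. ?\<omega> x a * cnj (?\<omega> x b))"
    using finite_alphabet by (intro sum.cong) auto
  finally show ?thesis
    unfolding sum0[OF a] sum0[OF b] orth using card_alphabet_pos
    by (auto simp: err_def field_simps)
qed

text \<open>Characters and second moments are both products over the positions, so the double sum
  factors into symbol kernels, and a single position with \<open>a i \<noteq> b i\<close>
  annihilates it.\<close>

lemma avg_ft:
  assumes a: "a \<in> words P" and b: "b \<in> words P"
  shows "avg (\<lambda>K. W.ft (w K) a * cnj (W.ft (w K) b)) = (if a = b then complex_of_real (\<Prod>i<n. err (a i)) else 0)"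
proof -
  let ?k = "\<lambda>i x x'. (1 + of_bool (x = x')) / (2 * of_nat Q)
      * (omega_trace P (dot P x (a i)) * cnj (omega_trace P (dot P x' (b i))))"
  have "W.ft (w K) a * cnj (W.ft (w K) b)
      = 1 / of_nat NW * (\<Sum>e\<in>words P. \<Sum>e'\<in>words P. (word_char e a * cnj (word_char e' b)) * (w K e * cnj (w K e')))" for K
    unfolding W.ft_def W.sqrt_N_mult[symmetric, simplified]
    by (simp add: sum_product sum_divide_distrib mult_ac)
  then have "avg (\<lambda>K. W.ft (w K) a * cnj (W.ft (w K) b))
      = 1 / of_nat NW * (\<Sum>e\<in>words P. \<Sum>e'\<in>words P. (word_char e a * cnj (word_char e' b)) * avg (\<lambda>K. w K e * cnj (w K e')))"
    by (simp only: avg_cmult avg_sum)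
  also have "(\<Sum>e\<in>words P. \<Sum>e'\<in>words P. (word_char e a * cnj (word_char e' b)) * avg (\<lambda>K. w K e * cnj (w K e')))
      = (\<Sum>e\<in>words P. \<Sum>e'\<in>words P. \<Prod>i<n. ?k i (e i) (e' i))"
    unfolding word_char_def cnj_prod
    by (intro sum.cong refl) (simp only: avg_w prod.distrib[symmetric] mult_ac)
  also have "\<dots> = (\<Prod>i<n. \<Sum>x\<in>alphabet P. \<Sum>x'\<in>alphabet P. ?k i x x')"
    unfolding words_def by (intro sum_sum_prod_PiE) (auto simp: finite_alphabet)
  also have "\<dots> = (\<Prod>i<n. if a i = b i then of_nat Q * complex_of_real (err (a i)) else 0)"
    using a b by (intro prod.cong symbol_kernel) auto
  also have "1 / of_nat NW * \<dots> = (if a = b then complex_of_real (\<Prod>i<n. err (a i)) else 0)"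
  proof (cases "a = b")
    case True
    then show ?thesis using card_alphabet_pos by (simp add: card_words prod.distrib)
  next
    case False
    then obtain i where "i < n" "a i \<noteq> b i"
      using a b PiE_ext[of a "{..<n}" "\<lambda>_. alphabet P" b] by (auto simp: words_def)
    then have "(\<Prod>i<n. if a i = b i then of_nat Q * complex_of_real (err (a i)) else 0) = 0"
      by (intro prod_zero) auto
    then show ?thesis using False by simp
  qed
  finally show ?thesis .
qed

text \<open>As \<open>err\<close> sums to 1 over the alphabet, this is the probability of a bad
  error under its \<open>n\<close>-fold product.\<close>

definition \<beta> :: real where
  "\<beta> = (\<Sum>e\<in>bad_errors. \<Prod>i<n. err (e i))"

lemma finite_bad_errors: "finite bad_errors"
  using bad_errors_subset finite_words finite_subset by blast

lemma avg_bad_ft: "avg (\<lambda>K. \<Sum>e\<in>bad_errors. (cmod (W.ft (w K) e))\<^sup>2) = \<beta>"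
proof -
  have "complex_of_real (avg (\<lambda>K. \<Sum>e\<in>bad_errors. (cmod (W.ft (w K) e))\<^sup>2)) = complex_of_real \<beta>"
    unfolding avg_of_real[symmetric] of_real_sum complex_norm_square avg_sum \<beta>_def
    using bad_errors_subset by (intro sum.cong) (auto simp: avg_ft subset_iff)
  then show ?thesis by (simp only: of_real_eq_iff)
qed

text \<open>Expanding the square gives pairs of bad errors with phases depending on
  \<open>u\<close>. Pairs off the diagonal average to 0 and on the diagonal the phases cancel, so
  the result is independent of \<open>u\<close>.\<close>

lemma avg_bad_ift:
  assumes u: "u \<in> words P"
  shows "avg (\<lambda>K. (cmod (W.ift (bad_part (w K)) u))\<^sup>2) = \<beta> / NW"
proof -
  let ?c = "\<lambda>a b. cnj (word_char a u) * word_char b u"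
  have "W.ift (bad_part (w K)) u = (\<Sum>a\<in>bad_errors. W.ft (w K) a * cnj (word_char a u)) / complex_of_real (sqrt NW)" for K
    unfolding W.ift_def bad_part_def using finite_words bad_errors_subset
    by (auto intro!: arg_cong2[where f = "(/)"] sum.mono_neutral_cong_right)
  then have "complex_of_real ((cmod (W.ift (bad_part (w K)) u))\<^sup>2)
      = 1 / of_nat NW * (\<Sum>a\<in>bad_errors. \<Sum>b\<in>bad_errors. ?c a b * (W.ft (w K) a * cnj (W.ft (w K) b)))" for K
    unfolding complex_norm_square W.sqrt_N_mult[symmetric, simplified]
    by (simp add: sum_product sum_divide_distrib mult_ac) (rule sum.swap)
  then have "complex_of_real (avg (\<lambda>K. (cmod (W.ift (bad_part (w K)) u))\<^sup>2))
      = 1 / of_nat NW * (\<Sum>a\<in>bad_errors. \<Sum>b\<in>bad_errors. ?c a b * avg (\<lambda>K. W.ft (w K) a * cnj (W.ft (w K) b)))"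
    by (simp only: avg_of_real[symmetric] avg_cmult avg_sum)
  also have "(\<Sum>a\<in>bad_errors. \<Sum>b\<in>bad_errors. ?c a b * avg (\<lambda>K. W.ft (w K) a * cnj (W.ft (w K) b)))
      = (\<Sum>a\<in>bad_errors. \<Sum>b\<in>bad_errors. if a = b then ?c a a * complex_of_real (\<Prod>i<n. err (a i)) else 0)"
    using bad_errors_subset by (intro sum.cong) (auto simp: avg_ft subset_iff)
  also have "\<dots> = (\<Sum>a\<in>bad_errors. complex_of_real (\<Prod>i<n. err (a i)))"
  proof (intro sum.cong refl)
    fix a assume a: "a \<in> bad_errors"
    then have "cmod (word_char a u) = 1" using W.cmod_chi[of a u] u bad_errors_subset by auto
    then have "?c a a = 1" by (simp add: complex_norm_square[symmetric] mult.commute)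
    then show "(\<Sum>b\<in>bad_errors. if a = b then ?c a a * complex_of_real (\<Prod>i<n. err (a i)) else 0)
        = complex_of_real (\<Prod>i<n. err (a i))"
      using a finite_bad_errors by simp
  qed
  also have "\<dots> = complex_of_real \<beta>" by (simp add: \<beta>_def)
  also have "1 / of_nat NW * complex_of_real \<beta> = complex_of_real (\<beta> / NW)" by simp
  finally show ?thesis by (simp only: of_real_eq_iff)
qed

text \<open>Summed over the code, the constant \<open>\<beta> / NW\<close> cancels the amplification
  \<open>NW / card (code P)\<close>; each of the two terms contributes
  \<open>2 * \<beta>\<close>.\<close>

lemma avg_failure_mass: "avg (\<lambda>K. failure_mass (w K)) = 4 * \<beta>"
proof -
  have c: "0 < card (code P)" "0 < NW"
    using zero_in_code code_subset finite_words finite_subset card_gt_0_iff by blast+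
  have "avg (\<lambda>K. \<Sum>u\<in>code P. (cmod (W.ift (bad_part (w K)) u))\<^sup>2) = (\<Sum>u\<in>code P. \<beta> / NW)"
    unfolding avg_sum using code_subset by (intro sum.cong avg_bad_ift) auto
  then show ?thesis
    unfolding failure_mass_def avg_add avg_cmult avg_bad_ft using c by simp
qed

end


section \<open>The modified protocol\<close>

context oracle_family
begin

section \<open>Comparison of the averaged error distribution with the noise of the decoder\<close>

lemma pmf_noise:
  assumes "a \<in> alphabet P"
  shows "pmf (noise P) a = (if a = zero_symbol P then 1 / 2 else 1 / (2 * (Q - 1)))"
proof -
  have ne: "alphabet P - {zero_symbol P} \<noteq> {}"
    using card_alphabet_gt_1 card_mono[of "{zero_symbol P}" "alphabet P"] by auto
  have "pmf (noise P) a = pmf (return_pmf (zero_symbol P)) a / 2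
      + pmf (pmf_of_set (alphabet P - {zero_symbol P})) a / 2"
    unfolding noise_def pmf_bind by simp
  also have "pmf (pmf_of_set (alphabet P - {zero_symbol P})) a
      = indicator (alphabet P - {zero_symbol P}) a / real (Q - 1)"
    using ne finite_alphabet by (simp add: pmf_of_set)
  finally show ?thesis
    using assms card_alphabet_gt_1 by (auto simp: indicator_def of_nat_diff)
qed

text \<open>The constant \<open>1 + 1 / Q\<close> is the exact ratio at the zero symbol; elsewhere
  \<open>noise\<close> is already the larger of the two.\<close>

lemma err_le: "a \<in> alphabet P \<Longrightarrow> err a \<le> (1 + 1 / Q) * pmf (noise P) a"
proof (cases "a = zero_symbol P")
  case True
  then show "a \<in> alphabet P \<Longrightarrow> err a \<le> (1 + 1 / Q) * pmf (noise P) a"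
    by (simp add: pmf_noise err_def algebra_simps)
next
  case False
  assume a: "a \<in> alphabet P"
  have "err a = 1 * (1 / (2 * Q))" using False by (simp add: err_def)
  also have "\<dots> \<le> (1 + 1 / Q) * (1 / (2 * (Q - 1)))"
    using card_alphabet_gt_1 by (intro mult_mono divide_left_mono) auto
  also have "\<dots> = (1 + 1 / Q) * pmf (noise P) a"
    using a False by (simp add: pmf_noise)
  finally show "err a \<le> (1 + 1 / Q) * pmf (noise P) a" .
qed

lemma err_nonneg: "0 \<le> err a"
  by (simp add: err_def)

lemma \<beta>_le: "\<beta> \<le> (1 + 1 / Q) ^ n * (1 - decoding_prob P)"
proof -
  let ?M = "Pi_pmf {..<n} undefined (\<lambda>_. noise P)"
  let ?S = "{e. \<forall>x\<in>dual_code P. dec P (x \<oplus>\<^bsub>WS\<^esub> e) = x}"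
  have "\<beta> \<le> (\<Sum>e\<in>bad_errors. \<Prod>i<n. (1 + 1 / Q) * pmf (noise P) (e i))"
    unfolding \<beta>_def using bad_errors_subset err_le err_nonneg
    by (intro sum_mono prod_mono) (auto simp: subset_iff)
  also have "\<dots> = (1 + 1 / Q) ^ n * (\<Sum>e\<in>bad_errors. \<Prod>i<n. pmf (noise P) (e i))"
    by (simp add: prod.distrib sum_distrib_left)
  also have "(\<Sum>e\<in>bad_errors. \<Prod>i<n. pmf (noise P) (e i)) = (\<Sum>e\<in>bad_errors. pmf ?M e)"
    using bad_errors_subset
    by (intro sum.cong refl pmf_Pi'[symmetric]) (auto simp: words_def PiE_def extensional_def subset_iff)
  also have "\<dots> = measure_pmf.prob ?M bad_errors"
    by (rule measure_measure_pmf_finite[OF finite_bad_errors, symmetric])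
  also have "\<dots> \<le> measure_pmf.prob ?M (UNIV - ?S)"
    by (intro measure_pmf.finite_measure_mono) (auto simp: bad_errors_def)
  also have "\<dots> = 1 - decoding_prob P"
    unfolding decoding_prob_def using measure_pmf.prob_compl[of ?S ?M] by simp
  finally show ?thesis by (simp add: mult_left_mono)
qed

section \<open>Concentration of the sizes of the accepting sets\<close>

abbreviation fraction :: "'k \<Rightarrow> nat \<Rightarrow> real" where
  "fraction K i \<equiv> card (accepting (R K) i) / Q"

lemma card_accepting: "real (card (accepting (R K) i)) = (\<Sum>x\<in>alphabet P. of_bool (R K x i))"
  using finite_alphabet by (simp add: accepting_def Int_def)

text \<open>Pairwise independent fair bits give the size mean \<open>Q / 2\<close> and variance
  \<open>Q / 4\<close>, and the scaling by \<open>2 / Q\<close> turns the variance into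
  \<open>1 / Q\<close>.\<close>

lemma avg_fraction_deviation:
  assumes i: "i < n"
  shows "avg (\<lambda>K. (2 * fraction K i - 1)\<^sup>2) = 1 / Q"
proof -
  let ?c = "\<lambda>K. real (card (accepting (R K) i))"
  have c1: "avg ?c = Q / 2"
  proof -
    have "avg ?c = (\<Sum>x\<in>alphabet P. avg (\<lambda>K. of_bool (R K x i) * of_bool (R K x i)))"
      unfolding card_accepting avg_sum[symmetric] by (intro avg_cong sum.cong) auto
    also have "\<dots> = (\<Sum>x\<in>alphabet P. 1 / 2)"
      using i by (intro sum.cong) (auto simp: avg_pair)
    finally show ?thesis by simp
  qed
  have c2: "avg (\<lambda>K. (?c K)\<^sup>2) = (Q\<^sup>2 + Q) / 4"
  proof -
    have "avg (\<lambda>K. (?c K)\<^sup>2) = (\<Sum>x\<in>alphabet P. \<Sum>x'\<in>alphabet P. avg (\<lambda>K. of_bool (R K x i) * of_bool (R K x' i)))"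
      unfolding card_accepting power2_eq_square sum_product avg_sum ..
    also have "\<dots> = (\<Sum>x\<in>alphabet P. \<Sum>x'\<in>alphabet P. (1 + of_bool (x = x')) / 4)"
      using i by (intro sum.cong) (auto simp: avg_pair)
    also have "\<dots> = (\<Sum>x\<in>alphabet P. (Q + 1) / 4)"
    proof (intro sum.cong refl)
      fix x assume x: "x \<in> alphabet P"
      have "(\<Sum>x'\<in>alphabet P. (1 + of_bool (x = x')) / 4 :: real) = (\<Sum>x'\<in>alphabet P. 1 / 4 + (if x = x' then 1 / 4 else 0))"
        by (intro sum.cong) auto
      also have "\<dots> = (Q + 1) / 4"
        using x finite_alphabet by (simp add: sum.distrib add_divide_distrib)
      finally show "(\<Sum>x'\<in>alphabet P. (1 + of_bool (x = x')) / 4 :: real) = (Q + 1) / 4" .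
    qed
    finally show ?thesis by (simp add: power2_eq_square field_simps)
  qed
  have "avg (\<lambda>K. (2 * fraction K i - 1)\<^sup>2) = avg (\<lambda>K. 4 / Q\<^sup>2 * (?c K)\<^sup>2 + (- 4 / Q * ?c K + 1))"
    by (intro avg_cong) (simp add: power2_eq_square algebra_simps)
  also have "\<dots> = 4 / Q\<^sup>2 * ((Q\<^sup>2 + Q) / 4) + (- 4 / Q * (Q / 2) + 1)"
    unfolding avg_add avg_cmult c1 c2 avg_const ..
  also have "\<dots> = 1 / Q"
    using card_alphabet_pos by (simp add: power2_eq_square field_simps)
  finally show ?thesis .
qed

text \<open>The tolerance has to shrink with \<open>n\<close>, because \<open>n\<close>
  normalisation factors are multiplied: (1 - 1/(2n))^n stays above 1/2, whereas a constant tolerance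
  would lose a factor exponential in \<open>n\<close>.\<close>

definition balanced :: "'k \<Rightarrow> nat \<Rightarrow> bool" where
  "balanced K i \<longleftrightarrow> \<bar>2 * fraction K i - 1\<bar> \<le> 1 / (2 * n)"

text \<open>Chebyshev's inequality in pointwise form: the indicator is at most the squared deviation
  divided by the squared tolerance, whose inverse is \<open>4 * n ^ 2\<close>.\<close>

lemma avg_unbalanced:
  assumes i: "i < n"
  shows "avg (\<lambda>K. of_bool (\<not> balanced K i)) \<le> 4 * real n ^ 2 / Q"
proof -
  have "avg (\<lambda>K. of_bool (\<not> balanced K i)) \<le> avg (\<lambda>K. 4 * real n ^ 2 * (2 * fraction K i - 1)\<^sup>2)"
  proof (rule avg_mono)
    fix K
    show "of_bool (\<not> balanced K i) \<le> 4 * real n ^ 2 * (2 * fraction K i - 1)\<^sup>2"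
    proof (cases "balanced K i")
      case False
      then have "1 < 2 * n * \<bar>2 * fraction K i - 1\<bar>"
        using n_pos by (simp add: balanced_def field_simps)
      then have "1\<^sup>2 \<le> (2 * n * \<bar>2 * fraction K i - 1\<bar>)\<^sup>2" by (intro power_mono) auto
      then show ?thesis using False by (simp add: power_mult_distrib)
    qed simp
  qed
  then show ?thesis unfolding avg_cmult avg_fraction_deviation[OF i] by simp
qed

section \<open>From the surrogate state back to the actual one\<close>

lemma failure_mass_scale: "failure_mass (\<lambda>e. c * V e) = (cmod c)\<^sup>2 * failure_mass V"
proof -
  have ft: "W.ft (\<lambda>e. c * V e) u = c * W.ft V u" and ift: "W.ift (\<lambda>e. c * V e) u = c * W.ift V u" for V u
    unfolding W.ft_def W.ift_def by (simp_all add: sum_distrib_left mult.assoc)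
  have "bad_part (\<lambda>e. c * V e) = (\<lambda>e. c * bad_part V e)"
    unfolding bad_part_def by (auto simp: ft)
  then show ?thesis
    unfolding failure_mass_def
    by (simp add: ft ift norm_mult power_mult_distrib sum_distrib_left mult_ac distrib_left)
qed

lemma failure_mass_nonneg: "0 \<le> failure_mass V"
  unfolding failure_mass_def by (intro add_nonneg_nonneg mult_nonneg_nonneg sum_nonneg) auto

text \<open>Each factor is the ratio of the actual amplitude, one over the root of the set size, to
  the typical amplitude \<open>sqrt (2 / Q)\<close>. If some accepting set is empty, both sides are
  0 because \<open>1 / 0 = 0\<close>.\<close>

lemma tensor_accepting_eq:
  "tensor_n n (\<lambda>i. uniform_state (accepting (R K) i))
    = (\<lambda>e. complex_of_real (\<Prod>i<n. sqrt (1 / (2 * fraction K i))) * w K e)"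
proof
  fix e
  show "tensor_n n (\<lambda>i. uniform_state (accepting (R K) i)) e
    = complex_of_real (\<Prod>i<n. sqrt (1 / (2 * fraction K i))) * w K e"
  proof (cases "e \<in> words P")
    case True
    have "uniform_state (accepting (R K) i) (e i)
        = complex_of_real (sqrt (1 / (2 * fraction K i))) * (complex_of_real (sqrt (2 / Q)) * of_bool (R K (e i) i))"
      if i: "i < n" for i
    proof -
      have "sqrt (1 / (2 * fraction K i)) * sqrt (2 / Q) = 1 / sqrt (card (accepting (R K) i))"
        unfolding real_sqrt_mult[symmetric] using card_alphabet_pos by (simp add: real_sqrt_divide)
      then have "complex_of_real (sqrt (1 / (2 * fraction K i))) * complex_of_real (sqrt (2 / Q))
          = complex_of_real (1 / sqrt (card (accepting (R K) i)))"
        by (simp only: of_real_mult[symmetric])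
      then show ?thesis
        using True i by (simp add: uniform_state_def accepting_def mult.assoc[symmetric])
    qed
    then show ?thesis
      using True by (simp add: tensor_n_def w_def in_words_iff prod.distrib)
  qed (simp add: tensor_accepting_eq_0 w_def)
qed

text \<open>A bound for each key separately in which every term can be averaged. For a key with an
  unbalanced position the first sum is at least 1 and the claim is trivial. Otherwise all fractions
  are at least 1/4, whence the 3/4, and the squared change of normalisation is at most 2.\<close>

lemma prob_failure_le:
  "measure_pmf.prob (prove P l (R K)) {\<pi>. \<not> verify P (R K) \<pi>}
    \<le> (\<Sum>i<n. of_bool (\<not> balanced K i)) + (n * (3 / 4) ^ l + 2 * failure_mass (w K))"
proof (cases "\<forall>i<n. balanced K i")
  case False
  then obtain i where i: "i < n" "\<not> balanced K i" by blast
  have "1 \<le> (\<Sum>i<n. of_bool (\<not> balanced K i) :: real)"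
    using i member_le_sum[of i "{..<n}" "\<lambda>i. of_bool (\<not> balanced K i) :: real"] by simp
  moreover have "0 \<le> n * (3 / 4 :: real) ^ l + 2 * failure_mass (w K)"
    using failure_mass_nonneg by (intro add_nonneg_nonneg mult_nonneg_nonneg) auto
  moreover have "measure_pmf.prob (prove P l (R K)) {\<pi>. \<not> verify P (R K) \<pi>} \<le> 1" by simp
  ultimately show ?thesis by linarith
next
  case True
  have lower: "1 - 1 / (2 * n) \<le> 2 * fraction K i" if "i < n" for i
  proof -
    have "\<bar>2 * fraction K i - 1\<bar> \<le> 1 / (2 * n)"
      using True that by (simp only: balanced_def)
    then show ?thesis by linarith
  qed
  have half: "1 / 2 \<le> 1 - 1 / (2 * real n)"
    using n_pos by (simp add: field_simps)
  have quarter: "1 / 4 \<le> fraction K i" if "i < n" for i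
    using lower[OF that] half by linarith
  let ?c = "\<Prod>i<n. sqrt (1 / (2 * fraction K i))"
  have "measure_pmf.prob (prove P l (R K)) {\<pi>. \<not> verify P (R K) \<pi>}
      \<le> (\<Sum>i<n. (1 - fraction K i) ^ l) + failure_mass (tensor_n n (\<lambda>i. uniform_state (accepting (R K) i)))"
    using quarter by (intro prob_prove_failure) force
  also have "(\<Sum>i<n. (1 - fraction K i) ^ l) \<le> (\<Sum>i<n. (3 / 4) ^ l)"
  proof (intro sum_mono power_mono)
    fix i assume i: "i \<in> {..<n}"
    then show "1 - fraction K i \<le> 3 / 4" using quarter[of i] by simp
    show "0 \<le> 1 - fraction K i"
      using card_mono[OF finite_alphabet accepting_subset[of "R K" i]] card_alphabet_pos by simp
  qed
  also have "failure_mass (tensor_n n (\<lambda>i. uniform_state (accepting (R K) i))) = ?c\<^sup>2 * failure_mass (w K)"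
    unfolding tensor_accepting_eq failure_mass_scale by (simp only: norm_of_real power2_abs)
  also have "?c\<^sup>2 = inverse (\<Prod>i<n. 2 * fraction K i)"
    unfolding prod_power_distrib prod_inversef[symmetric] using quarter
    by (intro prod.cong) (auto simp: divide_simps)
  also have "\<dots> \<le> inverse (1 / 2)"
  proof (rule le_imp_inverse_le)
    \<comment> \<open>Written as the left side of Bernoulli's inequality with increment
      \<open>- 1 / (2 * n)\<close>.\<close>
    have "1 / 2 = 1 + real n * (- 1 / (2 * n))" using n_pos by simp
    also have "\<dots> \<le> (1 + - 1 / (2 * n)) ^ n"
      using half by (intro Bernoulli_inequality) simp
    also have "\<dots> = (\<Prod>i<n. 1 - 1 / (2 * n))" by simp
    also have "\<dots> \<le> (\<Prod>i<n. 2 * fraction K i)"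
      using lower half by (intro prod_mono) auto
    finally show "1 / 2 \<le> (\<Prod>i<n. 2 * fraction K i)" .
  qed simp
  finally show ?thesis
    using True failure_mass_nonneg by (simp add: mult_right_mono)
qed

lemma avg_prob_failure_le:
  "avg (\<lambda>K. measure_pmf.prob (prove P l (R K)) {\<pi>. \<not> verify P (R K) \<pi>})
    \<le> 4 * real n ^ 3 / Q + n * (3 / 4) ^ l + 8 * ((1 + 1 / Q) ^ n * (1 - decoding_prob P))"
proof -
  have "avg (\<lambda>K. measure_pmf.prob (prove P l (R K)) {\<pi>. \<not> verify P (R K) \<pi>})
      \<le> avg (\<lambda>K. (\<Sum>i<n. of_bool (\<not> balanced K i)) + (n * (3 / 4) ^ l + 2 * failure_mass (w K)))"
    by (intro avg_mono prob_failure_le)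
  \<comment> \<open>The 8 is the factor 2 from the normalisation times the 4 of
    \<open>avg_failure_mass\<close>.\<close>
  also have "\<dots> = (\<Sum>i<n. avg (\<lambda>K. of_bool (\<not> balanced K i))) + (n * (3 / 4) ^ l + 8 * \<beta>)"
    unfolding avg_add avg_sum avg_const avg_cmult avg_failure_mass by simp
  also have "(\<Sum>i<n. avg (\<lambda>K. of_bool (\<not> balanced K i))) \<le> (\<Sum>i<n. 4 * real n ^ 2 / Q)"
    by (intro sum_mono avg_unbalanced) auto
  also have "\<dots> = 4 * real n ^ 3 / Q" by (simp add: power3_eq_cube power2_eq_square)
  finally show ?thesis using \<beta>_le by simp
qed

end

section \<open>From independent keys to the shifted oracle and the full protocol\<close>

lemma k_wise_independent_event:
  assumes ind: "k_wise_independent k Ks f X Y" and S: "S \<subseteq> X" "finite S" "card S \<le> k"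
    and Y: "finite Y" and B: "\<And>x. x \<in> S \<Longrightarrow> B x \<subseteq> Y"
  shows "real (card {K \<in> Ks. \<forall>x\<in>S. f K x \<in> B x}) / real (card Ks) = (\<Prod>x\<in>S. real (card (B x)) / real (card Y))"
proof -
  have Ks: "finite Ks" "Ks \<noteq> {}" using ind by (auto simp: k_wise_independent_def)
  have fin: "finite (PiE S B)" using S Y B finite_subset by (intro finite_PiE) blast+
  let ?E = "\<lambda>y. {K \<in> Ks. \<forall>x\<in>S. f K x = y x}"
  have E: "real (card (?E y)) / real (card Ks) = (1 / real (card Y)) ^ card S" if y: "y \<in> PiE S B" for y
  proof -
    have "y \<in> S \<rightarrow> Y" using y B by fastforce
    then have "measure_pmf.prob (pmf_of_set Ks) {K. \<forall>x\<in>S. f K x = y x} = (1 / real (card Y)) ^ card S"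
      using ind S by (auto simp: k_wise_independent_def)
    then show ?thesis using Ks by (simp add: measure_pmf_of_set Int_def)
  qed
  \<comment> \<open>Independence is given for exactly prescribed values only, so the event is
    partitioned by the values taken on \<open>S\<close>. All parts are equally likely, and their
    number is the product of the sizes of the \<open>B x\<close>.\<close>
  have "{K \<in> Ks. \<forall>x\<in>S. f K x \<in> B x} = (\<Union>y\<in>PiE S B. ?E y)"
  proof (intro equalityI subsetI)
    fix K assume K: "K \<in> {K \<in> Ks. \<forall>x\<in>S. f K x \<in> B x}"
    then have "restrict (f K) S \<in> PiE S B" "K \<in> ?E (restrict (f K) S)" by auto
    then show "K \<in> (\<Union>y\<in>PiE S B. ?E y)" by blast
  qed (auto simp: PiE_def Pi_def)
  also have "card \<dots> = (\<Sum>y\<in>PiE S B. card (?E y))"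
  proof (rule card_UN_disjoint[OF fin])
    show "\<forall>y\<in>PiE S B. finite (?E y)" using Ks by simp
    show "\<forall>y\<in>PiE S B. \<forall>y'\<in>PiE S B. y \<noteq> y' \<longrightarrow> ?E y \<inter> ?E y' = {}"
    proof (intro ballI impI)
      fix y y' assume y: "y \<in> PiE S B" "y' \<in> PiE S B" "y \<noteq> y'"
      then obtain x where "x \<in> S" "y x \<noteq> y' x" using PiE_ext[of y S B y'] by blast
      then show "?E y \<inter> ?E y' = {}" by auto
    qed
  qed
  also have "real \<dots> / real (card Ks) = (\<Sum>y\<in>PiE S B. (1 / real (card Y)) ^ card S)"
    unfolding of_nat_sum sum_divide_distrib by (intro sum.cong refl E)
  also have "\<dots> = (\<Prod>x\<in>S. real (card (B x)) / real (card Y))"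
    using S by (simp add: card_PiE prod_dividef power_one_over divide_simps)
  finally show ?thesis .
qed

text \<open>This is where the worst-case \<open>H\<close> disappears. A shifted bit is True exactly
  when the bit of \<open>f\<close> is the negated bit of \<open>H\<close>, so the constraints
  confine each \<open>f K x\<close> to a subcube \<open>B x\<close> of the bit strings. Whatever
  \<open>H\<close> is, every constrained bit halves the subcube.\<close>

lemma (in code_setup) oracle_family_shifted:
  assumes ind: "k_wise_independent k Ks f (alphabet P) (bit_strings n)" and k: "2 * n \<le> k"
  shows "oracle_family P Ks (\<lambda>K. shifted_oracle P H f K j)"
proof (intro oracle_family.intro oracle_family_axioms.intro code_setup_axioms)
  show "finite Ks" "Ks \<noteq> {}" using ind by (auto simp: k_wise_independent_def)
  fix Z assume Z: "Z \<subseteq> alphabet P \<times> {..<n}" and cZ: "card (fst ` Z) \<le> 2 * n"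
  let ?S = "fst ` Z"
  have finZ: "finite Z" using Z finite_alphabet finite_subset by blast
  define D where "D x i = (if (x, i) \<in> Z then {\<not> H (j, x) i} else UNIV)" for x i
  define B where "B x = PiE {..<n} (D x)" for x
  have "{K \<in> Ks. \<forall>z\<in>Z. shifted_oracle P H f K j (fst z) (snd z)} = {K \<in> Ks. \<forall>x\<in>?S. f K x \<in> B x}"
  proof (intro Collect_cong conj_cong refl)
    fix K assume K: "K \<in> Ks"
    have f: "f K x \<in> bit_strings n" if "x \<in> alphabet P" for x
      using ind K that by (auto simp: k_wise_independent_def)
    show "(\<forall>z\<in>Z. shifted_oracle P H f K j (fst z) (snd z)) \<longleftrightarrow> (\<forall>x\<in>?S. f K x \<in> B x)"
    proof
      assume L: "\<forall>z\<in>Z. shifted_oracle P H f K j (fst z) (snd z)"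
      show "\<forall>x\<in>?S. f K x \<in> B x"
      proof
        fix x assume "x \<in> ?S"
        then have "f K x \<in> bit_strings n" using Z f by auto
        moreover have "f K x i \<in> D x i" if "i < n" for i
          using L that by (auto simp: D_def shifted_oracle_def)
        ultimately show "f K x \<in> B x" by (auto simp: B_def bit_strings_def PiE_def)
      qed
    next
      assume Rr: "\<forall>x\<in>?S. f K x \<in> B x"
      show "\<forall>z\<in>Z. shifted_oracle P H f K j (fst z) (snd z)"
      proof
        fix z assume z: "z \<in> Z"
        obtain x i where xi: "z = (x, i)" by (cases z)
        then have i: "i < n" "x \<in> ?S" using z Z by force+
        then have "f K x i \<in> D x i" using Rr by (auto simp: B_def)
        then show "shifted_oracle P H f K j (fst z) (snd z)"
          using z i by (auto simp: D_def xi shifted_oracle_def)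
      qed
    qed
  qed
  moreover have "real (card {K \<in> Ks. \<forall>x\<in>?S. f K x \<in> B x}) / real (card Ks)
      = (\<Prod>x\<in>?S. real (card (B x)) / real (card (bit_strings n)))"
  proof (rule k_wise_independent_event[OF ind])
    show "finite (bit_strings n)" unfolding bit_strings_def by (intro finite_PiE) auto
    show "B x \<subseteq> bit_strings n" for x unfolding B_def bit_strings_def by (intro PiE_mono) auto
  qed (use Z cZ k finZ in auto)
  moreover have "real (card (B x)) / real (card (bit_strings n)) = (1 / 2) ^ card {i. (x, i) \<in> Z}" for x
  proof -
    have sub: "{i. (x, i) \<in> Z} \<subseteq> {..<n}" using Z by auto
    have "real (card (B x)) / real (card (bit_strings n)) = (\<Prod>i<n. real (card (D x i)) / 2)"
      unfolding B_def bit_strings_def by (simp add: card_PiE prod_dividef)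
    also have "\<dots> = (\<Prod>i<n. if i \<in> {i. (x, i) \<in> Z} then 1 / 2 else 1)"
      by (intro prod.cong) (auto simp: D_def)
    also have "\<dots> = (1 / 2) ^ card {i. (x, i) \<in> Z}"
      using sub by (simp add: prod.If_cases Int_absorb1)
    finally show ?thesis .
  qed
  moreover have "(\<Prod>x\<in>?S. (1 / 2 :: real) ^ card {i. (x, i) \<in> Z}) = (1 / 2) ^ card Z"
  proof -
    \<comment> \<open>\<open>Z\<close> is the disjoint union of its fibres over the symbols, so the
      exponents add up to \<open>card Z\<close>.\<close>
    have "Z = (SIGMA x:?S. {i. (x, i) \<in> Z})" by force
    then have "card Z = (\<Sum>x\<in>?S. card {i. (x, i) \<in> Z})"
      using finZ card_SigmaI[of ?S "\<lambda>x. {i. (x, i) \<in> Z}"]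
      by (metis (no_types, lifting) finite_imageI finite_SigmaI2 finite_subset Z finite_lessThan mem_Collect_eq mem_Sigma_iff subset_iff)
    then show ?thesis by (simp add: power_sum)
  qed
  ultimately show "real (card {K \<in> Ks. \<forall>z\<in>Z. shifted_oracle P H f K j (fst z) (snd z)}) / real (card Ks) = (1 / 2) ^ card Z"
    by simp
qed

text \<open>The \<open>t\<close> runs are correlated through the common key. A union bound for each
  key, followed by exchanging the sums over \<open>K\<close> and \<open>j\<close>, leaves one
  average per \<open>j\<close>, each over its own oracle family.\<close>

lemma (in code_setup) prob_prove_mod_failure:
  assumes ind: "k_wise_independent k Ks f (alphabet P) (bit_strings n)" and k: "2 * n \<le> k"
  shows "measure_pmf.prob (prove_mod P l Ks f t H) {\<pi>. \<not> verify_mod P f t H \<pi>}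
    \<le> t * (4 * real n ^ 3 / Q + n * (3 / 4) ^ l + 8 * ((1 + 1 / Q) ^ n * (1 - decoding_prob P)))"
proof -
  let ?bound = "4 * real n ^ 3 / Q + n * (3 / 4) ^ l + 8 * ((1 + 1 / Q) ^ n * (1 - decoding_prob P))"
  let ?G = "shifted_oracle P H f"
  let ?p = "\<lambda>K j. measure_pmf.prob (prove P l (?G K j)) {\<pi>. \<not> verify P (?G K j) \<pi>}"
  have Ks: "finite Ks" "Ks \<noteq> {}" using ind by (auto simp: k_wise_independent_def)
  define g where "g K = map_pmf (Pair K) (Pi_pmf {..<t} None (\<lambda>j. prove P l (?G K j)))" for K
  have "prove_mod P l Ks f t H = bind_pmf (pmf_of_set Ks) g"
    unfolding prove_mod_def g_def map_pmf_def ..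
  then have "measure_pmf.prob (prove_mod P l Ks f t H) {\<pi>. \<not> verify_mod P f t H \<pi>}
      = (\<Sum>K\<in>Ks. measure_pmf.prob (g K) {\<pi>. \<not> verify_mod P f t H \<pi>}) / card Ks"
    using Ks by (simp add: prob_bind_pmf integral_pmf_of_set)
  also have "\<dots> \<le> (\<Sum>K\<in>Ks. \<Sum>j<t. ?p K j) / card Ks"
  proof (intro divide_right_mono sum_mono)
    fix K
    have "measure_pmf.prob (g K) {\<pi>. \<not> verify_mod P f t H \<pi>}
        = measure_pmf.prob (Pi_pmf {..<t} None (\<lambda>j. prove P l (?G K j))) {\<pi>. \<exists>j\<in>{..<t}. \<not> verify P (?G K j) (\<pi> j)}"
      unfolding g_def by (simp add: vimage_def verify_mod_def Bex_def)
    also have "\<dots> \<le> (\<Sum>j<t. ?p K j)" by (rule prob_Pi_pmf_ex_le) simp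
    finally show "measure_pmf.prob (g K) {\<pi>. \<not> verify_mod P f t H \<pi>} \<le> (\<Sum>j<t. ?p K j)" .
  qed simp
  also have "\<dots> = (\<Sum>j<t. (\<Sum>K\<in>Ks. ?p K j) / card Ks)"
    by (subst sum.swap) (simp add: sum_divide_distrib)
  also have "\<dots> \<le> (\<Sum>j<t. ?bound)"
  proof (rule sum_mono)
    fix j
    interpret oracle_family P Ks "\<lambda>K. ?G K j"
      using ind k by (rule oracle_family_shifted)
    show "(\<Sum>K\<in>Ks. ?p K j) / card Ks \<le> ?bound"
      using avg_prob_failure_le[of l] unfolding avg_def by simp
  qed
  finally show ?thesis by simp
qed

theorem lemma6p10:
  fixes c c' :: real
    and P :: "nat \<Rightarrow> 'f code_data"
    and \<zeta> g :: "nat \<Rightarrow> real" and k d :: nat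
    and t :: "nat \<Rightarrow> nat"
    and Ks :: "nat \<Rightarrow> 'k set" and f :: "nat \<Rightarrow> 'k \<Rightarrow> 'f symbol \<Rightarrow> bits"
  assumes "0 < c" "c < c'" "c' < 1"
    and "\<And>l. l > 0 \<Longrightarrow> code_data_ok (P l)"
    and "\<exists>a>0. \<exists>b>0. \<forall>\<^sub>F l in sequentially.
           2 powr (real l powr a) \<le> real (card (alphabet (P l))) \<and>
           real (card (alphabet (P l))) \<le> 2 powr (real l powr b)"
    and "(\<lambda>l. real (blen (P l))) \<in> \<Theta>(\<lambda>l. real l)"
    and "\<And>l. l > 0 \<Longrightarrow> card (code (P l)) \<ge> 2 ^ (blen (P l) + l)"
    and "\<And>l. l > 0 \<Longrightarrow> 0 \<le> \<zeta> l" "\<zeta> \<in> \<Omega>(\<lambda>_. 1)"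
    and "g \<in> O(\<lambda>l. real l powr c' * ln (real l) ^ k)"
    and "\<And>l. l > 0 \<Longrightarrow> list_recoverable (P l) (\<zeta> l) (2 powr (real l powr c)) (2 powr g l)"
    and "\<exists>a>0. \<forall>\<^sub>F l in sequentially. decoding_prob (P l) \<ge> 1 - 2 powr (- a * real l)"
    and "\<And>l. l > 0 \<Longrightarrow>
           k_wise_independent (2 * (l * blen (P l) + 1)) (Ks l) (f l) (alphabet (P l)) (bit_strings (blen (P l)))"
    and "(\<lambda>l. real (t l)) \<in> O(\<lambda>l. real l ^ d)"
  shows "\<exists>\<nu>. negligible_fun \<nu> \<and>
           (\<forall>l>0. \<forall>H \<in> {..<t l} \<times> alphabet (P l) \<rightarrow> bit_strings (blen (P l)).
              measure_pmf.prob (prove_mod (P l) l (Ks l) (f l) (t l) H)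
                {\<pi>. \<not> verify_mod (P l) (f l) (t l) H \<pi>} \<le> \<nu> l)"
proof -
  define N Q where "N l = real (blen (P l))" and "Q l = real (card (alphabet (P l)))" for l
  define \<delta> where "\<delta> l = 1 - decoding_prob (P l)" for l
  \<comment> \<open>One function must serve all \<open>H\<close>, and indeed the bound for fixed
    \<open>l\<close> does not mention \<open>H\<close>.\<close>
  define \<nu> where "\<nu> l = t l * (4 * N l ^ 3 / Q l + N l * (3 / 4) ^ l + 8 * ((1 + 1 / Q l) ^ blen (P l) * \<delta> l))" for l
  have nonneg: "0 \<le> N l" "0 \<le> Q l" "0 \<le> \<delta> l" for l
    by (simp_all add: N_def Q_def \<delta>_def decoding_prob_def)
  have \<nu>_nonneg: "0 \<le> \<nu> l" for l
    unfolding \<nu>_def using nonneg by simp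
  have bound: "measure_pmf.prob (prove_mod (P l) l (Ks l) (f l) (t l) H) {\<pi>. \<not> verify_mod (P l) (f l) (t l) H \<pi>} \<le> \<nu> l"
    if l: "0 < l" for l H
  proof -
    interpret code_setup "P l" using assms(4)[OF l] by unfold_locales
    \<comment> \<open>Positivity of \<open>l\<close> makes the independence parameter cover the
      \<open>2 * n\<close> symbols of a second moment.\<close>
    have "2 * blen (P l) \<le> 2 * (l * blen (P l) + 1)" using l by (cases l) auto
    from prob_prove_mod_failure[OF assms(13)[OF l] this] show ?thesis
      unfolding \<nu>_def N_def Q_def \<delta>_def .
  qed
  obtain a where a: "0 < a" "\<forall>\<^sub>F l in sequentially. 2 powr (real l powr a) \<le> Q l"
  proof -
    obtain a b where ab: "0 < a" "\<forall>\<^sub>F l in sequentially.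
        2 powr (real l powr a) \<le> Q l \<and> Q l \<le> 2 powr (real l powr b)"
      using assms(5) unfolding Q_def by blast
    show ?thesis by (rule that[OF ab(1)], rule eventually_mono[OF ab(2)]) simp
  qed
  obtain a' where a': "0 < a'" "\<forall>\<^sub>F l in sequentially. \<delta> l \<le> 2 powr (- a' * real l)"
    using assms(12) by (auto simp: \<delta>_def algebra_simps)
  have "(\<lambda>l. N l) \<in> O(\<lambda>l. real l)" using assms(6) unfolding N_def by (rule bigthetaD1)
  then obtain C where C: "0 < C" "\<forall>\<^sub>F l in sequentially. N l \<le> C * real l"
    using nonneg by (auto elim!: landau_o.bigE)
  obtain D where D: "0 < D" "\<forall>\<^sub>F l in sequentially. t l \<le> D * real l ^ d"
    using assms(14) by (auto elim!: landau_o.bigE)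
  \<comment> \<open>\<open>u\<close> will dominate \<open>1 / Q\<close>, \<open>v\<close> is the
    probability bound for \<open>l\<close> failed trials, and \<open>z\<close> dominates the
    decoding error. Each decays faster than every inverse polynomial; for \<open>u\<close> because
    \<open>l powr a\<close> outgrows every multiple of the logarithm.\<close>
  define u v z where "u l = 2 powr (- (real l powr a))" and "v l = (3 / 4 :: real) ^ l"
    and "z l = 2 powr (- a' * real l)" for l
  have u: "(\<lambda>l. real l ^ j * u l) \<longlonglongrightarrow> 0" for j
    unfolding u_def using a(1) by real_asymp
  have v: "(\<lambda>l. real l ^ j * v l) \<longlonglongrightarrow> 0" for j
    unfolding v_def by real_asymp
  have z: "(\<lambda>l. real l ^ j * z l) \<longlonglongrightarrow> 0" for j
    unfolding z_def using a'(1) by real_asymp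
  have "\<forall>\<^sub>F l in sequentially. \<bar>\<nu> l\<bar> < 1 / real l ^ j" for j
  proof -
    \<comment> \<open>This is \<open>l ^ j\<close> times the eventual bound on
      \<open>\<nu> l\<close>. The exponent \<open>d\<close> comes from \<open>t\<close>, the 3 and
      the 1 from powers of the block length, and 24 is 8 times the bound 3 on
      \<open>(1 + 1 / Q) ^ n\<close>.\<close>
    define \<mu> where "\<mu> l = 4 * D * C ^ 3 * (real l ^ (j + d + 3) * u l)
        + D * C * (real l ^ (j + d + 1) * v l) + 24 * D * (real l ^ (j + d) * z l)" for l
    have "\<mu> \<longlonglongrightarrow> 4 * D * C ^ 3 * 0 + D * C * 0 + 24 * D * 0"
      unfolding \<mu>_def by (intro tendsto_add tendsto_mult tendsto_const u v z)
    then have "\<forall>\<^sub>F l in sequentially. \<mu> l < 1" by (intro order_tendstoD) auto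
    \<comment> \<open>Ensures that \<open>N l / Q l\<close> is at most 1, so that
      \<open>(1 + 1 / Q) ^ n\<close> is at most \<open>exp 1\<close>, hence at most 3.\<close>
    moreover have "\<forall>\<^sub>F l in sequentially. real l ^ 1 * u l < 1 / C"
      using u[of 1] C(1) by (intro order_tendstoD) auto
    ultimately show ?thesis
      using a(2) a'(2) C(2) D(2) eventually_gt_at_top[of 0]
    proof eventually_elim
      case (elim l)
      have Q: "0 < Q l" using elim(3) powr_gt_zero[of 2 "real l powr a"] by linarith
      have "1 / Q l \<le> 1 / 2 powr (real l powr a)"
        using elim(3) Q by (intro divide_left_mono) auto
      then have Qu: "1 / Q l \<le> u l" by (simp add: u_def powr_minus_divide)
      have "N l * (1 / Q l) \<le> (C * real l) * u l"
        using elim(5) Qu nonneg[of l] C(1) by (intro mult_mono) auto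
      also have "\<dots> \<le> 1" using elim(2) C(1) by (simp add: field_simps)
      finally have NQ: "N l * (1 / Q l) \<le> 1" .
      have "(1 + 1 / Q l) ^ blen (P l) \<le> exp (1 / Q l) ^ blen (P l)"
        using Q by (intro power_mono exp_ge_add_one_self) auto
      also have "\<dots> = exp (N l * (1 / Q l))"
        unfolding N_def by (rule exp_of_nat_mult[symmetric])
      also have "\<dots> \<le> exp 1" using NQ by simp
      finally have three: "(1 + 1 / Q l) ^ blen (P l) \<le> 3" using exp_le by linarith
      have "\<nu> l \<le> D * real l ^ d * (4 * (C * real l) ^ 3 * u l + C * real l * v l + 8 * (3 * z l))"
        unfolding \<nu>_def
      proof (intro mult_mono[of "real (t l)"] add_mono)
        have "4 * N l ^ 3 / Q l = 4 * N l ^ 3 * (1 / Q l)" by simp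
        also have "\<dots> \<le> 4 * (C * real l) ^ 3 * u l"
          using elim(5) Qu nonneg[of l] C(1) by (intro mult_mono power_mono) auto
        finally show "4 * N l ^ 3 / Q l \<le> 4 * (C * real l) ^ 3 * u l" .
        show "N l * (3 / 4) ^ l \<le> C * real l * v l"
          using elim(5) by (simp add: v_def)
        show "8 * ((1 + 1 / Q l) ^ blen (P l) * \<delta> l) \<le> 8 * (3 * z l)"
          using elim(4) three nonneg[of l] by (intro mult_left_mono mult_mono) (auto simp: z_def)
      qed (use elim(6) D(1) nonneg[of l] in auto)
      then have "real l ^ j * \<nu> l \<le> real l ^ j * (D * real l ^ d * (4 * (C * real l) ^ 3 * u l + C * real l * v l + 8 * (3 * z l)))"
        by (intro mult_left_mono) auto
      also have "\<dots> = \<mu> l"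
        unfolding \<mu>_def by (simp add: power_add power_mult_distrib algebra_simps power3_eq_cube)
      finally have "real l ^ j * \<nu> l < 1" using elim(1) by linarith
      then show ?case using elim(7) \<nu>_nonneg[of l] by (simp add: field_simps)
    qed
  qed
  then have "negligible_fun \<nu>" by (simp add: negligible_fun_def)
  then show ?thesis using bound by blast
qed

end
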